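(* Identify $\mathbb{R}^2\cong\mathbb{C}$ and let $B_1$ be the open unit disk. Let $a_1,\dots,a_N$ ($N\ge1$) be distinct points on $\partial B_1$ with multiplicities $d_1,\dots,d_N\in\mathbb{Z}\setminus\{0\}$ such that $\sum_{j=1}^Nd_j=2$, and let $b\in\partial B_1\setminus\{a_1,\dots,a_N\}$. Then every canonical harmonic map in $B_1$ with prescribed boundary vortices $\{(a_j,d_j)\}$ has the form $$m_*(z)=\pm\,\mathrm{i}\,b\prod_{j=1}^N\Big(\frac{z-a_j}{|z-a_j|}\,\frac{|b-a_j|}{b-a_j}\Big)^{d_j},\qquad z\in B_1.$$ Moreover, if $\Omega\subset\mathbb{R}^2$ is a bounded, simply connected $C^{1,1}$ domain for which there exists a $C^1$ conformal diffeomorphism $\Phi:\overline{B_1}\to\overline\Omega$ with inverse $\Psi$, then $$M_*(w)=m_*(\Psi(w))\,\frac{\Phi'(\Psi(w))}{|\Phi'(\Psi(w))|},\qquad w\in\Omega,$$ is a canonical harmonic map in $\Omega$ with prescribed boundary vortices $\{(\Phi(a_j),d_j)\}$ on $\partial\Omega$.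
   Context: Canonical harmonic map: let $\Omega\subset\mathbb{R}^2$ be a bounded, simply connected $C^{1,1}$ domain with outer unit normal $\nu$, tangent $\tau=\nu^\perp=(-\nu_2,\nu_1)$ and curvature $\varkappa$ of $\partial\Omega$ (so that $\int_{\partial\Omega}\varkappa\,d\mathcal{H}^1=2\pi$). Given $N\ge1$ distinct points $a_1,\dots,a_N\in\partial\Omega$ and $d_1,\dots,d_N\in\mathbb{Z}\setminus\{0\}$ with $\sum d_j=2$, let $\phi:\partial\Omega\to\mathbb{R}$ be a $BV$ function with $e^{\mathrm{i}\phi}\cdot\nu=0$ on $\partial\Omega\setminus\{a_1,\dots,a_N\}$ and $\partial_\tau\phi=\varkappa-\pi\sum_jd_j\delta_{a_j}$ (as measures on $\partial\Omega$). If $\phi_*$ is the harmonic extension of $\phi$ to $\Omega$, then $m_*=e^{\mathrm{i}\phi_*}$ is called a canonical harmonic map associated to $\{(a_j,d_j)\}$ (such $\phi$ is unique up to an additive constant in $\pi\mathbb{Z}$, so there are exactly two such maps $\pm e^{\mathrm{i}\phi_*}$). *)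

theory Defs
  imports "HOL-Complex_Analysis.Complex_Analysis"
begin

definition partial_x :: "(complex \<Rightarrow> real) \<Rightarrow> complex \<Rightarrow> real" where
  "partial_x u = (\<lambda>z. deriv (\<lambda>t::real. u (z + complex_of_real t)) 0)"

definition partial_y :: "(complex \<Rightarrow> real) \<Rightarrow> complex \<Rightarrow> real" where
  "partial_y u = (\<lambda>z. deriv (\<lambda>t::real. u (z + \<i> * complex_of_real t)) 0)"

definition harmonic_on :: "(complex \<Rightarrow> real) \<Rightarrow> complex set \<Rightarrow> bool" where
  "harmonic_on u S \<longleftrightarrow> open S \<and>
     (\<forall>z\<in>S. u differentiable (at z) \<and> partial_x u differentiable (at z)
             \<and> partial_y u differentiable (at z)) \<and>
     continuous_on S (partial_x (partial_x u)) \<and> continuous_on S (partial_y (partial_y u)) \<and>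
     continuous_on S (partial_x (partial_y u)) \<and> continuous_on S (partial_y (partial_x u)) \<and>
     (\<forall>z\<in>S. partial_x (partial_x u) z + partial_y (partial_y u) z = 0)"

text \<open>gamma is an L-periodic arclength parametrisation of the boundary of Omega, with unit
  tangent T (which is Lipschitz, i.e. gamma is C^{1,1}), injective on one period, and
  positively oriented (Omega lies to the left: winding number 1 around points of Omega).
  Then the tangent of the boundary at gamma s is tau = T s and the outer unit normal is
  nu = -i T s (so that tau = nu^perp = i nu).\<close>
definition C11_boundary_param ::
    "complex set \<Rightarrow> real \<Rightarrow> (real \<Rightarrow> complex) \<Rightarrow> (real \<Rightarrow> complex) \<Rightarrow> bool" where
  "C11_boundary_param \<Omega> L \<gamma> T \<longleftrightarrow> L > 0 \<and>
     (\<forall>s. \<gamma> (s + L) = \<gamma> s) \<and>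
     (\<forall>s. (\<gamma> has_vector_derivative T s) (at s)) \<and>
     (\<forall>s. norm (T s) = 1) \<and>
     (\<exists>K. \<forall>s t. norm (T s - T t) \<le> K * \<bar>s - t\<bar>) \<and>
     inj_on \<gamma> {0..<L} \<and>
     \<gamma> ` {0..L} = frontier \<Omega> \<and>
     (\<forall>z\<in>\<Omega>. winding_number (\<lambda>t. \<gamma> (L * t)) z = 1)"

definition C11_domain :: "complex set \<Rightarrow> bool" where
  "C11_domain \<Omega> \<longleftrightarrow> open \<Omega> \<and> connected \<Omega> \<and> \<Omega> \<noteq> {} \<and> bounded \<Omega> \<and> simply_connected \<Omega> \<and>
     (\<exists>L \<gamma> T. C11_boundary_param \<Omega> L \<gamma> T)"

text \<open>kappa is the (a.e. defined, bounded) curvature: T' = i kappa T, i.e.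
  T s = T 0 + integral of i kappa T over [0,s].\<close>
definition curvature_of :: "real \<Rightarrow> (real \<Rightarrow> complex) \<Rightarrow> (real \<Rightarrow> real) \<Rightarrow> bool" where
  "curvature_of L T \<kappa> \<longleftrightarrow> \<kappa> integrable_on {0..L} \<and>
     (\<forall>s\<in>{0..L}. T s = T 0 + integral {0..s} (\<lambda>t. \<i> * complex_of_real (\<kappa> t) * T t))"

text \<open>phi is the boundary phase on the frontier (precise representative, continuous off the
  vortices); phis its harmonic extension (the bounded harmonic function on Omega attaining the
  boundary values phi at every boundary point other than the vortices). The identity
  d/dtau phi = kappa - pi sum d_j delta_{a_j} is stated in the sense of distributions on the
  boundary, pulled back by the arclength parametrisation and tested with C^1 L-periodic
  test functions.\<close>
definition canonical_harmonic_map ::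
    "complex set \<Rightarrow> nat \<Rightarrow> (nat \<Rightarrow> complex) \<Rightarrow> (nat \<Rightarrow> int) \<Rightarrow> (complex \<Rightarrow> complex) \<Rightarrow> bool" where
  "canonical_harmonic_map \<Omega> N a d m \<longleftrightarrow> C11_domain \<Omega> \<and>
     (\<exists>L \<gamma> T \<kappa> s \<phi> \<phi>s.
        C11_boundary_param \<Omega> L \<gamma> T \<and> curvature_of L T \<kappa> \<and>
        (\<forall>j\<in>{1..N}. s j \<in> {0..<L} \<and> \<gamma> (s j) = a j) \<and>
        (\<lambda>t. \<phi> (\<gamma> t)) integrable_on {0..L} \<and>
        continuous_on (frontier \<Omega> - a ` {1..N}) \<phi> \<and>
        (\<forall>x\<in>{0..L}. \<gamma> x \<notin> a ` {1..N} \<longrightarrow>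
            inner (exp (\<i> * complex_of_real (\<phi> (\<gamma> x)))) (- \<i> * T x) = 0) \<and>
        (\<forall>\<zeta> \<zeta>'. (\<forall>t. (\<zeta> has_real_derivative \<zeta>' t) (at t)) \<and> continuous_on UNIV \<zeta>' \<and>
              (\<forall>t. \<zeta> (t + L) = \<zeta> t) \<longrightarrow>
           integral {0..L} (\<lambda>t. \<phi> (\<gamma> t) * \<zeta>' t)
             = - integral {0..L} (\<lambda>t. \<kappa> t * \<zeta> t) + pi * (\<Sum>j=1..N. of_int (d j) * \<zeta> (s j))) \<and>
        harmonic_on \<phi>s \<Omega> \<and> bounded (\<phi>s ` \<Omega>) \<and>
        (\<forall>x\<in>frontier \<Omega> - a ` {1..N}. (\<phi>s \<longlongrightarrow> \<phi> x) (at x within \<Omega>)) \<and>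
        (\<forall>z\<in>\<Omega>. m z = exp (\<i> * complex_of_real (\<phi>s z))))"

end

theory Submission
  imports Defs
begin

text \<open>On the circle the tangential derivative of the boundary phase, curvature minus point masses, is
  that of \<open>\<Sum> d\<^sub>j arg (1 - z / a\<^sub>j)\<close>, each argument being a sawtooth of slope \<open>1/2\<close> with
  jump \<open>- \<pi>\<close> at \<open>a\<^sub>j\<close>, since \<open>\<Sum> d\<^sub>j = 2\<close>. By du Bois-Reymond the two phases differ by a constant, and by
  the maximum principle, in which finitely many boundary points are negligible, so do the harmonic
  extensions. Tangency at \<open>b\<close> fixes the constant modulo \<open>\<pi>\<close>.

  A conformal map \<open>\<Phi>\<close> turns the tangent of the circle into that of \<open>\<partial>\<Omega>\<close> by the rotation \<open>\<Phi>' / \<bar>\<Phi>'\<bar>\<close>, so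
  the phase in \<open>\<Omega>\<close> is the transported one plus \<open>arg \<Phi>'\<close>. On the boundary \<open>arg \<Phi>'\<close> is the tangent angle
  minus the angle on the circle, so it contributes exactly the difference of the two curvatures.\<close>

section \<open>Harmonic functions and the maximum principle\<close>

text \<open>The tangent is only Lipschitz, so the curvature is a density accessible through
  integrals alone. For the target domain it is constructed: after adding a steep linear function the
  tangent angle is increasing, and Radon-Nikodym gives a density against which first-order relations
  dU = c d\<theta> can be integrated. In the disc the situation is reversed: \<open>\<kappa>\<close>
  is any function satisfying \<open>curvature_of\<close>, and since \<open>integral\<close> is 0 for
  nonintegrable functions, even its acting as the constant 1 on test functions needs a proof.

  Writing the phase with 1 - z / a rather than z - a keeps each factor in the right half-plane, so
  the principal logarithm is holomorphic in the disc, continuous up to the circle off a, and of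
  bounded imaginary part; boundedness is what makes the vortices negligible for uniqueness.

  The argument of \<Phi>' is a priori merely continuous on the boundary. Its weak derivative is read
  off as the difference of two angles, the Lipschitz tangent angle and the C^1 angle of \<Psi> along
  the boundary. The winding number hypothesis fixes the sign of the latter.\<close>

lemma partial_cong:
  assumes "open S" and "z \<in> S" and "\<And>w. w \<in> S \<Longrightarrow> u w = v w"
  shows "partial_x u z = partial_x v z" and "partial_y u z = partial_y v z"
proof -
  have *: "\<forall>\<^sub>F t in nhds (0::real). u (z + c * complex_of_real t) = v (z + c * complex_of_real t)" for c
  proof -
    have "((\<lambda>t::real. z + c * complex_of_real t) \<longlongrightarrow> z + c * complex_of_real 0) (nhds 0)"
      by (intro tendsto_intros filterlim_ident)
    then have "\<forall>\<^sub>F t in nhds (0::real). z + c * complex_of_real t \<in> S"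
      using assms(1,2) by (auto dest: topological_tendstoD)
    then show ?thesis
      by eventually_elim (auto intro: assms(3))
  qed
  show "partial_x u z = partial_x v z"
    unfolding partial_x_def using *[of 1] by (intro deriv_cong_ev) auto
  show "partial_y u z = partial_y v z"
    unfolding partial_y_def using *[of "\<i>"] by (intro deriv_cong_ev) auto
qed

lemma has_real_derivative_along_line:
  assumes "(u has_derivative D) (at z)"
  shows "((\<lambda>t::real. u (z + c * complex_of_real t)) has_real_derivative D c) (at 0)"
proof -
  have lin: "linear D"
    using assms has_derivative_linear by blast
  have "((\<lambda>t::real. z + c * complex_of_real t) has_derivative (\<lambda>t. c * complex_of_real t)) (at 0)"
    by (auto intro!: derivative_eq_intros)
  moreover have "(u has_derivative D) (at (z + c * complex_of_real 0))"
    using assms by simp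
  ultimately have "((\<lambda>t::real. u (z + c * complex_of_real t)) has_derivative (\<lambda>t. D (c * complex_of_real t))) (at 0)"
    by (rule has_derivative_compose)
  moreover have "D (c * complex_of_real t) = D c * t" for t
    using linear_scale[OF lin, of t c] by (simp add: scaleR_conv_of_real mult.commute)
  ultimately show ?thesis
    by (simp add: has_field_derivative_def)
qed

lemma partial_eq_derivative:
  assumes "(u has_derivative D) (at z)"
  shows "partial_x u z = D 1" and "partial_y u z = D \<i>"
  using has_real_derivative_along_line[OF assms, of 1] has_real_derivative_along_line[OF assms, of "\<i>"]
  by (auto simp: partial_x_def partial_y_def DERIV_imp_deriv)

lemma partial_has_real_derivative:
  assumes "u differentiable (at z)"
  shows "((\<lambda>t::real. u (z + complex_of_real t)) has_real_derivative partial_x u z) (at 0)"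
    and "((\<lambda>t::real. u (z + \<i> * complex_of_real t)) has_real_derivative partial_y u z) (at 0)"
proof -
  obtain D where D: "(u has_derivative D) (at z)"
    using assms differentiable_def by blast
  show "((\<lambda>t::real. u (z + complex_of_real t)) has_real_derivative partial_x u z) (at 0)"
    "((\<lambda>t::real. u (z + \<i> * complex_of_real t)) has_real_derivative partial_y u z) (at 0)"
    using has_real_derivative_along_line[OF D, of 1] has_real_derivative_along_line[OF D, of "\<i>"]
    by (auto simp: partial_eq_derivative[OF D])
qed

lemma partial_add:
  assumes "u differentiable (at z)" and "v differentiable (at z)"
  shows "partial_x (\<lambda>w. u w + v w) z = partial_x u z + partial_x v z"
    and "partial_y (\<lambda>w. u w + v w) z = partial_y u z + partial_y v z"
proof -
  obtain D E where D: "(u has_derivative D) (at z)" and E: "(v has_derivative E) (at z)"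
    using assms differentiable_def by blast
  have "((\<lambda>w. u w + v w) has_derivative (\<lambda>h. D h + E h)) (at z)"
    using D E by (rule has_derivative_add)
  from partial_eq_derivative[OF this] partial_eq_derivative[OF D] partial_eq_derivative[OF E]
  show "partial_x (\<lambda>w. u w + v w) z = partial_x u z + partial_x v z"
    "partial_y (\<lambda>w. u w + v w) z = partial_y u z + partial_y v z"
    by auto
qed

lemma partial_minus:
  assumes "u differentiable (at z)"
  shows "partial_x (\<lambda>w. - u w) z = - partial_x u z"
    and "partial_y (\<lambda>w. - u w) z = - partial_y u z"
proof -
  obtain D where D: "(u has_derivative D) (at z)"
    using assms differentiable_def by blast
  from partial_eq_derivative[OF has_derivative_minus[OF this]] partial_eq_derivative[OF D]
  show "partial_x (\<lambda>w. - u w) z = - partial_x u z" "partial_y (\<lambda>w. - u w) z = - partial_y u z"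
    by auto
qed

text \<open>The partials of a sum are the sum of the partials only on the open set where both
  functions are differentiable, so differentiability of the partials has to be carried across a
  local equality.\<close>

lemma differentiable_cong_open:
  assumes "u differentiable (at z)" and "open S" and "z \<in> S" and "\<And>w. w \<in> S \<Longrightarrow> u w = v w"
  shows "v differentiable (at z)"
  using assms differentiable_def has_derivative_transform_within_open by metis

lemma harmonic_on_add:
  assumes "harmonic_on u S" and "harmonic_on v S"
  shows "harmonic_on (\<lambda>z. u z + v z) S"
proof -
  have S: "open S"
    using assms by (simp add: harmonic_on_def)
  have du: "u differentiable (at z)" "partial_x u differentiable (at z)" "partial_y u differentiable (at z)"
    and dv: "v differentiable (at z)" "partial_x v differentiable (at z)" "partial_y v differentiable (at z)"
    if "z \<in> S" for z
    using assms that by (auto simp: harmonic_on_def)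
  have lap: "\<And>z. z \<in> S \<Longrightarrow> partial_x (partial_x u) z + partial_y (partial_y u) z = 0"
    "\<And>z. z \<in> S \<Longrightarrow> partial_x (partial_x v) z + partial_y (partial_y v) z = 0"
    using assms by (auto simp: harmonic_on_def)
  define w where "w = (\<lambda>z. u z + v z)"
  have x: "partial_x u z + partial_x v z = partial_x w z"
    and y: "partial_y u z + partial_y v z = partial_y w z" if "z \<in> S" for z
    unfolding w_def using partial_add[OF du(1) dv(1)] that by auto
  have dx: "partial_x w differentiable (at z)" and dy: "partial_y w differentiable (at z)" if "z \<in> S" for z
    using differentiable_cong_open[OF differentiable_add[OF du(2) dv(2)] S that x]
      differentiable_cong_open[OF differentiable_add[OF du(3) dv(3)] S that y] that by auto
  have second: "partial_x (partial_x w) z = partial_x (partial_x u) z + partial_x (partial_x v) z"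
     "partial_y (partial_x w) z = partial_y (partial_x u) z + partial_y (partial_x v) z"
     "partial_x (partial_y w) z = partial_x (partial_y u) z + partial_x (partial_y v) z"
     "partial_y (partial_y w) z = partial_y (partial_y u) z + partial_y (partial_y v) z" if "z \<in> S" for z
    using partial_cong[OF S that x] partial_cong[OF S that y]
      partial_add[OF du(2)[OF that] dv(2)[OF that]] partial_add[OF du(3)[OF that] dv(3)[OF that]]
    by auto
  have "harmonic_on w S"
    unfolding harmonic_on_def
  proof (intro conjI ballI S dx dy)
    show "w differentiable at z" if "z \<in> S" for z
      unfolding w_def using du(1) dv(1) that by auto
    show "partial_x (partial_x w) z + partial_y (partial_y w) z = 0" if "z \<in> S" for z
      using lap(1)[OF that] lap(2)[OF that] second[OF that] by linarith
  qed (use assms second in \<open>auto simp: harmonic_on_def cong: continuous_on_cong intro!: continuous_on_add\<close>)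
  then show ?thesis
    by (simp add: w_def)
qed

lemma harmonic_on_minus:
  assumes "harmonic_on u S"
  shows "harmonic_on (\<lambda>z. - u z) S"
proof -
  have S: "open S"
    using assms by (simp add: harmonic_on_def)
  have du: "u differentiable (at z)" "partial_x u differentiable (at z)" "partial_y u differentiable (at z)"
    if "z \<in> S" for z
    using assms that by (auto simp: harmonic_on_def)
  define w where "w = (\<lambda>z. - u z)"
  have x: "- partial_x u z = partial_x w z" and y: "- partial_y u z = partial_y w z" if "z \<in> S" for z
    unfolding w_def using partial_minus[OF du(1)] that by auto
  have dx: "partial_x w differentiable (at z)" and dy: "partial_y w differentiable (at z)" if "z \<in> S" for z
    using differentiable_cong_open[OF differentiable_minus[OF du(2)] S that x]
      differentiable_cong_open[OF differentiable_minus[OF du(3)] S that y] that by auto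
  have second: "partial_x (partial_x w) z = - partial_x (partial_x u) z"
     "partial_y (partial_x w) z = - partial_y (partial_x u) z"
     "partial_x (partial_y w) z = - partial_x (partial_y u) z"
     "partial_y (partial_y w) z = - partial_y (partial_y u) z" if "z \<in> S" for z
    using partial_cong[OF S that x] partial_cong[OF S that y]
      partial_minus[OF du(2)[OF that]] partial_minus[OF du(3)[OF that]]
    by auto
  have "harmonic_on w S"
    unfolding harmonic_on_def
  proof (intro conjI ballI S dx dy)
    show "w differentiable at z" if "z \<in> S" for z
      unfolding w_def using du(1) that by auto
  qed (use assms second in \<open>auto simp: harmonic_on_def cong: continuous_on_cong intro!: continuous_on_minus\<close>)
  then show ?thesis
    by (simp add: w_def)
qed

section \<open>Imaginary parts of holomorphic functions\<close>

lemma partial_Im_holomorphic: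
  assumes "F holomorphic_on S" and "open S" and "z \<in> S" and "\<And>w. w \<in> S \<Longrightarrow> u w = Im (F w)"
  shows "u differentiable (at z)"
    and "partial_x u z = Im (deriv F z)" and "partial_y u z = Im (\<i> * deriv F z)"
proof -
  have "(F has_derivative (\<lambda>h. deriv F z * h)) (at z)"
    using holomorphic_derivI[OF assms(1-3)] by (simp add: has_field_derivative_def)
  then have "((\<lambda>w. Im (F w)) has_derivative (\<lambda>h. Im (deriv F z * h))) (at z)"
    by (rule has_derivative_Im)
  then have D: "(u has_derivative (\<lambda>h. Im (deriv F z * h))) (at z)"
    by (rule has_derivative_transform_within_open[OF _ assms(2,3)]) (simp add: assms(4))
  show "u differentiable (at z)"
    using D differentiable_def by blast
  show "partial_x u z = Im (deriv F z)" "partial_y u z = Im (\<i> * deriv F z)"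
    using partial_eq_derivative[OF D] by auto
qed

text \<open>The partials of Im F are Im F' and Im (i F'), hence the pure second partials are Im F''
  and Im (i i F'') = - Im F''. Every explicit harmonic function below arises in this way.\<close>

lemma harmonic_on_Im:
  assumes "F holomorphic_on S" and "open S"
  shows "harmonic_on (\<lambda>z. Im (F z)) S"
proof -
  define u where "u = (\<lambda>z. Im (F z))"
  define G where "G = (\<lambda>z. \<i> * deriv F z)"
  have holF': "deriv F holomorphic_on S" and holG: "G holomorphic_on S"
    unfolding G_def using assms by (auto intro!: holomorphic_intros holomorphic_deriv)
  have u: "u differentiable (at z)" "partial_x u z = Im (deriv F z)" "partial_y u z = Im (G z)" if "z \<in> S" for z
    using partial_Im_holomorphic[OF assms that, of u] by (simp_all add: u_def G_def)
  note ux = partial_Im_holomorphic[OF holF' assms(2) _ u(2)]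
  note uy = partial_Im_holomorphic[OF holG assms(2) _ u(3)]
  have dG: "deriv G z = \<i> * deriv (deriv F) z" if "z \<in> S" for z
    unfolding G_def using that
      holomorphic_on_imp_differentiable_at[OF holF' assms(2)] by (simp add: deriv_cmult)
  have cont: "continuous_on S (deriv (deriv F))" "continuous_on S (deriv G)"
    using holF' holG assms(2) holomorphic_deriv holomorphic_on_imp_continuous_on by blast+
  have "harmonic_on u S"
    unfolding harmonic_on_def
  proof (intro conjI ballI)
    show "continuous_on S (partial_x (partial_x u))"
      using continuous_on_Im[OF cont(1)] by (simp add: ux cong: continuous_on_cong)
    show "continuous_on S (partial_y (partial_y u))"
      using continuous_on_Im[OF continuous_on_mult_left[OF cont(2), of "\<i>"]] 
      by (simp add: uy cong: continuous_on_cong del: imaginary_unit.simps complex.sel times_complex.sel)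
    show "continuous_on S (partial_x (partial_y u))"
      using continuous_on_Im[OF cont(2)] by (simp add: uy cong: continuous_on_cong)
    show "continuous_on S (partial_y (partial_x u))"
      using continuous_on_Im[OF continuous_on_mult_left[OF cont(1), of "\<i>"]]
      by (simp add: ux cong: continuous_on_cong)
  qed (use assms u ux uy dG in auto)
  then show ?thesis
    by (simp add: u_def)
qed

text \<open>\<open>f'\<close> vanishes at the maximum; if \<open>D > 0\<close> it would be positive
  just to the right of 0, and \<open>f\<close> would increase there.\<close>

lemma second_derivative_nonpos_at_max:
  fixes f f' :: "real \<Rightarrow> real"
  assumes "\<delta> > 0" and "\<And>t. \<bar>t\<bar> < \<delta> \<Longrightarrow> (f has_real_derivative f' t) (at t)"
    and "(f' has_real_derivative D) (at 0)" and "\<And>t. \<bar>t\<bar> < \<delta> \<Longrightarrow> f t \<le> f 0"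
  shows "D \<le> 0"
proof (rule ccontr)
  assume "\<not> D \<le> 0"
  have "f' 0 = 0"
    using DERIV_local_max[OF assms(2)[of 0] assms(1)] assms(1,4) by auto
  obtain e where e: "e > 0" "\<And>h. 0 < h \<Longrightarrow> h < e \<Longrightarrow> f' 0 < f' (0 + h)"
    using DERIV_pos_inc_right[OF assms(3)] \<open>\<not> D \<le> 0\<close> by force
  define b where "b = min e \<delta> / 2"
  have b: "0 < b" "b < e" "b < \<delta>"
    using e(1) assms(1) by (auto simp: b_def)
  have "f 0 < f b"
  proof (rule DERIV_pos_imp_increasing_open[OF b(1)])
    show "\<exists>y. (f has_real_derivative y) (at x) \<and> 0 < y" if "0 < x" "x < b" for x
      using assms(2)[of x] e(2)[of x] b that \<open>f' 0 = 0\<close> by auto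
    show "continuous_on {0..b} f"
      using b by (intro continuous_at_imp_continuous_on ballI DERIV_isCont[OF assms(2)]) auto
  qed
  then show False
    using assms(4)[of b] b by auto
qed

text \<open>Adding \<open>\<eta> * (norm z)\<^sup>2\<close> makes the Laplacian strictly positive,
  which is incompatible with an interior maximum. The boundary hypothesis is a one-sided upper
  limit, so that it also covers functions tending to minus infinity.\<close>

lemma harmonic_nonpos:
  assumes harm: "harmonic_on u S" and "bounded S"
    and bd: "\<And>x e. x \<in> frontier S \<Longrightarrow> 0 < e \<Longrightarrow> \<forall>\<^sub>F z in at x within S. u z < e"
    and "z \<in> S"
  shows "u z \<le> 0"
proof (rule ccontr)
  assume "\<not> u z \<le> 0"
  have S: "open S" and du: "\<And>z. z \<in> S \<Longrightarrow> u differentiable (at z)"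
    "\<And>z. z \<in> S \<Longrightarrow> partial_x u differentiable (at z)" "\<And>z. z \<in> S \<Longrightarrow> partial_y u differentiable (at z)"
    and lap: "\<And>z. z \<in> S \<Longrightarrow> partial_x (partial_x u) z + partial_y (partial_y u) z = 0"
    using harm by (auto simp: harmonic_on_def)
  have contu: "continuous_on S u"
    using du(1) differentiable_imp_continuous_within continuous_at_imp_continuous_on by blast
  obtain R where R: "R > 0" "\<And>w. w \<in> S \<Longrightarrow> norm w \<le> R"
    using \<open>bounded S\<close> bounded_pos by metis
  define c where "c = u z / 2"
  \<comment> \<open>On \<open>S\<close> the perturbation is at most
    \<open>\<eta> * R\<^sup>2 = c / 2\<close>. Thus \<open>w < 3 * c / 2\<close> off
    \<open>K\<close>, whereas \<open>w z \<ge> 2 * c\<close>, and a maximum of \<open>w\<close> over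
    \<open>K\<close> is a maximum over \<open>S\<close>.\<close>
  define \<eta> where "\<eta> = u z / (4 * R\<^sup>2)"
  have pos: "c > 0" "\<eta> > 0" and \<eta>: "\<eta> * R\<^sup>2 = c / 2"
    using \<open>\<not> u z \<le> 0\<close> R(1) by (auto simp: c_def \<eta>_def)
  define w where "w = (\<lambda>z. u z + \<eta> * (norm z)\<^sup>2)"
  define K where "K = {x \<in> S. c \<le> u x}"
  \<comment> \<open>Here the boundary hypothesis enters: a limit point of \<open>K\<close> outside
    \<open>S\<close> would be a frontier point, near which \<open>u < c\<close>.\<close>
  have "closed K"
    unfolding closed_limpt
  proof (intro allI impI)
    fix x assume "x islimpt K"
    then have "x islimpt S"
      by (rule islimpt_subset) (auto simp: K_def)
    have fr: "\<exists>\<^sub>F y in at x. y \<in> K"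
      using \<open>x islimpt K\<close> by (simp add: islimpt_iff_eventually frequently_def)
    show "x \<in> K"
    proof (cases "x \<in> S")
      case True
      have "(u \<longlongrightarrow> u x) (at x)"
        using contu True S continuous_on_eq_continuous_at continuous_at by blast
      moreover have "\<not> (\<forall>\<^sub>F y in at x. u y < c)"
        using fr unfolding frequently_def by (rule contrapos_nn) (auto simp: K_def elim!: eventually_mono)
      ultimately have "c \<le> u x"
        using order_tendstoD(2) by force
      then show ?thesis
        using True by (simp add: K_def)
    next
      case False
      then have "x \<in> frontier S"
        using \<open>x islimpt S\<close> S by (simp add: frontier_def closure_def interior_open)
      from bd[OF this pos(1)] have "\<forall>\<^sub>F y in at x. y \<in> S \<longrightarrow> u y < c"
        by (simp add: eventually_at_filter)
      then have "\<forall>\<^sub>F y in at x. y \<notin> K"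
        by eventually_elim (auto simp: K_def)
      with fr show ?thesis
        by (auto simp: frequently_def)
    qed
  qed
  moreover have "bounded K"
    using \<open>bounded S\<close> by (rule bounded_subset) (auto simp: K_def)
  ultimately have "compact K"
    by (simp add: compact_eq_bounded_closed)
  have "z \<in> K"
    using \<open>z \<in> S\<close> pos by (auto simp: K_def c_def)
  have "continuous_on K w"
    unfolding w_def by (intro continuous_intros continuous_on_subset[OF contu]) (auto simp: K_def)
  then obtain p where p: "p \<in> K" "\<And>y. y \<in> K \<Longrightarrow> w y \<le> w p"
    using continuous_attains_sup[OF \<open>compact K\<close>, of w] \<open>z \<in> K\<close> by blast
  have "p \<in> S"
    using p(1) by (simp add: K_def)
  have max: "w y \<le> w p" if "y \<in> S" for y
  proof (cases "y \<in> K")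
    case False
    then have "u y < c"
      using that by (auto simp: K_def)
    moreover have "\<eta> * (norm y)\<^sup>2 \<le> \<eta> * R\<^sup>2"
      using pos R that by (intro mult_left_mono power_mono) auto
    moreover have "w z \<ge> 2 * c"
      using pos by (auto simp: w_def c_def)
    ultimately have "w y \<le> w z"
      using \<eta> pos by (auto simp: w_def)
    then show ?thesis
      using p(2)[OF \<open>z \<in> K\<close>] by linarith
  qed (use p in auto)
  obtain \<delta> where \<delta>: "\<delta> > 0" "ball p \<delta> \<subseteq> S"
    using S \<open>p \<in> S\<close> open_contains_ball by blast
  have inS: "p + complex_of_real t \<in> S" "p + \<i> * complex_of_real t \<in> S" if "\<bar>t\<bar> < \<delta>" for t
    using \<delta>(2) that by (auto simp: subset_iff dist_norm norm_mult)
  have sq: "(norm (p + complex_of_real t))\<^sup>2 = (Re p + t)\<^sup>2 + (Im p)\<^sup>2"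
     "(norm (p + \<i> * complex_of_real t))\<^sup>2 = (Re p)\<^sup>2 + (Im p + t)\<^sup>2" for t
    by (simp_all add: cmod_power2)
  have ux: "((\<lambda>t. u (p + complex_of_real t)) has_real_derivative partial_x u (p + complex_of_real t)) (at t)"
    and uy: "((\<lambda>t. u (p + \<i> * complex_of_real t)) has_real_derivative partial_y u (p + \<i> * complex_of_real t)) (at t)"
    if "\<bar>t\<bar> < \<delta>" for t
    using partial_has_real_derivative(1)[OF du(1)[OF inS(1)[OF that]]]
      partial_has_real_derivative(2)[OF du(1)[OF inS(2)[OF that]]]
      DERIV_shift[of "\<lambda>t. u (p + complex_of_real t)" _ 0 t]
      DERIV_shift[of "\<lambda>t. u (p + \<i> * complex_of_real t)" _ 0 t]
    by (simp_all add: add.assoc add.commute[of _ t] distrib_left)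
  \<comment> \<open>Both pure second partials of \<open>w\<close> are nonpositive at its maximum
    \<open>p\<close>, but they add up to \<open>4 * \<eta>\<close>.\<close>
  have "partial_x (partial_x u) p + 2 * \<eta> \<le> 0"
  proof (rule second_derivative_nonpos_at_max[OF \<delta>(1)])
    show "((\<lambda>t. w (p + complex_of_real t)) has_real_derivative
        partial_x u (p + complex_of_real t) + 2 * \<eta> * (Re p + t)) (at t)" if "\<bar>t\<bar> < \<delta>" for t
      unfolding w_def sq using ux[OF that] by (auto intro!: derivative_eq_intros)
    show "((\<lambda>t. partial_x u (p + complex_of_real t) + 2 * \<eta> * (Re p + t)) has_real_derivative
        partial_x (partial_x u) p + 2 * \<eta>) (at 0)"
      using partial_has_real_derivative(1)[OF du(2)[OF \<open>p \<in> S\<close>]] by (auto intro!: derivative_eq_intros)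
  qed (use max inS in auto)
  moreover have "partial_y (partial_y u) p + 2 * \<eta> \<le> 0"
  proof (rule second_derivative_nonpos_at_max[OF \<delta>(1)])
    show "((\<lambda>t. w (p + \<i> * complex_of_real t)) has_real_derivative
        partial_y u (p + \<i> * complex_of_real t) + 2 * \<eta> * (Im p + t)) (at t)" if "\<bar>t\<bar> < \<delta>" for t
      unfolding w_def sq using uy[OF that] by (auto intro!: derivative_eq_intros)
    show "((\<lambda>t. partial_y u (p + \<i> * complex_of_real t) + 2 * \<eta> * (Im p + t)) has_real_derivative
        partial_y (partial_y u) p + 2 * \<eta>) (at 0)"
      using partial_has_real_derivative(2)[OF du(3)[OF \<open>p \<in> S\<close>]] by (auto intro!: derivative_eq_intros)
  qed (use max inS in auto)
  ultimately show False
    using lap[OF \<open>p \<in> S\<close>] pos by linarith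
qed

text \<open>Keeps \<open>1 - z / a\<close> off the branch cut of \<open>Ln\<close> on the whole
  closed disc except at \<open>a\<close>.\<close>

lemma Re_one_minus_divide_pos:
  fixes z a :: complex
  assumes "norm a = 1" and "norm z \<le> 1" and "z \<noteq> a"
  shows "0 < Re (1 - z / a)"
proof -
  have "a \<noteq> 0" "norm (z / a) \<le> 1" "z / a \<noteq> 1"
    using assms by (auto simp: norm_divide)
  moreover have "Re w < 1" if "norm w \<le> 1" "w \<noteq> 1" for w :: complex
  proof (rule ccontr)
    assume "\<not> Re w < 1"
    then have "Re w = 1"
      using complex_Re_le_cmod[of w] that by auto
    then have "1 + (Im w)\<^sup>2 \<le> 1"
      using cmod_power2[of w] power_mono[OF that(1), of 2] by simp
    then have "w = 1"
      using \<open>Re w = 1\<close> by (simp add: complex_eq_iff)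
    then show False
      using that by simp
  qed
  ultimately show ?thesis
    by simp
qed

lemma Re_pos_not_nonpos_Reals: "0 < Re z \<Longrightarrow> z \<notin> \<real>\<^sub>\<le>\<^sub>0"
  by (auto simp: complex_nonpos_Reals_iff)

lemma holomorphic_Ln_one_minus_divide:
  assumes "norm a = 1"
  shows "(\<lambda>z. Ln (1 - z / a)) holomorphic_on ball 0 1"
proof (intro holomorphic_intros Re_pos_not_nonpos_Reals Re_one_minus_divide_pos[OF assms])
qed (use assms in auto)

lemma continuous_Ln_one_minus_divide:
  assumes "norm a = 1"
  shows "continuous_on (cball 0 1 - {a}) (\<lambda>z. Ln (1 - z / a))"
proof (intro continuous_intros Re_pos_not_nonpos_Reals Re_one_minus_divide_pos[OF assms])
qed (use assms in auto)

lemma filterlim_ln_norm_diff: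
  fixes a :: complex
  shows "filterlim (\<lambda>z. ln (norm (z - a))) at_bot (at a within S)"
proof -
  have "((\<lambda>z. norm (z - a)) \<longlongrightarrow> 0) (at a within S)"
    using LIM_zero[OF tendsto_ident_at, of a S] by (rule tendsto_norm_zero)
  then have "filterlim (\<lambda>z. norm (z - a)) (at_right 0) (at a within S)"
    by (auto simp: filterlim_at eventually_at_filter)
  then show ?thesis
    by (rule filterlim_compose[OF ln_at_0])
qed

text \<open>A finite set of boundary points is removable for the maximum principle: the logarithmic
  potential \<open>\<delta> \<Sum> ln (\<bar>1 - z / a\<bar> / 2)\<close> is nonpositive, tends to minus infinity at the exceptional
  points, and vanishes in the limit \<open>\<delta> \<rightarrow> 0\<close>.\<close>
lemma harmonic_nonpos_exceptional:
  assumes harm: "harmonic_on u (ball 0 1)" and "finite A" and A: "A \<subseteq> sphere 0 1"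
    and M: "\<And>z. z \<in> ball 0 1 \<Longrightarrow> u z \<le> M"
    and bd: "\<And>x e. x \<in> sphere 0 1 - A \<Longrightarrow> 0 < e \<Longrightarrow> \<forall>\<^sub>F z in at x within ball 0 1. u z < e"
    and z: "z \<in> ball 0 1"
  shows "u z \<le> 0"
proof -
  define h where "h = (\<lambda>a z::complex. ln (norm (1 - z / a)) - ln 2)"
  have nz: "1 - z / a \<noteq> 0" if "z \<in> ball 0 1" "a \<in> A" for z a
    using that A by auto
  have h_nonpos: "h a z \<le> 0" if "z \<in> ball 0 1" "a \<in> A" for z a
  proof -
    have "norm (1 - z / a) \<le> 2"
      using norm_triangle_ineq4[of 1 "z / a"] that A by (auto simp: norm_divide subset_iff)
    then show ?thesis
      using nz[OF that] by (simp add: h_def)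
  qed
  have le: "u z + \<delta> * (\<Sum>a\<in>A. h a z) \<le> 0" if \<delta>: "\<delta> > 0" and z: "z \<in> ball 0 1" for \<delta> z
  proof -
    \<comment> \<open>The factor i moves ln |1 - z / a|, the real part of the logarithm, into the
      imaginary part, where \<open>harmonic_on_Im\<close> applies.\<close>
    define G where "G = (\<lambda>z. \<Sum>a\<in>A. \<i> * complex_of_real \<delta> * (Ln (1 - z / a) - complex_of_real (ln 2)))"
    define v where "v = (\<lambda>z. u z + Im (G z))"
    have G: "Im (G z) = \<delta> * (\<Sum>a\<in>A. h a z)" if "z \<in> ball 0 1" for z
      using nz that by (simp add: G_def h_def sum_distrib_left)
    have "G holomorphic_on ball 0 1"
      unfolding G_def using A
      by (intro holomorphic_intros holomorphic_Ln_one_minus_divide) auto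
    then have "harmonic_on v (ball 0 1)"
      unfolding v_def by (intro harmonic_on_add harm harmonic_on_Im) auto
    moreover have "\<forall>\<^sub>F z in at x within ball 0 1. v z < e" if "x \<in> frontier (ball 0 1)" "0 < e" for x e
    proof (cases "x \<in> A")
      \<comment> \<open>The threshold for the logarithm is chosen to give
        \<open>\<delta> * h x z < e - M\<close>; the other potentials are nonpositive and
        \<open>u \<le> M\<close>, so \<open>v < e\<close>.\<close>
      case True
      then have "norm x = 1"
        using A by auto
      have "\<forall>\<^sub>F z in at x within ball 0 1. ln (norm (z - x)) < ln 2 + (e - M) / \<delta>"
        using filterlim_ln_norm_diff[of x "ball 0 1"] by (simp add: filterlim_at_bot_dense)
      moreover have "\<forall>\<^sub>F z in at x within ball 0 1. z \<in> ball 0 1"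
        by (simp add: eventually_at_filter)
      ultimately show ?thesis
      proof eventually_elim
        case (elim z)
        have "1 - z / x = (x - z) / x"
          using \<open>norm x = 1\<close> by (cases "x = 0") (auto simp: diff_divide_distrib)
        then have "h x z = ln (norm (z - x)) - ln 2"
          using \<open>norm x = 1\<close> by (simp add: h_def norm_divide norm_minus_commute)
        then have "h x z < (e - M) / \<delta>"
          using elim(1) by linarith
        then have "\<delta> * h x z < e - M"
          using \<delta> by (simp add: pos_less_divide_eq mult.commute)
        moreover have "(\<Sum>a\<in>A. h a z) \<le> h x z"
          using True \<open>finite A\<close> h_nonpos[OF elim(2)]
          by (subst sum.remove[OF \<open>finite A\<close> True]) (auto intro!: sum_nonpos)
        ultimately have "Im (G z) < e - M"
          unfolding G[OF elim(2)] using \<delta> by (meson less_eq_real_def mult_left_mono order.strict_trans1)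
        then show ?case
          using M[OF elim(2)] by (simp add: v_def)
      qed
    next
      case False
      then have "x \<in> sphere 0 1 - A"
        using that by simp
      from bd[OF this that(2)] have "\<forall>\<^sub>F z in at x within ball 0 1. u z < e" .
      moreover have "\<forall>\<^sub>F z in at x within ball 0 1. z \<in> ball 0 1"
        by (simp add: eventually_at_filter)
      ultimately show ?thesis
      proof eventually_elim
        case (elim z)
        have "Im (G z) \<le> 0"
          unfolding G[OF elim(2)] using \<delta> h_nonpos[OF elim(2)]
          by (simp add: mult_nonneg_nonpos sum_nonpos)
        then show ?case
          using elim(1) by (simp add: v_def)
      qed
    qed
    ultimately have "v z \<le> 0"
      using z by (intro harmonic_nonpos) auto
    then show ?thesis
      using G[OF z] by (simp add: v_def)
  qed
  \<comment> \<open>The potential is finite at the fixed interior point \<open>z\<close>, so letting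
    \<delta> tend to 0 removes it.\<close>
  define H where "H = (\<Sum>a\<in>A. h a z)"
  have "((\<lambda>\<delta>. u z + \<delta> * H) \<longlongrightarrow> u z + 0 * H) (at_right 0)"
    by (intro tendsto_intros)
  moreover have "\<forall>\<^sub>F \<delta> in at_right 0. u z + \<delta> * H \<le> 0"
    using le[OF _ z] by (auto simp: eventually_at_filter H_def)
  ultimately have "u z + 0 * H \<le> 0"
    by (intro tendsto_upperbound) auto
  then show ?thesis
    by simp
qed

lemma bounded_harmonic_eq_if_boundary_eq:
  assumes u: "harmonic_on u (ball 0 1)" and v: "harmonic_on v (ball 0 1)"
    and "finite A" and "A \<subseteq> sphere 0 1"
    and bu: "bounded (u ` ball 0 1)" and bv: "bounded (v ` ball 0 1)"
    and lim: "\<And>x. x \<in> sphere 0 1 - A \<Longrightarrow> (u \<longlongrightarrow> f x) (at x within ball 0 1)"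
      "\<And>x. x \<in> sphere 0 1 - A \<Longrightarrow> (v \<longlongrightarrow> f x) (at x within ball 0 1)"
    and z: "z \<in> ball 0 1"
  shows "u z = v z"
proof -
  obtain M1 M2 where M: "\<And>z. z \<in> ball 0 1 \<Longrightarrow> norm (u z) \<le> M1" "\<And>z. z \<in> ball 0 1 \<Longrightarrow> norm (v z) \<le> M2"
    using bu bv unfolding bounded_iff by (metis imageI)
  have lim0: "((\<lambda>z. u z + - v z) \<longlongrightarrow> 0) (at x within ball 0 1)"
    "((\<lambda>z. v z + - u z) \<longlongrightarrow> 0) (at x within ball 0 1)" if "x \<in> sphere 0 1 - A" for x
    using tendsto_diff[OF lim(1)[OF that] lim(2)[OF that]]
      tendsto_diff[OF lim(2)[OF that] lim(1)[OF that]] by simp_all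
  have "u z + - v z \<le> 0"
  proof (rule harmonic_nonpos_exceptional[OF _ assms(3,4) _ _ z])
    show "u z + - v z \<le> M1 + M2" if "z \<in> ball 0 1" for z
      using M(1)[OF that] M(2)[OF that] by auto
    show "harmonic_on (\<lambda>z. u z + - v z) (ball 0 1)"
      by (intro harmonic_on_add harmonic_on_minus u v)
  qed (use lim0 order_tendstoD(2) in blast)
  moreover have "v z + - u z \<le> 0"
  proof (rule harmonic_nonpos_exceptional[OF _ assms(3,4) _ _ z])
    show "v z + - u z \<le> M1 + M2" if "z \<in> ball 0 1" for z
      using M(1)[OF that] M(2)[OF that] by auto
    show "harmonic_on (\<lambda>z. v z + - u z) (ball 0 1)"
      by (intro harmonic_on_add harmonic_on_minus u v)
  qed (use lim0 order_tendstoD(2) in blast)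
  ultimately show ?thesis
    by simp
qed

text \<open>1 - exp (i x) = 2 sin (x / 2) exp (i (x - \<pi>) / 2), with a positive modulus and an
  angle between - \<pi> / 2 and \<pi> / 2, hence principal.\<close>

lemma Im_Ln_one_minus_cis:
  assumes "0 < x" and "x < 2 * pi"
  shows "Im (Ln (1 - exp (\<i> * complex_of_real x))) = (x - pi) / 2"
proof -
  define y where "y = x / 2"
  define w where "w = Complex (ln (2 * sin y)) (y - pi / 2)"
  have "sin y > 0"
    using assms by (simp add: y_def sin_gt_zero)
  then have "exp w = complex_of_real (2 * sin y) * cis (y - pi / 2)"
    by (simp add: w_def exp_eq_polar)
  also have "\<dots> = 1 - exp (\<i> * complex_of_real x)"
  proof -
    have "x = 2 * y"
      by (simp add: y_def)
    then show ?thesis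
      unfolding cis_conv_exp[symmetric]
      by (simp add: complex_eq_iff cos_diff sin_diff sin_double cos_double_sin power2_eq_square)
  qed
  finally have "Ln (1 - exp (\<i> * complex_of_real x)) = w"
    using assms Ln_exp[of w] by (simp add: w_def y_def)
  then show ?thesis
    by (simp add: w_def y_def field_simps)
qed

section \<open>Lipschitz functions as integrals\<close>

text \<open>The image of Lebesgue measure under the inverse of \<open>F\<close> gives a set A the
  measure of F(A). Lipschitz maps preserve null sets, so this measure has a density by
  Radon-Nikodym, and on an interval its value is the increment of \<open>F\<close>.\<close>

lemma lipschitz_strict_mono_density:
  fixes F :: "real \<Rightarrow> real"
  assumes lip: "\<And>s t. \<bar>F s - F t\<bar> \<le> C * \<bar>s - t\<bar>" and low: "\<And>s t. s \<le> t \<Longrightarrow> t - s \<le> F t - F s"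
  obtains g where "\<And>t. 0 \<le> g t" and "\<And>s t. s \<le> t \<Longrightarrow> (g has_integral (F t - F s)) {s..t}"
proof -
  have "continuous_on UNIV F"
  proof -
    have "C-lipschitz_on UNIV F"
      using lip lip[of 0 1] by (intro lipschitz_onI) (auto simp: dist_real_def)
    then show ?thesis
      by (rule lipschitz_on_continuous_on)
  qed
  have smono: "strict_mono F"
  proof (rule strict_monoI)
    show "F s < F t" if "s < t" for s t
      using low[of s t] that by simp
  qed
  have "inj F"
    using smono strict_mono_imp_inj_on by blast
  have "\<exists>x. F x = y" for y
  proof -
    define R where "R = \<bar>y - F 0\<bar>"
    have "F (- R) \<le> y" "y \<le> F R"
      using low[of "-R" 0] low[of 0 R] by (auto simp: R_def)
    moreover have "continuous_on {- R..R} F"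
      using \<open>continuous_on UNIV F\<close> by (rule continuous_on_subset) simp
    ultimately show ?thesis
      using IVT'[of F "-R" y R] by (auto simp: R_def)
  qed
  then have "surj F"
    by (metis surjI)
  define G where "G = inv F"
  have FG [simp]: "F (G y) = y" and GF [simp]: "G (F x) = x" for x y
    using \<open>inj F\<close> \<open>surj F\<close> by (auto simp: G_def surj_f_inv_f)
  have "mono G"
    by (rule monoI) (metis FG smono strict_mono_less_eq)
  then have Gm [measurable]: "G \<in> borel_measurable borel"
    by (rule borel_measurable_mono)
  define \<mu> where "\<mu> = distr lborel borel G"
  have vim: "G -` A = F ` A" for A
    by (auto simp: image_iff) (metis FG)
  have "absolutely_continuous lborel \<mu>"
    unfolding absolutely_continuous_def
  proof
    fix A assume A: "A \<in> null_sets (lborel :: real measure)"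
    then have borel: "A \<in> sets borel"
      by auto
    have "negligible A"
      using A by (simp add: negligible_iff_null_sets null_sets_completionI)
    then have "negligible (F ` A)"
    proof (rule negligible_locally_Lipschitz_image[rotated])
      show "\<exists>T B. open T \<and> x \<in> T \<and> (\<forall>y\<in>A \<inter> T. norm (F y - F x) \<le> B * norm (y - x))" if "x \<in> A" for x
        using lip by (intro exI[of _ UNIV] exI[of _ C]) auto
    qed simp
    moreover have "G -` A \<in> sets borel"
      using measurable_sets[OF Gm borel] by simp
    ultimately have "emeasure lborel (G -` A) = 0"
      unfolding vim by (simp add: negligible_iff_null_sets null_sets_completion_iff null_setsD1)
    then show "A \<in> null_sets \<mu>"
      using borel by (simp add: \<mu>_def null_sets_def emeasure_distr)
  qed
  moreover have "sets \<mu> = sets (lborel :: real measure)"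
    by (simp add: \<mu>_def)
  ultimately obtain f where f: "f \<in> borel_measurable lborel" "density lborel f = \<mu>"
    using sigma_finite_measure.Radon_Nikodym[OF sigma_finite_lborel, of \<mu>] by (auto simp: \<mu>_def)
  have int: "(\<integral>\<^sup>+x. f x * indicator {s..t} x \<partial>lborel) = ennreal (F t - F s)" if "s \<le> t" for s t
  proof -
    have "(\<integral>\<^sup>+x. f x * indicator {s..t} x \<partial>lborel) = emeasure \<mu> {s..t}"
      using f by (metis emeasure_density atLeastAtMost_borel sets_lborel)
    also have "\<dots> = emeasure lborel (F ` {s..t})"
      by (simp add: \<mu>_def emeasure_distr vim)
    also have "F ` {s..t} = {F s..F t}"
      using smono by (auto simp: strict_mono_less_eq image_iff) (metis FG smono strict_mono_less_eq atLeastAtMost_iff)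
    also have "emeasure lborel {F s..F t} = ennreal (F t - F s)"
      using low[OF that] that by simp
    finally show ?thesis .
  qed
  define g where "g = (\<lambda>x. enn2real (f x))"
  \<comment> \<open>The integral over each interval {-n..n} is a finite increment of
    \<open>F\<close>, so replacing \<open>f\<close> by its real part \<open>g\<close> changes it on
    a null set only.\<close>
  have "AE x in lborel. f x \<noteq> \<infinity>"
  proof -
    have "AE x in lborel. f x * indicator {- real n..real n} x \<noteq> \<infinity>" for n
      by (rule nn_integral_PInf_AE) (use f(1) int[of "- real n" "real n"] in auto)
    then have "AE x in lborel. \<forall>n. f x * indicator {- real n..real n} x \<noteq> \<infinity>"
      by (simp add: AE_all_countable)
    then show ?thesis
    proof eventually_elim
      case (elim x)
      obtain n where "\<bar>x\<bar> \<le> real n"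
        using real_arch_simple by blast
      then have "x \<in> {- real n..real n}"
        by auto
      then show ?case
        using elim[rule_format, of n] by simp
    qed
  qed
  then have fg: "AE x in lborel. f x = ennreal (g x)"
    by eventually_elim (auto simp: g_def ennreal_enn2real_if)
  have gm: "g \<in> borel_measurable borel"
    using f(1) by (simp add: g_def)
  show ?thesis
  proof
    show "0 \<le> g t" for t
      by (simp add: g_def)
    show "(g has_integral (F t - F s)) {s..t}" if "s \<le> t" for s t
    proof -
      have "(\<integral>\<^sup>+x. ennreal (g x * indicator {s..t} x) \<partial>lborel) = (\<integral>\<^sup>+x. f x * indicator {s..t} x \<partial>lborel)"
        by (rule nn_integral_cong_AE, use fg in eventually_elim) (auto simp: indicator_def)
      also have "\<dots> = ennreal (F t - F s)"
        using int[OF that] .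
      finally have "((\<lambda>x. g x * indicator {s..t} x) has_integral (F t - F s)) UNIV"
        using gm low[OF that] that
        by (intro nn_integral_has_integral) (auto simp: g_def)
      then show ?thesis
        by (subst has_integral_restrict_UNIV[symmetric]) (auto elim!: has_integral_eq[rotated] simp: indicator_def)
    qed
  qed
qed

lemma has_vector_derivative_zero_within_iff:
  fixes f :: "real \<Rightarrow> 'a::real_normed_vector"
  shows "(f has_vector_derivative 0) (at x within S) \<longleftrightarrow>
    (\<forall>e>0. \<exists>d>0. \<forall>y\<in>S. \<bar>y - x\<bar> < d \<longrightarrow> norm (f y - f x) \<le> e * \<bar>y - x\<bar>)"
  by (simp add: has_vector_derivative_def has_derivative_within_alt)

text \<open>\<open>g\<close> is treated as the density of a measure of mass \<open>D\<close>,
  against which a function within \<open>e\<close> of \<open>v\<close> integrates to within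
  \<open>e * D\<close> of \<open>D *\<^sub>R v\<close>.\<close>

lemma integral_nonneg_times_continuous:
  fixes g :: "real \<Rightarrow> real" and c :: "real \<Rightarrow> 'a::euclidean_space"
  assumes "\<And>t. 0 \<le> g t" and g: "(g has_integral D) {p..q}"
    and c: "continuous_on {p..q} c" and near: "\<And>r. r \<in> {p..q} \<Longrightarrow> norm (c r - v) \<le> e"
  shows "(\<lambda>t. g t *\<^sub>R c t) integrable_on {p..q}"
    and "norm (integral {p..q} (\<lambda>t. g t *\<^sub>R c t) - D *\<^sub>R v) \<le> e * D"
proof -
  have "g absolutely_integrable_on {p..q}"
    using g assms(1) by (intro nonnegative_absolutely_integrable_1) auto
  moreover have "c \<in> borel_measurable (lebesgue_on {p..q})"
    using c by (intro continuous_imp_measurable_on_sets_lebesgue) auto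
  moreover have "bounded (c ` {p..q})"
    using c compact_continuous_image compact_imp_bounded compact_Icc by blast
  ultimately have "(\<lambda>t. g t *\<^sub>R c t) absolutely_integrable_on {p..q}"
    using absolutely_integrable_bounded_measurable_product[of "\<lambda>x y. y *\<^sub>R x" c "{p..q}" g]
    bounded_bilinear.flip[OF bounded_bilinear_scaleR] by (auto simp: bilinear_conv_bounded_bilinear)
  then show int: "(\<lambda>t. g t *\<^sub>R c t) integrable_on {p..q}"
    using set_lebesgue_integral_eq_integral(1) by blast
  have v: "((\<lambda>t. g t *\<^sub>R v) has_integral D *\<^sub>R v) {p..q}"
    using has_integral_scaleR_left[OF g] .
  have "integral {p..q} (\<lambda>t. g t *\<^sub>R c t) - D *\<^sub>R v = integral {p..q} (\<lambda>t. g t *\<^sub>R c t - g t *\<^sub>R v)"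
    using int v by (simp add: integral_diff has_integral_integrable integral_unique)
  also have "norm \<dots> \<le> integral {p..q} (\<lambda>t. g t * e)"
  proof (rule integral_norm_bound_integral)
    show "(\<lambda>t. g t *\<^sub>R c t - g t *\<^sub>R v) integrable_on {p..q}"
      using int v by (intro integrable_diff) auto
    show "(\<lambda>t. g t * e) integrable_on {p..q}"
      using has_integral_mult_left[OF g] by blast
    show "norm (g t *\<^sub>R c t - g t *\<^sub>R v) \<le> g t * e" if "t \<in> {p..q}" for t
      using near[OF that] assms(1)[of t]
      by (simp add: scaleR_diff_right[symmetric] mult_left_mono)
  qed
  also have "\<dots> = e * D"
    using integral_unique[OF has_integral_mult_left[OF g, of e]] by (simp only: mult.commute)
  finally show "norm (integral {p..q} (\<lambda>t. g t *\<^sub>R c t) - D *\<^sub>R v) \<le> e * D" .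
qed

text \<open>A fundamental theorem of calculus that needs no differentiation almost everywhere: the
  hypothesis on \<open>U\<close> says \<open>dU = c dF\<close> to first order at every point.\<close>
lemma nonneg_density_FTC:
  fixes g F :: "real \<Rightarrow> real" and U c :: "real \<Rightarrow> 'a::euclidean_space"
  assumes g0: "\<And>t. 0 \<le> g t" and g: "\<And>s t. s \<le> t \<Longrightarrow> (g has_integral (F t - F s)) {s..t}"
    and lip: "\<And>s t. \<bar>F s - F t\<bar> \<le> C * \<bar>s - t\<bar>"
    and c: "continuous_on UNIV c"
    and U: "\<And>s. ((\<lambda>t. U t - F t *\<^sub>R c s) has_vector_derivative 0) (at s)"
    and "a \<le> b"
  shows "((\<lambda>t. g t *\<^sub>R c t) has_integral (U b - U a)) {a..b}"
proof -
  have C: "C \<ge> 0"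
    using lip[of 0 1] by simp
  have cc: "continuous_on S c" for S
    using c continuous_on_subset by blast
  have int: "(\<lambda>t. g t *\<^sub>R c t) integrable_on {p..q}" if "p \<le> q" for p q
  proof -
    obtain B where "\<And>r. r \<in> {p..q} \<Longrightarrow> norm (c r) \<le> B"
      using compact_imp_bounded[OF compact_continuous_image[OF cc compact_Icc]]
      unfolding bounded_iff by (metis imageI)
    then show ?thesis
      using integral_nonneg_times_continuous(1)[OF g0 g[OF that] cc, of 0 B] by simp
  qed
  define I where "I = (\<lambda>t. integral {a..t} (\<lambda>t. g t *\<^sub>R c t))"
  have I: "I q - I p = integral {p..q} (\<lambda>t. g t *\<^sub>R c t)" if "a \<le> p" "p \<le> q" for p q
    using Henstock_Kurzweil_Integration.integral_combine[OF that int[of a q]] that by (simp add: I_def algebra_simps)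
  \<comment> \<open>Near \<open>s\<close> the increments of \<open>U\<close> and of the integral
    \<open>I\<close> both equal \<open>(F y - F s) *\<^sub>R c s\<close> up to an error small
    relative to |y - s|, so \<open>W\<close> has derivative 0 everywhere.\<close>
  define W where "W = (\<lambda>t. U t - I t)"
  have "(W has_vector_derivative 0) (at s within {a..b})" if s: "s \<in> {a..b}" for s
    unfolding has_vector_derivative_zero_within_iff
  proof (intro allI impI)
    fix e :: real assume "e > 0"
    \<comment> \<open>Half of the error budget goes to \<open>I\<close>, where \<open>F\<close>
      costs a factor \<open>C\<close>, and half to \<open>U\<close>; \<open>C + 1\<close> avoids a
      zero denominator.\<close>
    define e' where "e' = e / (2 * (C + 1))"
    have e': "e' > 0" "e' * C \<le> e / 2"
      using \<open>e > 0\<close> C by (auto simp: e'_def field_simps)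
    obtain d1 where d1: "d1 > 0" "\<And>y. \<bar>y - s\<bar> < d1 \<Longrightarrow> norm (c y - c s) \<le> e'"
      using c e'(1) by (metis UNIV_I continuous_on_iff dist_norm less_imp_le real_norm_def)
    obtain d2 where d2: "d2 > 0"
      "\<And>y. \<bar>y - s\<bar> < d2 \<Longrightarrow> norm ((U y - F y *\<^sub>R c s) - (U s - F s *\<^sub>R c s)) \<le> e / 2 * \<bar>y - s\<bar>"
      using U[of s] \<open>e > 0\<close> unfolding has_vector_derivative_zero_within_iff
      by (metis UNIV_I half_gt_zero)
    show "\<exists>d>0. \<forall>y\<in>{a..b}. \<bar>y - s\<bar> < d \<longrightarrow> norm (W y - W s) \<le> e * \<bar>y - s\<bar>"
    proof (intro exI[of _ "min d1 d2"] conjI ballI impI)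
      fix y assume y: "y \<in> {a..b}" "\<bar>y - s\<bar> < min d1 d2"
      have I_est: "norm (I y - I s - (F y - F s) *\<^sub>R c s) \<le> e / 2 * \<bar>y - s\<bar>"
      proof -
        define p q where "p = min y s" and "q = max y s"
        have pq: "a \<le> p" "p \<le> q"
          using y s by (auto simp: p_def q_def)
        have "norm (integral {p..q} (\<lambda>t. g t *\<^sub>R c t) - (F q - F p) *\<^sub>R c s) \<le> e' * (F q - F p)"
          using y(2) by (intro integral_nonneg_times_continuous(2)[OF g0 g[OF pq(2)] cc] d1(2))
            (auto simp: p_def q_def)
        also have "\<dots> \<le> e' * (C * \<bar>q - p\<bar>)"
          using lip[of q p] e'(1) by (intro mult_left_mono) auto
        also have "\<dots> \<le> e / 2 * \<bar>q - p\<bar>"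
          using mult_right_mono[OF e'(2), of "\<bar>q - p\<bar>"] by (simp add: mult.assoc)
        finally have *: "norm (I q - I p - (F q - F p) *\<^sub>R c s) \<le> e / 2 * \<bar>y - s\<bar>"
          unfolding I[OF pq] by (simp add: p_def q_def abs_if max_def min_def split: if_splits)
        show ?thesis
        proof (cases "y \<le> s")
          case True
          have "I y - I s - (F y - F s) *\<^sub>R c s = - (I s - I y - (F s - F y) *\<^sub>R c s)"
            by (simp add: algebra_simps)
          then have "norm (I y - I s - (F y - F s) *\<^sub>R c s) = norm (I s - I y - (F s - F y) *\<^sub>R c s)"
            by (metis norm_minus_cancel)
          then show ?thesis
            using * True by (simp add: p_def q_def)
        qed (use * in \<open>simp add: p_def q_def\<close>)
      qed
      have "W y - W s = ((U y - F y *\<^sub>R c s) - (U s - F s *\<^sub>R c s)) - (I y - I s - (F y - F s) *\<^sub>R c s)"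
        by (simp add: W_def algebra_simps)
      also have "norm \<dots> \<le> e / 2 * \<bar>y - s\<bar> + e / 2 * \<bar>y - s\<bar>"
        using y(2) by (intro order_trans[OF norm_triangle_ineq4 add_mono[OF d2(2) I_est]]) simp
      finally show "norm (W y - W s) \<le> e * \<bar>y - s\<bar>"
        by (simp add: field_simps)
    qed (use d1 d2 in auto)
  qed
  then obtain k where "\<And>t. t \<in> {a..b} \<Longrightarrow> W t = k"
    using has_vector_derivative_zero_constant[of "{a..b}" W] by auto
  then have "W a = W b"
    using \<open>a \<le> b\<close> by simp
  then have "integral {a..b} (\<lambda>t. g t *\<^sub>R c t) = U b - U a"
    by (simp add: W_def I_def algebra_simps)
  then show ?thesis
    using int[OF \<open>a \<le> b\<close>] by (simp add: has_integral_iff)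
qed

section \<open>Curvature of a Lipschitz tangent\<close>

lemma continuous_antiderivative:
  fixes f :: "real \<Rightarrow> 'a::euclidean_space"
  assumes "continuous_on UNIV f"
  obtains P where "\<And>t. (P has_vector_derivative f t) (at t)"
  using einterval_antiderivative[of "-\<infinity>" "\<infinity>" f] assms
  by (auto simp: continuous_on_eq_continuous_at)

text \<open>\<open>\<kappa>\<close> plays the role of \<theta>'. It is described by a fundamental
  theorem for all pairs with dU = c d\<theta>, because the same \<open>\<kappa>\<close> must serve
  both the tangent equation and integration by parts. Adding \<open>(K + 1) * t\<close> to
  \<open>\<theta>\<close> makes it increasing with slope at least 1; the density is corrected by
  \<open>K + 1\<close> afterwards.\<close>

lemma lipschitz_density:
  fixes \<theta> :: "real \<Rightarrow> real"
  assumes lip: "\<And>s t. \<bar>\<theta> s - \<theta> t\<bar> \<le> K * \<bar>s - t\<bar>"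
  obtains \<kappa> where "\<And>U c :: real \<Rightarrow> complex. \<And>a b. continuous_on UNIV c \<Longrightarrow>
      (\<And>s. ((\<lambda>t. U t - \<theta> t *\<^sub>R c s) has_vector_derivative 0) (at s)) \<Longrightarrow> a \<le> b \<Longrightarrow>
      ((\<lambda>t. \<kappa> t *\<^sub>R c t) has_integral (U b - U a)) {a..b}"
proof -
  define F where "F = (\<lambda>t. \<theta> t + (K + 1) * t)"
  have K: "K \<ge> 0"
    using lip[of 0 1] by simp
  have F_lip: "\<bar>F s - F t\<bar> \<le> (2 * K + 1) * \<bar>s - t\<bar>" for s t
  proof -
    have "F s - F t = (\<theta> s - \<theta> t) + (K + 1) * (s - t)"
      by (simp add: F_def algebra_simps)
    also have "\<bar>\<dots>\<bar> \<le> K * \<bar>s - t\<bar> + (K + 1) * \<bar>s - t\<bar>"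
      using lip[of s t] K by (intro order_trans[OF abs_triangle_ineq]) (auto simp: abs_mult)
    finally show ?thesis
      by (simp add: algebra_simps)
  qed
  have F_low: "t - s \<le> F t - F s" if "s \<le> t" for s t
    using lip[of s t] that by (auto simp: F_def algebra_simps)
  obtain g where g: "\<And>t. 0 \<le> g t" "\<And>s t. s \<le> t \<Longrightarrow> (g has_integral (F t - F s)) {s..t}"
    using lipschitz_strict_mono_density[OF F_lip F_low] by blast
  show ?thesis
  proof (rule that[of "\<lambda>t. g t - (K + 1)"])
    fix U c :: "real \<Rightarrow> complex" and a b :: real
    assume c: "continuous_on UNIV c" and "a \<le> b"
      and U: "\<And>s. ((\<lambda>t. U t - \<theta> t *\<^sub>R c s) has_vector_derivative 0) (at s)"
    obtain P where P: "\<And>t. (P has_vector_derivative c t) (at t)"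
      using continuous_antiderivative[OF c] by blast
    \<comment> \<open>\<open>P\<close> is a primitive of \<open>c\<close>, so its multiple accounts
      for the linear term by which \<open>F\<close> differs from \<open>\<theta>\<close>.\<close>
    define V where "V = (\<lambda>t. U t + (K + 1) *\<^sub>R P t)"
    have V: "((\<lambda>t. V t - F t *\<^sub>R c s) has_vector_derivative 0) (at s)" for s
    proof -
      have "((\<lambda>t. (U t - \<theta> t *\<^sub>R c s) + ((K + 1) *\<^sub>R P t - ((K + 1) * t) *\<^sub>R c s)) has_vector_derivative
          0 + ((K + 1) *\<^sub>R c s - (K + 1) *\<^sub>R c s)) (at s)"
        by (rule has_vector_derivative_add[OF U], rule has_vector_derivative_diff)
           (auto intro!: derivative_eq_intros P)
      then show ?thesis
        by (simp add: V_def F_def algebra_simps)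
    qed
    have "((\<lambda>t. g t *\<^sub>R c t) has_integral (V b - V a)) {a..b}"
      by (rule nonneg_density_FTC[OF g F_lip c V \<open>a \<le> b\<close>])
    moreover have "(c has_integral (P b - P a)) {a..b}"
      by (rule fundamental_theorem_of_calculus[OF \<open>a \<le> b\<close>])
         (use P has_vector_derivative_at_within in blast)
    then have "((\<lambda>t. (K + 1) *\<^sub>R c t) has_integral ((K + 1) *\<^sub>R (P b - P a))) {a..b}"
      by (rule has_integral_cmul)
    ultimately have "((\<lambda>t. g t *\<^sub>R c t - (K + 1) *\<^sub>R c t) has_integral
        ((V b - V a) - (K + 1) *\<^sub>R (P b - P a))) {a..b}"
      by (rule has_integral_diff)
    then show "((\<lambda>t. (g t - (K + 1)) *\<^sub>R c t) has_integral (U b - U a)) {a..b}"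
      by (simp add: V_def algebra_simps)
  qed
qed

lemma half_le_sin:
  assumes "0 \<le> x" and "x \<le> 1"
  shows "x / 2 \<le> sin (x::real)"
proof -
  have "sin 0 - 0 / 2 \<le> sin x - x / 2"
  proof (rule DERIV_nonneg_imp_nondecreasing[OF assms(1)])
    fix t assume t: "0 \<le> t" "t \<le> x"
    \<comment> \<open>Up to \<pi> / 3 the cosine is at least 1/2, so sin x - x / 2 does not decrease
      on [0, 1].\<close>
    have "t \<le> pi / 3"
      using t assms pi_gt3 by linarith
    then have "cos (pi / 3) \<le> cos t"
      using t by (intro cos_monotone_0_pi_le) auto
    then show "\<exists>y. ((\<lambda>x. sin x - x / 2) has_real_derivative y) (at t) \<and> 0 \<le> y"
      by (intro exI[of _ "cos t - 1 / 2"]) (auto intro!: derivative_eq_intros simp: cos_60)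
  qed
  then show ?thesis
    by simp
qed

text \<open>The chord has length 2 |sin ((x - y) / 2)|, which by \<open>half_le_sin\<close> is at
  least half the arc when the arc is at most 1.\<close>

lemma abs_diff_le_norm_exp_diff:
  assumes "\<bar>x - y\<bar> \<le> 1"
  shows "\<bar>x - y\<bar> \<le> 2 * norm (exp (\<i> * complex_of_real x) - exp (\<i> * complex_of_real y))"
proof -
  have "exp (\<i> * complex_of_real x) - exp (\<i> * complex_of_real y)
      = exp (\<i> * complex_of_real y) * (exp (\<i> * complex_of_real (x - y)) - 1)"
    by (simp add: algebra_simps exp_diff exp_add exp_minus divide_simps)
  then have "norm (exp (\<i> * complex_of_real x) - exp (\<i> * complex_of_real y)) = 2 * \<bar>sin ((x - y) / 2)\<bar>"
    using dist_exp_i_1[of "x - y"] by (simp add: norm_mult dist_norm)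
  moreover have "\<bar>sin ((x - y) / 2)\<bar> = sin (\<bar>x - y\<bar> / 2)"
  proof -
    have "\<bar>sin r\<bar> = sin \<bar>r\<bar>" if "\<bar>r\<bar> \<le> 1" for r :: real
      using that half_le_sin[of "\<bar>r\<bar>"] by (cases "r \<ge> 0") auto
    from this[of "(x - y) / 2"] show ?thesis
      using assms by simp
  qed
  ultimately show ?thesis
    using half_le_sin[of "\<bar>x - y\<bar> / 2"] assms by simp
qed

text \<open>For parameters closer than \<open>\<delta>\<close> uniform continuity keeps the angles
  within 1, and the arc is at most twice the chord; for the others the bound \<open>2 * B\<close> on
  the angle difference is at most \<open>2 * B / \<delta>\<close> times the distance.\<close>

lemma lipschitz_angle:
  assumes cont: "continuous_on {0..L} \<theta>" and lip: "\<And>s t. norm (T s - T t) \<le> K * \<bar>s - t\<bar>"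
    and T: "\<And>t. t \<in> {0..L} \<Longrightarrow> T t = exp (\<i> * complex_of_real (\<theta> t))"
  obtains K' :: real where "\<And>s t. s \<in> {0..L} \<Longrightarrow> t \<in> {0..L} \<Longrightarrow> \<bar>\<theta> s - \<theta> t\<bar> \<le> K' * \<bar>s - t\<bar>"
proof -
  have "uniformly_continuous_on {0..L} \<theta>"
    using cont compact_uniformly_continuous by blast
  then obtain \<delta> where \<delta>: "\<delta> > 0"
    "\<And>s t. s \<in> {0..L} \<Longrightarrow> t \<in> {0..L} \<Longrightarrow> \<bar>s - t\<bar> < \<delta> \<Longrightarrow> \<bar>\<theta> s - \<theta> t\<bar> < 1"
    unfolding uniformly_continuous_on_def dist_real_def by (metis zero_less_one)
  obtain B where B: "\<And>t. t \<in> {0..L} \<Longrightarrow> \<bar>\<theta> t\<bar> \<le> B"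
    using compact_imp_bounded[OF compact_continuous_image[OF cont compact_Icc]]
    unfolding bounded_iff by (metis imageI real_norm_def)
  define K' where "K' = max (2 * K) (2 * B / \<delta>)"
  show ?thesis
  proof (rule that)
    fix s t assume st: "s \<in> {0..L}" "t \<in> {0..L}"
    show "\<bar>\<theta> s - \<theta> t\<bar> \<le> K' * \<bar>s - t\<bar>"
    proof (cases "\<bar>s - t\<bar> < \<delta>")
      case True
      then have "\<bar>\<theta> s - \<theta> t\<bar> \<le> 2 * norm (T s - T t)"
        using \<delta>(2)[OF st] T[OF st(1)] T[OF st(2)] abs_diff_le_norm_exp_diff[of "\<theta> s" "\<theta> t"] by simp
      also have "\<dots> \<le> 2 * K * \<bar>s - t\<bar>"
        using lip[of s t] by simp
      also have "\<dots> \<le> K' * \<bar>s - t\<bar>"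
        by (intro mult_right_mono) (auto simp: K'_def)
      finally show ?thesis .
    next
      case False
      have "0 \<le> B"
        using B[OF st(1)] by simp
      have "\<bar>\<theta> s - \<theta> t\<bar> \<le> 2 * B"
        using B[OF st(1)] B[OF st(2)] by linarith
      also have "2 * B = 2 * B / \<delta> * \<delta>"
        using \<delta>(1) by simp
      also have "\<dots> \<le> 2 * B / \<delta> * \<bar>s - t\<bar>"
        using False \<delta>(1) \<open>0 \<le> B\<close> by (intro mult_left_mono) auto
      also have "\<dots> \<le> K' * \<bar>s - t\<bar>"
        by (intro mult_right_mono) (auto simp: K'_def)
      finally show ?thesis .
    qed
  qed
qed

text \<open>A chain rule for an inner function that need not be differentiable: a zero outer
  derivative absorbs the Lipschitz factor.\<close>

lemma has_vector_derivative_zero_lipschitz_comp: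
  fixes \<theta> :: "real \<Rightarrow> real"
  assumes lip: "\<And>s t. \<bar>\<theta> s - \<theta> t\<bar> \<le> K * \<bar>s - t\<bar>" and H: "(H has_vector_derivative 0) (at (\<theta> s))"
  shows "((\<lambda>t. H (\<theta> t)) has_vector_derivative 0) (at s)"
  unfolding has_vector_derivative_zero_within_iff
proof (intro allI impI)
  fix e :: real assume "e > 0"
  have K: "K \<ge> 0"
    using lip[of 0 1] by simp
  define e' where "e' = e / (K + 1)"
  have e': "e' > 0" "e' * K \<le> e"
    using \<open>e > 0\<close> K by (auto simp: e'_def field_simps)
  obtain d where d: "d > 0" "\<And>y. \<bar>y - \<theta> s\<bar> < d \<Longrightarrow> norm (H y - H (\<theta> s)) \<le> e' * \<bar>y - \<theta> s\<bar>"
    using H e'(1) unfolding has_vector_derivative_zero_within_iff by (metis UNIV_I)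
  show "\<exists>d>0. \<forall>y\<in>UNIV. \<bar>y - s\<bar> < d \<longrightarrow> norm (H (\<theta> y) - H (\<theta> s)) \<le> e * \<bar>y - s\<bar>"
  proof (intro exI[of _ "d / (K + 1)"] conjI ballI impI)
    fix y assume y: "\<bar>y - s\<bar> < d / (K + 1)"
    have "K * \<bar>y - s\<bar> \<le> (K + 1) * \<bar>y - s\<bar>"
      by (intro mult_right_mono) auto
    then have "\<bar>\<theta> y - \<theta> s\<bar> < d"
      using lip[of y s] y K by (simp add: pos_less_divide_eq mult.commute)
    then have "norm (H (\<theta> y) - H (\<theta> s)) \<le> e' * \<bar>\<theta> y - \<theta> s\<bar>"
      by (rule d(2))
    also have "\<dots> \<le> e' * (K * \<bar>y - s\<bar>)"
      using e'(1) lip by (intro mult_left_mono) auto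
    also have "\<dots> \<le> e * \<bar>y - s\<bar>"
      using mult_right_mono[OF e'(2), of "\<bar>y - s\<bar>"] by (simp add: mult.assoc)
    finally show "norm (H (\<theta> y) - H (\<theta> s)) \<le> e * \<bar>y - s\<bar>" .
  qed (use d(1) K in auto)
qed

text \<open>Both conclusions are instances of \<open>lipschitz_density\<close> for one
  \<open>\<kappa>\<close>: U = exp (i \<theta>) with c = i exp (i \<theta>) for the tangent
  equation, and c = \<zeta> for integration by parts.\<close>

lemma curvature_exists:
  assumes "L > 0" and cont: "continuous_on {0..L} \<theta>" and lip: "\<And>s t. norm (T s - T t) \<le> K * \<bar>s - t\<bar>"
    and T: "\<And>t. t \<in> {0..L} \<Longrightarrow> T t = exp (\<i> * complex_of_real (\<theta> t))"
  obtains \<kappa> where "curvature_of L T \<kappa>"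
    and "\<forall>\<zeta> \<zeta>'. (\<forall>t. (\<zeta> has_real_derivative \<zeta>' t) (at t)) \<and> continuous_on UNIV \<zeta>' \<longrightarrow>
      ((\<lambda>t. \<kappa> t * \<zeta> t) has_integral
        (\<theta> L * \<zeta> L - \<theta> 0 * \<zeta> 0 - integral {0..L} (\<lambda>t. \<theta> t * \<zeta>' t))) {0..L}"
proof -
  obtain K' :: real where K': "\<And>s t. s \<in> {0..L} \<Longrightarrow> t \<in> {0..L} \<Longrightarrow> \<bar>\<theta> s - \<theta> t\<bar> \<le> K' * \<bar>s - t\<bar>"
    using lipschitz_angle[OF cont lip T] by blast
  have "K' \<ge> 0"
    using order_trans[OF abs_ge_zero K'[of 0 L]] \<open>L > 0\<close> by (simp add: zero_le_mult_iff)
  \<comment> \<open>Clamping the parameter to {0..L} extends \<open>\<theta>\<close> to the line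
    with the same Lipschitz constant.\<close>
  define cl where "cl = (\<lambda>t. max 0 (min L t))"
  define \<theta>c where "\<theta>c = (\<lambda>t. \<theta> (cl t))"
  have cl: "cl t \<in> {0..L}" for t
    using \<open>L > 0\<close> by (auto simp: cl_def)
  have \<theta>c: "\<theta>c t = \<theta> t" if "t \<in> {0..L}" for t
    using that by (auto simp: \<theta>c_def cl_def)
  have lipc: "\<bar>\<theta>c s - \<theta>c t\<bar> \<le> K' * \<bar>s - t\<bar>" for s t
  proof -
    have "\<bar>cl s - cl t\<bar> \<le> \<bar>s - t\<bar>"
      by (auto simp: cl_def max_def min_def)
    then show ?thesis
      using K'[OF cl cl, of s t] \<open>K' \<ge> 0\<close> unfolding \<theta>c_def
      by (meson mult_left_mono order_trans)
  qed
  have contc: "continuous_on UNIV \<theta>c"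
  proof -
    have "K'-lipschitz_on UNIV \<theta>c"
      using lipc \<open>K' \<ge> 0\<close> by (intro lipschitz_onI) (auto simp: dist_real_def)
    then show ?thesis
      by (rule lipschitz_on_continuous_on)
  qed
  obtain \<kappa> where \<kappa>: "\<And>U c :: real \<Rightarrow> complex. \<And>a b. continuous_on UNIV c \<Longrightarrow>
      (\<And>s. ((\<lambda>t. U t - \<theta>c t *\<^sub>R c s) has_vector_derivative 0) (at s)) \<Longrightarrow> a \<le> b \<Longrightarrow>
      ((\<lambda>t. \<kappa> t *\<^sub>R c t) has_integral (U b - U a)) {a..b}"
    using lipschitz_density[OF lipc] by blast
  show ?thesis
  proof (rule that[of \<kappa>])
    show "curvature_of L T \<kappa>"
      unfolding curvature_of_def
    proof (intro conjI ballI)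
      have "((\<lambda>t. \<kappa> t *\<^sub>R (1::complex)) has_integral complex_of_real (\<theta>c L) - complex_of_real (\<theta>c 0)) {0..L}"
        using \<open>L > 0\<close> by (intro \<kappa>) (auto simp: scaleR_conv_of_real)
      from has_integral_Re[OF this] show "\<kappa> integrable_on {0..L}"
        by (auto simp: has_integral_iff)
      fix s assume s: "s \<in> {0..L}"
      define E where "E = (\<lambda>t. exp (\<i> * complex_of_real (\<theta>c t)))"
      have E: "E t = T t" if "t \<in> {0..L}" for t
        using T that by (simp add: E_def \<theta>c)
      have "((\<lambda>t. \<kappa> t *\<^sub>R (\<i> * E t)) has_integral (E s - E 0)) {0..s}"
      proof (rule \<kappa>)
        show "continuous_on UNIV (\<lambda>t. \<i> * E t)"
          unfolding E_def by (intro continuous_intros contc)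
        show "((\<lambda>t. E t - \<theta>c t *\<^sub>R (\<i> * E s)) has_vector_derivative 0) (at s)" for s
        proof -
          \<comment> \<open>First-order Taylor remainder of exp (i y) at \<open>\<theta>c s\<close>,
            up to a constant.\<close>
          define H where "H = (\<lambda>y. exp (\<i> * complex_of_real y) - y *\<^sub>R (\<i> * E s))"
          have "(H has_vector_derivative 0) (at (\<theta>c s))"
            unfolding H_def E_def
            by (rule derivative_eq_intros has_vector_derivative_real_field | simp)+
          from has_vector_derivative_zero_lipschitz_comp[OF lipc this]
          show ?thesis
            by (simp add: H_def E_def)
        qed
      qed (use s in auto)
      then have "((\<lambda>t. \<i> * complex_of_real (\<kappa> t) * T t) has_integral (T s - T 0)) {0..s}"
        using s E by (auto elim!: has_integral_eq[rotated] simp: scaleR_conv_of_real)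
      then show "T s = T 0 + integral {0..s} (\<lambda>t. \<i> * complex_of_real (\<kappa> t) * T t)"
        by (simp add: integral_unique)
    qed
    have "((\<lambda>t. \<kappa> t * \<zeta> t) has_integral
        (\<theta> L * \<zeta> L - \<theta> 0 * \<zeta> 0 - integral {0..L} (\<lambda>t. \<theta> t * \<zeta>' t))) {0..L}"
      if \<zeta>: "\<And>t. (\<zeta> has_real_derivative \<zeta>' t) (at t)" and \<zeta>': "continuous_on UNIV \<zeta>'"
      for \<zeta> \<zeta>' :: "real \<Rightarrow> real"
    proof -
      have cont\<zeta>: "continuous_on UNIV \<zeta>"
        using \<zeta> DERIV_isCont continuous_at_imp_continuous_on by blast
      obtain P where P: "\<And>t. (P has_vector_derivative \<theta>c t * \<zeta>' t) (at t)"
        using continuous_antiderivative[OF continuous_on_mult[OF contc \<zeta>']] by blast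
      \<comment> \<open>Since P' = \<theta> \<zeta>', this is the primitive with dU = \<zeta>
        d\<theta>.\<close>
      define U where "U = (\<lambda>t. complex_of_real (\<theta>c t * \<zeta> t - P t))"
      have "((\<lambda>t. \<kappa> t *\<^sub>R complex_of_real (\<zeta> t)) has_integral (U L - U 0)) {0..L}"
      proof (rule \<kappa>)
        show "continuous_on UNIV (\<lambda>t. complex_of_real (\<zeta> t))"
          by (intro continuous_intros cont\<zeta>)
        show "((\<lambda>t. U t - \<theta>c t *\<^sub>R complex_of_real (\<zeta> s)) has_vector_derivative 0) (at s)" for s
        proof -
          \<comment> \<open>Up to this product of two increments,
            \<open>U t - \<theta>c t * \<zeta> s\<close> equals
            \<open>\<theta>c s * (\<zeta> t - \<zeta> s) - P t\<close>, which is differentiable; the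
            product is negligible because one increment is Lipschitz and the other tends to
            0.\<close>
          have "((\<lambda>t. (\<theta>c t - \<theta>c s) * (\<zeta> t - \<zeta> s)) has_vector_derivative 0) (at s)"
            unfolding has_vector_derivative_zero_within_iff
          proof (intro allI impI)
            fix e :: real assume "e > 0"
            define e' where "e' = e / (K' + 1)"
            have e': "e' > 0" "e' * K' \<le> e"
              using \<open>e > 0\<close> \<open>K' \<ge> 0\<close> by (auto simp: e'_def field_simps)
            obtain d where d: "d > 0" "\<And>y. \<bar>y - s\<bar> < d \<Longrightarrow> \<bar>\<zeta> y - \<zeta> s\<bar> \<le> e'"
              using cont\<zeta> e'(1) by (metis UNIV_I continuous_on_iff dist_real_def less_imp_le)
            show "\<exists>d>0. \<forall>y\<in>UNIV. \<bar>y - s\<bar> < d \<longrightarrow>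
                norm ((\<theta>c y - \<theta>c s) * (\<zeta> y - \<zeta> s) - (\<theta>c s - \<theta>c s) * (\<zeta> s - \<zeta> s)) \<le> e * \<bar>y - s\<bar>"
            proof (intro exI[of _ d] conjI ballI impI d(1))
              fix y assume y: "\<bar>y - s\<bar> < d"
              have "\<bar>\<theta>c y - \<theta>c s\<bar> * \<bar>\<zeta> y - \<zeta> s\<bar> \<le> (K' * \<bar>y - s\<bar>) * e'"
                using lipc[of y s] d(2)[OF y] \<open>K' \<ge> 0\<close> by (intro mult_mono) auto
              also have "\<dots> \<le> e * \<bar>y - s\<bar>"
                using mult_right_mono[OF e'(2), of "\<bar>y - s\<bar>"] by (simp add: mult_ac)
              finally show "norm ((\<theta>c y - \<theta>c s) * (\<zeta> y - \<zeta> s) - (\<theta>c s - \<theta>c s) * (\<zeta> s - \<zeta> s)) \<le> e * \<bar>y - s\<bar>"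
                by (simp add: abs_mult)
            qed
          qed
          moreover have "((\<lambda>t. \<theta>c s * (\<zeta> t - \<zeta> s) - P t) has_vector_derivative 0) (at s)"
            by (rule derivative_eq_intros P \<zeta>[unfolded has_real_derivative_iff_has_vector_derivative] refl | simp)+
          ultimately have "((\<lambda>t. (\<theta>c t - \<theta>c s) * (\<zeta> t - \<zeta> s) + (\<theta>c s * (\<zeta> t - \<zeta> s) - P t)) has_vector_derivative 0 + 0) (at s)"
            by (rule has_vector_derivative_add)
          from has_vector_derivative_of_real[OF this[folded has_real_derivative_iff_has_vector_derivative]]
          have "((\<lambda>t. complex_of_real ((\<theta>c t - \<theta>c s) * (\<zeta> t - \<zeta> s) + (\<theta>c s * (\<zeta> t - \<zeta> s) - P t))) has_vector_derivative 0) (at s)"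
            by simp
          then show ?thesis
            by (simp add: U_def scaleR_conv_of_real algebra_simps)
        qed
      qed (use \<open>L > 0\<close> in simp)
      from has_integral_Re[OF this]
      have 1: "((\<lambda>t. \<kappa> t * \<zeta> t) has_integral ((\<theta>c L * \<zeta> L - P L) - (\<theta>c 0 * \<zeta> 0 - P 0))) {0..L}"
        by (simp add: U_def)
      have "((\<lambda>t. \<theta>c t * \<zeta>' t) has_integral (P L - P 0)) {0..L}"
        using \<open>L > 0\<close> P by (intro fundamental_theorem_of_calculus) (auto intro: has_vector_derivative_at_within)
      then have "((\<lambda>t. \<theta> t * \<zeta>' t) has_integral (P L - P 0)) {0..L}"
        by (rule has_integral_eq[rotated]) (simp add: \<theta>c)
      then have "P L - P 0 = integral {0..L} (\<lambda>t. \<theta> t * \<zeta>' t)"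
        by (simp add: integral_unique)
      then show ?thesis
        using 1 \<theta>c[of 0] \<theta>c[of L] \<open>L > 0\<close> by (simp add: algebra_simps)
    qed
    then show "\<forall>\<zeta> \<zeta>'. (\<forall>t. (\<zeta> has_real_derivative \<zeta>' t) (at t)) \<and> continuous_on UNIV \<zeta>' \<longrightarrow>
      ((\<lambda>t. \<kappa> t * \<zeta> t) has_integral
        (\<theta> L * \<zeta> L - \<theta> 0 * \<zeta> 0 - integral {0..L} (\<lambda>t. \<theta> t * \<zeta>' t))) {0..L}"
      by blast
  qed
qed

section \<open>Boundary parametrisations and boundary correspondence\<close>

lemma periodic_shift_int:
  fixes f :: "real \<Rightarrow> 'a"
  assumes "\<And>t. f (t + L) = f t"
  shows "f (t + of_int n * L) = f t"
proof -
  have nat: "f (t + of_nat k * L) = f t" for k t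
  proof (induction k)
    case (Suc k)
    then show ?case
      using assms[of "t + of_nat k * L"] by (simp add: algebra_simps)
  qed simp
  show ?thesis
  proof (cases "n \<ge> 0")
    case True
    then show ?thesis
      using nat[of t "nat n"] by simp
  next
    case False
    then show ?thesis
      using nat[of "t + of_int n * L" "nat (- n)"] by simp
  qed
qed

lemma real_mod_period:
  fixes t L :: real
  assumes "L > 0"
  obtains s n where "s \<in> {0..<L}" and "t = s + of_int n * L"
proof
  show "t = (t - of_int \<lfloor>t / L\<rfloor> * L) + of_int \<lfloor>t / L\<rfloor> * L"
    by simp
  show "t - of_int \<lfloor>t / L\<rfloor> * L \<in> {0..<L}"
    using assms floor_divide_lower[of L t] floor_divide_upper[of L t] by (simp add: algebra_simps)
qed

context
  fixes \<Omega> L \<gamma> T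
  assumes param: "C11_boundary_param \<Omega> L \<gamma> T"
begin

lemma
  shows param_L_pos: "L > 0"
    and param_periodic: "\<gamma> (t + L) = \<gamma> t"
    and param_deriv: "(\<gamma> has_vector_derivative T t) (at t)"
    and param_norm: "norm (T t) = 1"
    and param_inj: "inj_on \<gamma> {0..<L}"
    and param_image: "\<gamma> ` {0..L} = frontier \<Omega>"
    and param_winding: "z \<in> \<Omega> \<Longrightarrow> winding_number (\<lambda>t. \<gamma> (L * t)) z = 1"
  using param by (auto simp: C11_boundary_param_def)

lemma param_lipschitz: obtains K where "\<And>s t. norm (T s - T t) \<le> K * \<bar>s - t\<bar>"
  using param by (auto simp: C11_boundary_param_def)

lemma param_in_frontier: "\<gamma> t \<in> frontier \<Omega>"
proof -
  obtain s n where s: "s \<in> {0..<L}" "t = s + of_int n * L"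
    using real_mod_period[OF param_L_pos] by blast
  then have "\<gamma> t = \<gamma> s"
    using periodic_shift_int[of \<gamma>, OF param_periodic] by simp
  then show ?thesis
    using s(1) param_image by force
qed

lemma param_eq_imp_period:
  assumes "\<gamma> x = \<gamma> y"
  obtains n :: int where "x = y + of_int n * L"
proof -
  obtain s n where s: "s \<in> {0..<L}" "x = s + of_int n * L"
    using real_mod_period[OF param_L_pos] by blast
  obtain r m where r: "r \<in> {0..<L}" "y = r + of_int m * L"
    using real_mod_period[OF param_L_pos] by blast
  have "\<gamma> x = \<gamma> s" "\<gamma> y = \<gamma> r"
    using s r periodic_shift_int[of \<gamma>, OF param_periodic] by simp_all
  then have "s = r"
    using assms param_inj s(1) r(1) by (simp add: inj_on_def)
  then have "x = y + of_int (n - m) * L"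
    using s(2) r(2) by (simp add: algebra_simps)
  then show ?thesis
    by (rule that)
qed

lemma param_preimage:
  assumes "x \<in> frontier \<Omega>"
  obtains s where "s \<in> {0..<L}" and "\<gamma> s = x"
proof -
  obtain t where t: "t \<in> {0..L}" "\<gamma> t = x"
    using assms param_image by (metis imageE)
  show ?thesis
  proof (cases "t = L")
    case True
    then show ?thesis
      using that[of 0] t param_periodic[of 0] param_L_pos by simp
  qed (use that[of t] t in auto)
qed

lemma param_continuous: "continuous_on S \<gamma>"
  using param_deriv has_vector_derivative_continuous continuous_at_imp_continuous_on by blast

lemma param_tangent_continuous: "continuous_on S T"
proof -
  obtain K where K: "\<And>s t. norm (T s - T t) \<le> K * \<bar>s - t\<bar>"
    using param_lipschitz by blast
  have "K-lipschitz_on UNIV T"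
    using K order_trans[OF norm_ge_zero K[of 0 1]] by (intro lipschitz_onI) (auto simp: dist_norm)
  then show ?thesis
    using lipschitz_on_continuous_on continuous_on_subset by blast
qed

end

section \<open>Continuous logarithms and lifts to the circle\<close>

lemma exp_eq_1_imp_constant_on:
  fixes D :: "'a::topological_space \<Rightarrow> complex"
  assumes "connected S" and "continuous_on S D" and expD: "\<And>x. x \<in> S \<Longrightarrow> exp (D x) = 1"
  shows "D constant_on S"
proof (rule continuous_discrete_range_constant[OF assms(1,2)])
  fix x assume "x \<in> S"
  \<comment> \<open>The values of \<open>D\<close> are integer multiples of 2 \<pi> i, so distinct
    ones are at least 2 \<pi> apart.\<close>
  show "\<exists>e>0. \<forall>y. y \<in> S \<and> D y \<noteq> D x \<longrightarrow> e \<le> norm (D y - D x)"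
  proof (intro exI[of _ "2 * pi"] conjI allI impI)
    fix y assume y: "y \<in> S \<and> D y \<noteq> D x"
    have "exp (D y - D x) = 1"
      using expD \<open>x \<in> S\<close> y by (simp add: exp_diff)
    then obtain n :: int where n: "Re (D y - D x) = 0" "Im (D y - D x) = of_int (2 * n) * pi"
      by (auto simp: exp_eq_1)
    then have "n \<noteq> 0"
      using y by (auto simp: complex_eq_iff)
    then have "1 \<le> \<bar>n\<bar>"
      by simp
    then have "1 \<le> \<bar>of_int n :: real\<bar>"
      by linarith
    then have "2 * pi \<le> \<bar>Im (D y - D x)\<bar>"
      using n(2) by (simp add: abs_mult)
    then show "2 * pi \<le> norm (D y - D x)"
      using abs_Im_le_cmod order_trans by blast
  qed simp
qed

text \<open>Any two continuous logarithms of p - z differ by a constant, so every one of them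
  computes the winding number.\<close>

lemma winding_number_exp_log:
  assumes "path p" and "z \<notin> path_image p" and q: "continuous_on {0..1} q"
    and pq: "\<And>t. t \<in> {0..1} \<Longrightarrow> p t = z + exp (q t)"
  shows "q 1 - q 0 = 2 * of_real pi * \<i> * winding_number p z"
proof -
  obtain r where r: "path r" "pathfinish r - pathstart r = 2 * of_real pi * \<i> * winding_number p z"
    "\<And>t. t \<in> {0..1} \<Longrightarrow> p t = z + exp (r t)"
    using winding_number_as_continuous_log[OF assms(1,2)] by blast
  define D where "D = (\<lambda>t. r t - q t)"
  have expD: "exp (D t) = 1" if "t \<in> {0..1}" for t
    using pq[OF that] r(3)[OF that] by (simp add: D_def exp_diff)
  have "D constant_on {0..1}"
    using q r(1) expD by (intro exp_eq_1_imp_constant_on) (auto simp: D_def path_def intro!: continuous_intros)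
  then have "D 1 = D 0"
    by (auto simp: constant_on_def)
  then show ?thesis
    using r(2) by (simp add: D_def pathfinish_def pathstart_def algebra_simps)
qed

text \<open>Differentiating |g| = 1 gives g' = i b g with real b. The lift is obtained by
  integrating the angular speed b, since g exp (- i \<beta>) is then constant; this makes it C^1 at
  once.\<close>

lemma continuous_circle_lift:
  fixes g :: "real \<Rightarrow> complex"
  assumes norm: "\<And>t. norm (g t) = 1" and g': "\<And>t. (g has_vector_derivative g' t) (at t)"
    and cont: "continuous_on UNIV g'"
  obtains \<beta> b :: "real \<Rightarrow> real" where "continuous_on UNIV b"
    and "\<And>t. (\<beta> has_real_derivative b t) (at t)" and "\<And>t. g t = exp (\<i> * complex_of_real (\<beta> t))"
    and "\<And>t. g' t = \<i> * complex_of_real (b t) * g t"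
proof -
  have contg: "continuous_on UNIV g"
    using g' has_vector_derivative_continuous continuous_at_imp_continuous_on by blast
  define b where "b = (\<lambda>t. Im (cnj (g t) * g' t))"
  have contb: "continuous_on UNIV b"
    unfolding b_def by (intro continuous_intros contg cont)
  have "inner (g t) (g' t) = 0" for t
  proof -
    have "((\<lambda>t. inner (g t) (g t)) has_vector_derivative (inner (g t) (g' t) + inner (g' t) (g t))) (at t)"
      using bounded_bilinear.has_vector_derivative[OF bounded_bilinear_inner g' g'] .
    moreover have "(\<lambda>t. inner (g t) (g t)) = (\<lambda>t. 1)"
      using norm by (simp add: power2_norm_eq_inner[symmetric])
    ultimately show ?thesis
      using vector_derivative_unique_at[OF _ has_vector_derivative_const[of "1::real"]]
      by (fastforce simp: inner_commute)
  qed
  then have "cnj (g t) * g' t = \<i> * complex_of_real (b t)" for t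
    by (simp add: b_def complex_eq_iff inner_complex_def)
  moreover have "g t * cnj (g t) = 1" for t
    using norm[of t] complex_norm_square[of "g t"] by simp
  ultimately have g'b: "g' t = \<i> * complex_of_real (b t) * g t" for t
    by (metis mult.assoc mult.commute mult.left_neutral)
  obtain \<beta> where \<beta>: "\<And>t. (\<beta> has_vector_derivative b t) (at t)"
    using continuous_antiderivative[OF contb] by blast
  define G where "G = (\<lambda>t. g t * exp (- (\<i> * complex_of_real (\<beta> t))))"
  have "(G has_vector_derivative 0) (at t)" for t
  proof -
    have "((\<lambda>t. complex_of_real (\<beta> t)) has_vector_derivative complex_of_real (b t)) (at t)"
      using has_vector_derivative_of_real[OF \<beta>[folded has_real_derivative_iff_has_vector_derivative]] .
    then have "((\<lambda>t. - (\<i> * complex_of_real (\<beta> t))) has_vector_derivative - (\<i> * complex_of_real (b t))) (at t)"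
      by (intro has_vector_derivative_minus has_vector_derivative_mult_right)
    from field_vector_diff_chain_at[OF this DERIV_exp]
    have "((\<lambda>t. exp (- (\<i> * complex_of_real (\<beta> t)))) has_vector_derivative
        - (\<i> * complex_of_real (b t)) * exp (- (\<i> * complex_of_real (\<beta> t)))) (at t)"
      by (simp add: o_def)
    from has_vector_derivative_mult[OF g' this]
    show ?thesis
      by (simp add: G_def g'b algebra_simps)
  qed
  then obtain k where k: "\<And>t. G t = k"
    using has_vector_derivative_zero_constant[of UNIV G] by auto
  have "norm k = 1"
    using k[of 0] norm[of 0] by (auto simp: G_def norm_mult)
  then obtain \<alpha> where \<alpha>: "k = exp (\<i> * complex_of_real \<alpha>)"
    using Arg_eq[of k] by fastforce
  show ?thesis
  proof (rule that[of b "\<lambda>t. \<beta> t + \<alpha>"])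
    show "((\<lambda>t. \<beta> t + \<alpha>) has_real_derivative b t) (at t)" for t
      using \<beta>[folded has_real_derivative_iff_has_vector_derivative] by (auto intro!: derivative_eq_intros)
    show "g t = exp (\<i> * complex_of_real (\<beta> t + \<alpha>))" for t
      using k[of t] \<alpha> by (simp add: G_def exp_minus algebra_simps exp_add divide_simps)
  qed (use contb g'b in auto)
qed

text \<open>\<open>image_ball\<close> does not occur among the hypotheses of the theorem;
  \<open>conformal_image_ball\<close> derives it from the boundary parametrisation. Derivatives on
  the closed sets are taken within them, hence one-sided at the boundary.\<close>

locale C1_conformal_diffeo =
  fixes \<Omega> :: "complex set" and \<Phi> \<Phi>' \<Psi> \<Psi>' :: "complex \<Rightarrow> complex"
  assumes open_\<Omega>: "open \<Omega>"
    and cont_\<Phi>': "continuous_on (cball 0 1) \<Phi>'"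
    and deriv_\<Phi>: "\<And>z. z \<in> cball 0 1 \<Longrightarrow> (\<Phi> has_field_derivative \<Phi>' z) (at z within cball 0 1)"
    and \<Phi>'_nonzero: "\<And>z. z \<in> cball 0 1 \<Longrightarrow> \<Phi>' z \<noteq> 0"
    and cont_\<Psi>': "continuous_on (closure \<Omega>) \<Psi>'"
    and deriv_\<Psi>: "\<And>w. w \<in> closure \<Omega> \<Longrightarrow> (\<Psi> has_field_derivative \<Psi>' w) (at w within closure \<Omega>)"
    and \<Psi>_\<Phi>: "\<And>z. z \<in> cball 0 1 \<Longrightarrow> \<Psi> (\<Phi> z) = z"
    and \<Phi>_\<Psi>: "\<And>w. w \<in> closure \<Omega> \<Longrightarrow> \<Phi> (\<Psi> w) = w"
    and image_cball: "\<Phi> ` cball 0 1 = closure \<Omega>"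
    and image_ball: "\<Phi> ` ball 0 1 = \<Omega>"
begin

lemma cont_\<Phi>: "continuous_on (cball 0 1) \<Phi>"
  using deriv_\<Phi> DERIV_continuous_on by blast

lemma cont_\<Psi>: "continuous_on (closure \<Omega>) \<Psi>"
  using deriv_\<Psi> DERIV_continuous_on by blast

lemma \<Psi>_in_cball: "w \<in> closure \<Omega> \<Longrightarrow> \<Psi> w \<in> cball 0 1"
  using \<Psi>_\<Phi> image_cball by (metis imageE)

lemma \<Psi>_in_ball: "w \<in> \<Omega> \<Longrightarrow> \<Psi> w \<in> ball 0 1"
  using \<Psi>_\<Phi> image_ball ball_subset_cball by (metis imageE subsetD)

lemma norm_\<Psi>_frontier:
  assumes "w \<in> frontier \<Omega>"
  shows "norm (\<Psi> w) = 1"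
proof -
  have w: "w \<in> closure \<Omega>" "w \<notin> \<Omega>"
    using assms open_\<Omega> by (auto simp: frontier_def interior_open)
  have "\<Psi> w \<notin> ball 0 1"
    using \<Phi>_\<Psi>[OF w(1)] w(2) image_ball by (metis imageI)
  then show ?thesis
    using \<Psi>_in_cball[OF w(1)] by auto
qed

lemma \<Phi>_sphere_frontier:
  assumes "norm z = 1"
  shows "\<Phi> z \<in> frontier \<Omega>"
proof -
  have "\<Phi> z \<in> closure \<Omega>"
    using assms image_cball by force
  moreover have "\<Phi> z \<notin> \<Omega>"
    using \<Psi>_in_ball[of "\<Phi> z"] \<Psi>_\<Phi>[of z] assms by auto
  ultimately show ?thesis
    using open_\<Omega> by (simp add: frontier_def interior_open)
qed

lemma deriv_\<Phi>_eq: "z \<in> ball 0 1 \<Longrightarrow> (\<Phi> has_field_derivative \<Phi>' z) (at z)"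
  using deriv_\<Phi>[of z] at_within_interior[of z "cball 0 1"] by (simp add: interior_cball)

lemma holomorphic_\<Phi>': "\<Phi>' holomorphic_on ball 0 1"
proof -
  have "\<Phi> holomorphic_on ball 0 1"
    unfolding holomorphic_on_open[OF open_ball] using deriv_\<Phi>_eq by blast
  then have "deriv \<Phi> holomorphic_on ball 0 1"
    by (simp add: holomorphic_deriv)
  then show ?thesis
    by (rule holomorphic_transform) (use deriv_\<Phi>_eq DERIV_imp_deriv in blast)
qed

lemma holomorphic_\<Psi>: "\<Psi> holomorphic_on \<Omega>"
  unfolding holomorphic_on_def field_differentiable_def
  using deriv_\<Psi> closure_subset DERIV_subset by (metis subsetD)

text \<open>One logarithm is continuous on the closed disc, another is holomorphic inside. They
  differ by a constant on the open disc, so the first has both properties.\<close>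

lemma log_\<Phi>':
  obtains l where "continuous_on (cball 0 1) l" and "l holomorphic_on ball 0 1"
    and "\<And>z. z \<in> cball 0 1 \<Longrightarrow> \<Phi>' z = exp (l z)"
proof -
  obtain l where l: "continuous_on (cball 0 1) l" "\<And>z. z \<in> cball 0 1 \<Longrightarrow> \<Phi>' z = exp (l z)"
    using continuous_logarithm_on_cball[OF cont_\<Phi>' \<Phi>'_nonzero] by blast
  obtain G where G: "G holomorphic_on ball 0 1" "\<And>z. z \<in> ball 0 1 \<Longrightarrow> \<Phi>' z = exp (G z)"
    using contractible_imp_holomorphic_log[OF holomorphic_\<Phi>'] \<Phi>'_nonzero convex_imp_contractible[OF convex_ball]
    by (metis ball_subset_cball subsetD)
  have "(\<lambda>z. l z - G z) constant_on ball 0 1"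
  proof (rule exp_eq_1_imp_constant_on)
    show "continuous_on (ball 0 1) (\<lambda>z. l z - G z)"
      by (intro continuous_intros continuous_on_subset[OF l(1)] holomorphic_on_imp_continuous_on[OF G(1)]) auto
    show "exp (l z - G z) = 1" if "z \<in> ball 0 1" for z
    proof -
      have "exp (l z) = exp (G z)"
        using l(2)[of z] G(2)[OF that] that by simp
      then show ?thesis
        by (simp add: exp_diff)
    qed
  qed simp
  then obtain k where k: "\<And>z. z \<in> ball 0 1 \<Longrightarrow> l z - G z = k"
    by (auto simp: constant_on_def)
  have "(\<lambda>z. k + G z) holomorphic_on ball 0 1"
    by (intro holomorphic_intros G(1))
  then have "l holomorphic_on ball 0 1"
    by (rule holomorphic_transform) (use k in \<open>force simp: algebra_simps\<close>)
  then show ?thesis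
    using that l by blast
qed

text \<open>With Q the difference quotient of \<Phi> at 0, \<gamma> - \<Phi> 0 = \<Psi>(\<gamma>)
  Q(\<Psi>(\<gamma>)). On the closed disc Q has a continuous logarithm h, and h(\<Psi>(\<gamma>))
  returns to its value after one period, so the winding number of \<gamma> comes from \<beta>
  alone.\<close>

lemma boundary_winding:
  assumes param: "C11_boundary_param \<Omega> L \<gamma> T"
    and \<beta>: "continuous_on UNIV \<beta>" "\<And>t. \<Psi> (\<gamma> t) = exp (\<i> * complex_of_real (\<beta> t))"
  shows "\<beta> L - \<beta> 0 = 2 * pi"
proof -
  note fr = param_in_frontier[OF param]
  have cl: "\<gamma> t \<in> closure \<Omega>" for t
    using fr by (simp add: frontier_def)
  define Q where "Q = (\<lambda>z. if z = 0 then \<Phi>' 0 else (\<Phi> z - \<Phi> 0) / z)"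
  have "continuous_on (cball 0 1) Q"
    unfolding continuous_on_eq_continuous_within
  proof
    fix z :: complex assume z: "z \<in> cball 0 1"
    show "continuous (at z within cball 0 1) Q"
    proof (cases "z = 0")
      case True
      have "((\<lambda>z. (\<Phi> z - \<Phi> 0) / (z - 0)) \<longlongrightarrow> \<Phi>' 0) (at 0 within cball 0 1)"
        using deriv_\<Phi>[of 0] by (simp add: has_field_derivative_iff)
      then have "(Q \<longlongrightarrow> \<Phi>' 0) (at 0 within cball 0 1)"
        by (rule Lim_transform_eventually) (auto simp: Q_def eventually_at_filter)
      then show ?thesis
        using True by (simp add: continuous_within Q_def)
    next
      case False
      have "continuous (at z within cball 0 1) (\<lambda>z. (\<Phi> z - \<Phi> 0) / z)"
        using False z cont_\<Phi> by (intro continuous_intros) (auto simp: continuous_on_eq_continuous_within)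
      moreover have "\<forall>\<^sub>F w in at z within cball 0 1. (\<Phi> w - \<Phi> 0) / w = Q w"
        using eventually_neq_at_within[of 0 z "cball 0 1"] by (rule eventually_mono) (auto simp: Q_def)
      ultimately show ?thesis
        using False by (auto simp: continuous_within Q_def intro: Lim_transform_eventually)
    qed
  qed
  \<comment> \<open>Away from 0 by injectivity of \<open>\<Phi>\<close>, at 0 because
    \<open>\<Phi>' 0 \<noteq> 0\<close>.\<close>
  moreover have "Q z \<noteq> 0" if "z \<in> cball 0 1" for z
    using that \<Psi>_\<Phi>[of z] \<Psi>_\<Phi>[of 0] \<Phi>'_nonzero[of 0] by (auto simp: Q_def)
  ultimately obtain h where h: "continuous_on (cball 0 1) h" "\<And>z. z \<in> cball 0 1 \<Longrightarrow> Q z = exp (h z)"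
    using continuous_logarithm_on_cball by blast
  define p where "p = (\<lambda>t. \<gamma> (L * t))"
  define q where "q = (\<lambda>t. \<i> * complex_of_real (\<beta> (L * t)) + h (\<Psi> (p t)))"
  have contp: "continuous_on {0..1} p"
    unfolding p_def by (rule continuous_on_compose2[OF param_continuous[OF param, of UNIV]]) (auto intro!: continuous_intros)
  have "\<Phi> 0 \<in> \<Omega>"
    using image_ball by force
  have "q 1 - q 0 = 2 * of_real pi * \<i> * winding_number p (\<Phi> 0)"
  proof (rule winding_number_exp_log)
    show "path p"
      using contp by (simp add: path_def)
    show "\<Phi> 0 \<notin> path_image p"
      using fr open_\<Omega> \<open>\<Phi> 0 \<in> \<Omega>\<close> by (auto simp: path_image_def p_def frontier_def interior_open)
    show "continuous_on {0..1} q"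
      unfolding q_def
    proof (intro continuous_intros)
      show "continuous_on {0..1} (\<lambda>t. \<beta> (L * t))"
        by (rule continuous_on_compose2[OF \<beta>(1)]) (auto intro!: continuous_intros)
      have "continuous_on {0..1} (\<lambda>t. \<Psi> (p t))"
        using cl by (intro continuous_on_compose2[OF cont_\<Psi> contp]) (auto simp: p_def)
      then show "continuous_on {0..1} (\<lambda>t. h (\<Psi> (p t)))"
        using cl \<Psi>_in_cball by (intro continuous_on_compose2[OF h(1)]) (auto simp: p_def)
    qed
    show "p t = \<Phi> 0 + exp (q t)" for t
    proof -
      define z where "z = \<Psi> (p t)"
      have z: "norm z = 1" "\<Phi> z = p t"
        using norm_\<Psi>_frontier[OF fr] \<Phi>_\<Psi>[OF cl] by (auto simp: z_def p_def)
      have "exp (q t) = z * Q z"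
        using h(2)[of z] z(1) \<beta>(2)[of "L * t"] by (simp add: q_def exp_add z_def p_def)
      also have "\<dots> = p t - \<Phi> 0"
        using z by (auto simp: Q_def)
      finally show ?thesis
        by simp
    qed
  qed
  moreover have "q 1 - q 0 = \<i> * complex_of_real (\<beta> L - \<beta> 0)"
    using param_periodic[OF param, of 0] by (simp add: q_def p_def algebra_simps)
  moreover have "winding_number p (\<Phi> 0) = 1"
    using param_winding[OF param \<open>\<Phi> 0 \<in> \<Omega>\<close>] by (simp add: p_def)
  ultimately have "\<i> * complex_of_real (\<beta> L - \<beta> 0) = \<i> * complex_of_real (2 * pi)"
    by simp
  then show ?thesis
    by (simp only: mult_cancel_left complex_i_not_zero of_real_eq_iff simp_thms)
qed

text \<open>Differentiating \<Phi>(\<Psi>(\<gamma>)) = \<gamma> gives T = i b \<Psi>(\<gamma>)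
  \<Phi>'(\<Psi>(\<gamma>)) with b = \<beta>'. Unit speed determines |b|, the orientation its
  sign.\<close>

lemma boundary_correspondence:
  assumes param: "C11_boundary_param \<Omega> L \<gamma> T"
  obtains \<beta> :: "real \<Rightarrow> real" where "\<And>t. \<Psi> (\<gamma> t) = exp (\<i> * complex_of_real (\<beta> t))"
    and "\<And>t. (\<beta> has_real_derivative 1 / norm (\<Phi>' (\<Psi> (\<gamma> t)))) (at t)"
    and "\<And>t. \<beta> (t + L) = \<beta> t + 2 * pi"
    and "\<And>t. T t = \<i> * \<Psi> (\<gamma> t) * \<Phi>' (\<Psi> (\<gamma> t)) / complex_of_real (norm (\<Phi>' (\<Psi> (\<gamma> t))))"
proof -
  note fr = param_in_frontier[OF param]
  have cl: "\<gamma> t \<in> closure \<Omega>" for t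
    using fr by (simp add: frontier_def)
  define g where "g = (\<lambda>t. \<Psi> (\<gamma> t))"
  define g' where "g' = (\<lambda>t. T t * \<Psi>' (\<gamma> t))"
  have g_norm: "norm (g t) = 1" for t
    using norm_\<Psi>_frontier[OF fr] by (simp add: g_def)
  have g_cball: "g t \<in> cball 0 1" for t
    using g_norm[of t] by simp
  have g_deriv: "(g has_vector_derivative g' t) (at t)" for t
  proof -
    have "((\<Psi> \<circ> \<gamma>) has_vector_derivative T t * \<Psi>' (\<gamma> t)) (at t)"
      by (rule field_vector_diff_chain_within[OF param_deriv[OF param] DERIV_subset[OF deriv_\<Psi>[OF cl]]])
         (use cl in blast)
    then show ?thesis
      by (simp add: g_def g'_def o_def)
  qed
  have g'_cont: "continuous_on UNIV g'"
  proof -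
    have "continuous_on UNIV (\<lambda>t. \<Psi>' (\<gamma> t))"
      by (rule continuous_on_compose2[OF cont_\<Psi>' param_continuous[OF param]]) (use cl in blast)
    then show ?thesis
      unfolding g'_def by (rule continuous_on_mult[OF param_tangent_continuous[OF param]])
  qed
  obtain \<beta> b :: "real \<Rightarrow> real" where b: "continuous_on UNIV b" "\<And>t. (\<beta> has_real_derivative b t) (at t)"
    "\<And>t. g t = exp (\<i> * complex_of_real (\<beta> t))" "\<And>t. g' t = \<i> * complex_of_real (b t) * g t"
    by (rule continuous_circle_lift[OF g_norm g_deriv g'_cont]) (rule that)
  have T: "T t = \<Phi>' (g t) * g' t" for t
  proof -
    have "((\<Phi> \<circ> g) has_vector_derivative g' t * \<Phi>' (g t)) (at t)"
      by (rule field_vector_diff_chain_within[OF g_deriv DERIV_subset[OF deriv_\<Phi>[OF g_cball]]])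
         (use g_cball in blast)
    moreover have "\<Phi> \<circ> g = \<gamma>"
      using \<Phi>_\<Psi> cl by (auto simp: g_def)
    ultimately show ?thesis
      using vector_derivative_unique_at[OF param_deriv[OF param]] by (simp add: mult.commute)
  qed
  have abs_b: "\<bar>b t\<bar> * norm (\<Phi>' (g t)) = 1" for t
    using param_norm[OF param, of t] g_norm[of t] by (simp add: T b(4) norm_mult mult.commute)
  have b_nz: "b t \<noteq> 0" for t
    using abs_b[of t] by auto
  have cont\<beta>: "continuous_on UNIV \<beta>"
    using b(2) DERIV_isCont continuous_at_imp_continuous_on by blast
  have \<beta>L: "\<beta> L - \<beta> 0 = 2 * pi"
    using b(3) by (intro boundary_winding[OF param cont\<beta>]) (simp add: g_def)
  \<comment> \<open>\<open>b\<close> is continuous without zeros, so a negative value anywhere would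
    make \<open>\<beta>\<close> decreasing, against its increase by 2 \<pi> over a period.\<close>
  have b_pos: "b t > 0" for t
  proof (rule ccontr)
    assume "\<not> b t > 0"
    then have "b t < 0"
      using b_nz[of t] by linarith
    have neg: "b s < 0" for s
    proof (rule ccontr)
      assume "\<not> b s < 0"
      then have "b s > 0"
        using b_nz[of s] by linarith
      have "connected (range b)"
        using b(1) connected_continuous_image connected_UNIV by blast
      then have "0 \<in> range b"
        using \<open>b t < 0\<close> \<open>b s > 0\<close> connectedD_interval[of "range b" "b t" "b s" 0] by force
      then show False
        using b_nz by (metis imageE)
    qed
    have "\<beta> L < \<beta> 0"
      by (rule DERIV_neg_imp_decreasing[OF param_L_pos[OF param]]) (use b(2) neg in blast)
    then show False
      using \<beta>L pi_gt_zero by linarith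
  qed
  have b_eq: "b t = 1 / norm (\<Phi>' (g t))" for t
    using abs_b[of t] b_pos[of t] by (auto simp: eq_divide_eq)
  show ?thesis
  proof (rule that[of \<beta>])
    show "\<Psi> (\<gamma> t) = exp (\<i> * complex_of_real (\<beta> t))" for t
      using b(3)[of t] by (simp add: g_def)
    show "(\<beta> has_real_derivative 1 / norm (\<Phi>' (\<Psi> (\<gamma> t)))) (at t)" for t
      using b(2)[of t] b_eq[of t] by (simp add: g_def)
    show "T t = \<i> * \<Psi> (\<gamma> t) * \<Phi>' (\<Psi> (\<gamma> t)) / complex_of_real (norm (\<Phi>' (\<Psi> (\<gamma> t))))" for t
      by (simp add: T b(4) b_eq) (simp add: g_def)
    have "((\<lambda>t. \<beta> (t + L) - \<beta> t) has_real_derivative 0) (at t)" for t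
    proof -
      have "b (t + L) = b t"
        using param_periodic[OF param] by (simp add: b_eq g_def)
      moreover have "((\<lambda>t. \<beta> (t + L)) has_real_derivative b (t + L)) (at t)"
        using b(2)[of "t + L"] by (simp add: DERIV_shift)
      ultimately show ?thesis
        using b(2)[of t] by (auto intro!: derivative_eq_intros)
    qed
    then have "\<beta> (t + L) - \<beta> t = \<beta> (0 + L) - \<beta> 0" for t
      using DERIV_isconst_all[of "\<lambda>t. \<beta> (t + L) - \<beta> t"] by blast
    then show "\<beta> (t + L) = \<beta> t + 2 * pi" for t
      using \<beta>L by (metis add.commute add_0 diff_add_cancel)
  qed
qed

end

section \<open>Weak derivatives of boundary phases\<close>

text \<open>An open set can be smaller than the interior of its closure, so the claim needs the
  boundary curve: by the Jordan curve theorem every frontier point is approached from the outside,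
  which the open image of the disc, lying in the closure of \<Omega>, cannot meet. The converse
  inclusion is invariance of domain for \<Psi>.\<close>

lemma conformal_image_ball:
  fixes \<Phi> \<Psi> :: "complex \<Rightarrow> complex"
  assumes param: "C11_boundary_param \<Omega> L \<gamma> T" and "open \<Omega>" and "bounded \<Omega>"
    and cont_\<Phi>: "continuous_on (cball 0 1) \<Phi>" and cont_\<Psi>: "continuous_on (closure \<Omega>) \<Psi>"
    and \<Psi>_\<Phi>: "\<And>z. z \<in> cball 0 1 \<Longrightarrow> \<Psi> (\<Phi> z) = z" and \<Phi>_\<Psi>: "\<And>w. w \<in> closure \<Omega> \<Longrightarrow> \<Phi> (\<Psi> w) = w"
    and image: "\<Phi> ` cball 0 1 = closure \<Omega>"
  shows "\<Phi> ` ball 0 1 = \<Omega>"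
proof
  have L: "L > 0"
    by (rule param_L_pos[OF param])
  define c where "c = (\<lambda>t. \<gamma> (L * t))"
  have c_image: "path_image c = frontier \<Omega>"
  proof -
    have "(\<lambda>t. L * t) ` {0..1} = {0..L}"
      using L by (simp add: image_mult_atLeastAtMost)
    then show ?thesis
      unfolding path_image_def c_def param_image[OF param, symmetric] by (metis image_image)
  qed
  have "simple_path c"
    unfolding simple_path_def
  proof
    show "path c"
      unfolding path_def c_def
      by (rule continuous_on_compose2[OF param_continuous[OF param, of UNIV]]) (auto intro!: continuous_intros)
    show "loop_free c"
      unfolding loop_free_def
    proof (intro ballI impI)
      fix x y :: real assume xy: "x \<in> {0..1}" "y \<in> {0..1}" "c x = c y"
      then have "\<gamma> (L * x) = \<gamma> (L * y)"
        by (simp add: c_def)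
      then obtain n :: int where "L * x = L * y + of_int n * L"
        using param_eq_imp_period[OF param] by blast
      then have "L * x = L * (y + of_int n)"
        by (simp add: algebra_simps)
      then have n: "x = y + of_int n"
        using L by simp
      then have "n \<in> {-1, 0, 1}"
        using xy by auto
      then show "x = y \<or> x = 0 \<and> y = 1 \<or> x = 1 \<and> y = 0"
        using n xy by auto
    qed
  qed
  moreover have "pathfinish c = pathstart c"
    using param_periodic[OF param, of 0] by (simp add: pathfinish_def pathstart_def c_def)
  ultimately have outside: "connected (outside (frontier \<Omega>))" "\<not> bounded (outside (frontier \<Omega>))"
    "frontier (outside (frontier \<Omega>)) = frontier \<Omega>"
    using Jordan_inside_outside[of c] by (simp_all add: c_image)
  \<comment> \<open>A connected set avoiding the frontier of \<open>\<Omega>\<close> and meeting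
    \<open>\<Omega>\<close> lies in \<open>\<Omega>\<close>, but the outside is unbounded.\<close>
  have disj: "outside (frontier \<Omega>) \<inter> \<Omega> = {}"
  proof (rule ccontr)
    assume "outside (frontier \<Omega>) \<inter> \<Omega> \<noteq> {}"
    moreover have "outside (frontier \<Omega>) \<inter> frontier \<Omega> = {}"
      using outside_no_overlap by blast
    ultimately have "outside (frontier \<Omega>) \<subseteq> \<Omega>"
      using connected_Int_frontier[OF outside(1), of \<Omega>] by blast
    then show False
      using outside(2) \<open>bounded \<Omega>\<close> bounded_subset by blast
  qed
  have "open (\<Phi> ` ball 0 1)"
    by (rule invariance_of_domain)
       (use cont_\<Phi> \<Psi>_\<Phi> in \<open>auto intro: continuous_on_subset intro!: inj_on_inverseI[of _ \<Psi>]\<close>)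
  show "\<Phi> ` ball 0 1 \<subseteq> \<Omega>"
  proof (rule ccontr)
    assume "\<not> \<Phi> ` ball 0 1 \<subseteq> \<Omega>"
    then obtain x where x: "x \<in> \<Phi> ` ball 0 1" "x \<notin> \<Omega>"
      by blast
    have sub: "\<Phi> ` ball 0 1 \<subseteq> closure \<Omega>"
      using image by force
    then have "x \<in> frontier \<Omega>"
      using x \<open>open \<Omega>\<close> by (auto simp: frontier_def interior_open)
    then have "x \<in> closure (outside (frontier \<Omega>))"
      using outside(3) by (auto simp: frontier_def)
    then obtain y where y: "y \<in> outside (frontier \<Omega>)" "y \<in> \<Phi> ` ball 0 1"
      using \<open>open (\<Phi> ` ball 0 1)\<close> x(1) by (metis closure_iff_nhds_not_empty disjoint_iff subset_refl)
    then have "y \<in> \<Omega> \<union> frontier \<Omega>"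
      using sub \<open>open \<Omega>\<close> by (auto simp: frontier_def interior_open)
    then show False
      using y(1) disj outside_no_overlap by blast
  qed
  have "open (\<Psi> ` \<Omega>)"
  proof (rule invariance_of_domain)
    show "continuous_on \<Omega> \<Psi>"
      using cont_\<Psi> closure_subset continuous_on_subset by blast
    show "inj_on \<Psi> \<Omega>"
      by (rule inj_on_inverseI[of _ \<Phi>]) (use \<Phi>_\<Psi> closure_subset in blast)
  qed fact
  moreover have "\<Psi> ` \<Omega> \<subseteq> cball 0 1"
  proof
    fix z assume "z \<in> \<Psi> ` \<Omega>"
    then obtain w where "w \<in> closure \<Omega>" "z = \<Psi> w"
      using closure_subset by blast
    then show "z \<in> cball 0 1"
      using image \<Psi>_\<Phi> by (metis imageE)
  qed
  ultimately have "\<Psi> ` \<Omega> \<subseteq> ball 0 1"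
    using interior_maximal[of "\<Psi> ` \<Omega>" "cball 0 1"] by (simp add: interior_cball)
  then show "\<Omega> \<subseteq> \<Phi> ` ball 0 1"
    using \<Phi>_\<Psi> closure_subset by (smt (verit) image_iff subset_iff)
qed

section \<open>The sawtooth phase of a single vortex\<close>

lemma product_rule_has_integral:
  fixes u v u' v' :: "real \<Rightarrow> real"
  assumes "p \<le> q" and u: "\<And>t. (u has_real_derivative u' t) (at t)" and v: "\<And>t. (v has_real_derivative v' t) (at t)"
    and "continuous_on UNIV u'" and "continuous_on UNIV v'"
  shows "((\<lambda>t. u t * v' t) has_integral (u q * v q - u p * v p - integral {p..q} (\<lambda>t. u' t * v t))) {p..q}"
proof -
  have "continuous_on UNIV v"
    using v DERIV_isCont continuous_at_imp_continuous_on by blast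
  with assms(4) have "continuous_on UNIV (\<lambda>t. u' t * v t)"
    by (rule continuous_on_mult)
  then have "(\<lambda>t. u' t * v t) integrable_on {p..q}"
    by (intro integrable_continuous_interval) (rule continuous_on_subset, auto)
  then have "((\<lambda>t. u' t * v t) has_integral integral {p..q} (\<lambda>t. u' t * v t)) {p..q}"
    by (rule integrable_integral)
  moreover have "((\<lambda>t. u t * v' t + u' t * v t) has_integral (u q * v q - u p * v p)) {p..q}"
  proof (rule fundamental_theorem_of_calculus[OF \<open>p \<le> q\<close>])
    fix t
    have "((\<lambda>t. u t * v t) has_real_derivative (u t * v' t + u' t * v t)) (at t)"
      using u[of t] v[of t] by (auto intro!: derivative_eq_intros)
    then show "((\<lambda>t. u t * v t) has_vector_derivative (u t * v' t + u' t * v t)) (at t within {p..q})"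
      by (simp add: has_real_derivative_iff_has_vector_derivative has_vector_derivative_at_within)
  qed
  ultimately have "((\<lambda>t. (u t * v' t + u' t * v t) - u' t * v t) has_integral
      (u q * v q - u p * v p - integral {p..q} (\<lambda>t. u' t * v t))) {p..q}"
    by (intro has_integral_diff)
  then show ?thesis
    by simp
qed

text \<open>After \<open>s\<close> the angle \<open>\<beta> t - \<beta> s\<close> lies between 0 and
  2 \<pi>, where \<open>Im_Ln_one_minus_cis\<close> applies; before \<open>s\<close> it does so
  after adding 2 \<pi>.\<close>

lemma sawtooth_eq:
  fixes \<beta> :: "real \<Rightarrow> real"
  assumes mono: "\<And>x y. x < y \<Longrightarrow> \<beta> x < \<beta> y" and per: "\<And>t. \<beta> (t + L) = \<beta> t + 2 * pi"
    and s: "s \<in> {0..<L}"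
    and f: "\<And>t. f t = Im (Ln (1 - exp (\<i> * complex_of_real (\<beta> t)) / exp (\<i> * complex_of_real (\<beta> s))))"
  shows "s < t \<Longrightarrow> t < L \<Longrightarrow> f t = (\<beta> t - \<beta> s - pi) / 2"
    and "0 \<le> t \<Longrightarrow> t < s \<Longrightarrow> f t = (\<beta> t - \<beta> s + pi) / 2"
proof -
  have f: "f t = Im (Ln (1 - exp (\<i> * complex_of_real (\<beta> t - \<beta> s))))" for t
    by (simp add: f exp_diff right_diff_distrib)
  show "f t = (\<beta> t - \<beta> s - pi) / 2" if "s < t" "t < L"
  proof -
    have "\<beta> t < \<beta> s + 2 * pi"
      using mono[of t "s + L"] per[of s] that s by simp
    then show ?thesis
      using mono[OF that(1)] by (simp only: f Im_Ln_one_minus_cis[of "\<beta> t - \<beta> s"])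
  qed
  show "f t = (\<beta> t - \<beta> s + pi) / 2" if "0 \<le> t" "t < s"
  proof -
    have "\<beta> s < \<beta> t + 2 * pi"
      using mono[of s "t + L"] per[of t] that s by simp
    moreover have "exp (\<i> * complex_of_real (\<beta> t - \<beta> s)) = exp (\<i> * complex_of_real (\<beta> t - \<beta> s + 2 * pi))"
      by (simp only: cis_conv_exp[symmetric]) (simp add: complex_eq_iff)
    ultimately have "f t = (\<beta> t - \<beta> s + 2 * pi - pi) / 2"
      using mono[OF that(2)] by (simp only: f Im_Ln_one_minus_cis[of "\<beta> t - \<beta> s + 2 * pi"])
    then show ?thesis
      by simp
  qed
qed

context
  fixes L :: real and \<beta> b :: "real \<Rightarrow> real" and s :: real
  assumes \<beta>: "\<And>t. (\<beta> has_real_derivative b t) (at t)" and b: "continuous_on UNIV b"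
    and pos: "\<And>t. b t > 0" and per: "\<And>t. \<beta> (t + L) = \<beta> t + 2 * pi"
    and s: "s \<in> {0..<L}"
begin

private lemma mono: "x < y \<Longrightarrow> \<beta> x < \<beta> y"
  by (erule DERIV_pos_imp_increasing) (use \<beta> pos in blast)

lemma sawtooth_integrable:
  "(\<lambda>t. Im (Ln (1 - exp (\<i> * complex_of_real (\<beta> t)) / exp (\<i> * complex_of_real (\<beta> s))))) integrable_on {0..L}"
proof -
  define f where "f = (\<lambda>t. Im (Ln (1 - exp (\<i> * complex_of_real (\<beta> t)) / exp (\<i> * complex_of_real (\<beta> s)))))"
  note eq = sawtooth_eq[of \<beta> L s f, OF mono per s fun_cong[OF f_def]]
  have "continuous_on S \<beta>" for S
    using \<beta> DERIV_isCont continuous_at_imp_continuous_on by blast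
  then have int: "(\<lambda>t. (\<beta> t - \<beta> s + r) / 2) integrable_on {p..q}" for p q r
    by (intro integrable_continuous_interval continuous_intros) auto
  have "f integrable_on {0..s}"
    using int[of pi 0 s] by (rule integrable_spike_finite[of "{s}", rotated 2]) (auto simp: eq)
  \<comment> \<open>At \<open>s\<close> the logarithm is taken at 0, and \<open>L\<close> is outside
    the range of the branch formula (for \<open>s = 0\<close> it is the vortex again); both points
    are discarded.\<close>
  moreover have "f integrable_on {s..L}"
    using int[of "- pi" s L] by (rule integrable_spike_finite[of "{s, L}", rotated 2]) (auto simp: eq)
  ultimately have "f integrable_on {0..L}"
    using s by (intro Henstock_Kurzweil_Integration.integrable_combine[of 0 s L]) auto
  then show ?thesis
    by (simp add: f_def)
qed

text \<open>The boundary phase of a single vortex is a sawtooth: its derivative is \<open>b / 2\<close> off the vortex,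
  where it jumps by \<open>- \<pi>\<close>.\<close>
lemma sawtooth_weak_derivative:
  assumes \<zeta>: "\<And>t. (\<zeta> has_real_derivative \<zeta>' t) (at t)" and \<zeta>': "continuous_on UNIV \<zeta>'" and \<zeta>_per: "\<And>t. \<zeta> (t + L) = \<zeta> t"
  shows "((\<lambda>t. Im (Ln (1 - exp (\<i> * complex_of_real (\<beta> t)) / exp (\<i> * complex_of_real (\<beta> s)))) * \<zeta>' t)
    has_integral (pi * \<zeta> s - integral {0..L} (\<lambda>t. b t * \<zeta> t) / 2)) {0..L}"
proof -
  define f where "f = (\<lambda>t. Im (Ln (1 - exp (\<i> * complex_of_real (\<beta> t)) / exp (\<i> * complex_of_real (\<beta> s)))))"
  note right = sawtooth_eq(1)[of \<beta> L s f, OF mono per s fun_cong[OF f_def]]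
  note left = sawtooth_eq(2)[of \<beta> L s f, OF mono per s fun_cong[OF f_def]]
  have b2: "continuous_on UNIV (\<lambda>t. b t / 2)"
    using b by (intro continuous_intros) auto
  have int_b: "(\<lambda>t. b t / 2 * \<zeta> t) integrable_on {p..q}" for p q
  proof -
    have "continuous_on UNIV \<zeta>"
      using \<zeta> DERIV_isCont continuous_at_imp_continuous_on by blast
    with b2 have "continuous_on UNIV (\<lambda>t. b t / 2 * \<zeta> t)"
      by (rule continuous_on_mult)
    then show ?thesis
      by (intro integrable_continuous_interval) (rule continuous_on_subset, auto)
  qed
  have "((\<lambda>t. (\<beta> t - \<beta> s + pi) / 2 * \<zeta>' t) has_integral
      ((\<beta> s - \<beta> s + pi) / 2 * \<zeta> s - (\<beta> 0 - \<beta> s + pi) / 2 * \<zeta> 0 - integral {0..s} (\<lambda>t. b t / 2 * \<zeta> t))) {0..s}"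
    using s by (intro product_rule_has_integral \<zeta> \<zeta>' b2) (auto intro!: derivative_eq_intros \<beta>)
  then have 1: "((\<lambda>t. f t * \<zeta>' t) has_integral
      ((\<beta> s - \<beta> s + pi) / 2 * \<zeta> s - (\<beta> 0 - \<beta> s + pi) / 2 * \<zeta> 0 - integral {0..s} (\<lambda>t. b t / 2 * \<zeta> t))) {0..s}"
    by (rule has_integral_spike_finite[of "{s}", rotated 2]) (auto simp: left)
  have "((\<lambda>t. (\<beta> t - \<beta> s - pi) / 2 * \<zeta>' t) has_integral
      ((\<beta> L - \<beta> s - pi) / 2 * \<zeta> L - (\<beta> s - \<beta> s - pi) / 2 * \<zeta> s - integral {s..L} (\<lambda>t. b t / 2 * \<zeta> t))) {s..L}"
    using s by (intro product_rule_has_integral \<zeta> \<zeta>' b2) (auto intro!: derivative_eq_intros \<beta>)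
  then have 2: "((\<lambda>t. f t * \<zeta>' t) has_integral
      ((\<beta> L - \<beta> s - pi) / 2 * \<zeta> L - (\<beta> s - \<beta> s - pi) / 2 * \<zeta> s - integral {s..L} (\<lambda>t. b t / 2 * \<zeta> t))) {s..L}"
    by (rule has_integral_spike_finite[of "{s, L}", rotated 2]) (auto simp: right)
  \<comment> \<open>By these relations the boundary terms at 0 and \<open>L\<close> cancel. The two
    one-sided terms at \<open>s\<close>, each \<open>pi / 2 * \<zeta> s\<close>, remain.\<close>
  have ends: "\<beta> L = \<beta> 0 + 2 * pi" "\<zeta> L = \<zeta> 0"
    using per[of 0] \<zeta>_per[of 0] by simp_all
  have comb: "integral {0..s} (\<lambda>t. b t / 2 * \<zeta> t) + integral {s..L} (\<lambda>t. b t / 2 * \<zeta> t)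
      = integral {0..L} (\<lambda>t. b t * \<zeta> t) / 2"
    using Henstock_Kurzweil_Integration.integral_combine[OF _ _ int_b, of 0 s L] s by simp
  have "((\<lambda>t. f t * \<zeta>' t) has_integral
      (((\<beta> s - \<beta> s + pi) / 2 * \<zeta> s - (\<beta> 0 - \<beta> s + pi) / 2 * \<zeta> 0 - integral {0..s} (\<lambda>t. b t / 2 * \<zeta> t))
       + ((\<beta> L - \<beta> s - pi) / 2 * \<zeta> L - (\<beta> s - \<beta> s - pi) / 2 * \<zeta> s - integral {s..L} (\<lambda>t. b t / 2 * \<zeta> t)))) {0..L}"
    using s by (intro has_integral_combine[OF _ _ 1 2]) auto
  moreover have "((\<beta> s - \<beta> s + pi) / 2 * \<zeta> s - (\<beta> 0 - \<beta> s + pi) / 2 * \<zeta> 0 - integral {0..s} (\<lambda>t. b t / 2 * \<zeta> t))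
       + ((\<beta> L - \<beta> s - pi) / 2 * \<zeta> L - (\<beta> s - \<beta> s - pi) / 2 * \<zeta> s - integral {s..L} (\<lambda>t. b t / 2 * \<zeta> t))
      = pi * \<zeta> s - integral {0..L} (\<lambda>t. b t * \<zeta> t) / 2"
    unfolding comb[symmetric] ends by (simp add: field_simps)
  ultimately show ?thesis
    by (simp only: f_def)
qed

end

text \<open>\<open>f\<close> is only gauge integrable, so its product with a bounded function is not
  integrable for free. For a monotone factor the second mean value theorem suffices, and a C^1
  function is the difference of the monotone functions \<open>h t + K * t\<close> and
  \<open>K * t\<close>.\<close>

lemma has_integral_zero_times_C1:
  fixes f h :: "real \<Rightarrow> real"
  assumes "a \<le> b" and f: "\<And>s. s \<in> {a..b} \<Longrightarrow> (f has_integral 0) {a..s}"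
    and h: "\<And>t. (h has_real_derivative h' t) (at t)" and h': "continuous_on UNIV h'"
  shows "((\<lambda>t. f t * h t) has_integral 0) {a..b}"
proof -
  have int: "f integrable_on {a..b}"
    using f[of b] \<open>a \<le> b\<close> by auto
  have zero: "integral {a..c} f = 0" "integral {c..b} f = 0" if "c \<in> {a..b}" for c
  proof -
    show "integral {a..c} f = 0"
      using f[OF that] by (simp add: integral_unique)
    moreover have "integral {a..b} f = 0"
      using f[of b] \<open>a \<le> b\<close> by (simp add: integral_unique)
    ultimately show "integral {c..b} f = 0"
      using Henstock_Kurzweil_Integration.integral_combine[of a c b f] int that by auto
  qed
  have mono: "((\<lambda>t. g t * f t) has_integral 0) {a..b}"
    if g: "\<And>x y. a \<le> x \<Longrightarrow> x \<le> y \<Longrightarrow> y \<le> b \<Longrightarrow> g x \<le> g y" for g :: "real \<Rightarrow> real"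
  proof -
    obtain c where c: "c \<in> {a..b}"
      "((\<lambda>x. g x * f x) has_integral (g a * integral {a..c} f + g b * integral {c..b} f)) {a..b}"
      by (rule second_mean_value_theorem_full[OF int \<open>a \<le> b\<close> g])
    then show ?thesis
      using zero[OF c(1)] by simp
  qed
  have "compact (h' ` {a..b})"
    using h' by (intro compact_continuous_image) (rule continuous_on_subset, auto)
  then have "bounded (h' ` {a..b})"
    by (rule compact_imp_bounded)
  then obtain K where K: "\<And>t. t \<in> {a..b} \<Longrightarrow> \<bar>h' t\<bar> \<le> K"
    unfolding bounded_iff by (metis imageI real_norm_def)
  then have "K \<ge> 0"
    using K[of a] \<open>a \<le> b\<close> by force
  have "((\<lambda>t. (h t + K * t) * f t) has_integral 0) {a..b}"
  proof (rule mono)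
    fix x y assume xy: "a \<le> x" "x \<le> y" "y \<le> b"
    show "h x + K * x \<le> h y + K * y"
    proof (rule DERIV_nonneg_imp_nondecreasing[OF xy(2)])
      fix t assume t: "x \<le> t" "t \<le> y"
      have "((\<lambda>t. h t + K * t) has_real_derivative h' t + K) (at t)"
        using h[of t] by (auto intro!: derivative_eq_intros)
      moreover have "0 \<le> h' t + K"
        using K[of t] t xy by auto
      ultimately show "\<exists>y. ((\<lambda>t. h t + K * t) has_real_derivative y) (at t) \<and> 0 \<le> y"
        by blast
    qed
  qed
  moreover have "((\<lambda>t. (K * t) * f t) has_integral 0) {a..b}"
    using \<open>K \<ge> 0\<close> by (intro mono) (auto intro: mult_left_mono)
  ultimately have "((\<lambda>t. (h t + K * t) * f t - (K * t) * f t) has_integral (0 - 0)) {a..b}"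
    by (rule has_integral_diff)
  then show ?thesis
    by (simp add: algebra_simps)
qed

text \<open>For f = \<kappa> - 1 the tangent equation says that f cos and f sin have vanishing
  indefinite integrals. Multiplying them by cos and sin and adding removes the rotation, so f itself
  has vanishing indefinite integral.\<close>

lemma unit_circle_curvature:
  assumes L: "L = 2 * pi" and \<gamma>: "\<And>t. \<gamma> t = exp (\<i> * complex_of_real (t + c))" and T: "\<And>t. T t = \<i> * \<gamma> t"
    and \<kappa>: "curvature_of L T \<kappa>"
    and \<zeta>: "\<And>t. (\<zeta> has_real_derivative \<zeta>' t) (at t)" and \<zeta>': "continuous_on UNIV \<zeta>'"
  shows "integral {0..L} (\<lambda>t. \<kappa> t * \<zeta> t) = integral {0..L} \<zeta>"
proof -
  have \<kappa>_int: "\<kappa> integrable_on {0..L}"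
    and \<kappa>_eq: "\<And>s. s \<in> {0..L} \<Longrightarrow> T s = T 0 + integral {0..s} (\<lambda>t. \<i> * complex_of_real (\<kappa> t) * T t)"
    using \<kappa> unfolding curvature_of_def by blast+
  have T_deriv: "(T has_vector_derivative \<i> * T t) (at t)" for t
  proof -
    have "((\<lambda>t. exp (\<i> * complex_of_real (t + c))) has_vector_derivative exp (\<i> * complex_of_real (t + c)) * \<i>) (at t)"
      by (rule derivative_eq_intros has_vector_derivative_real_field refl | simp)+
    from has_vector_derivative_mult_right[OF this, of "\<i>"] show ?thesis
      unfolding T[abs_def] \<gamma>[abs_def] by (simp only: mult.commute[of _ "\<i>"])
  qed
  define f where "f = (\<lambda>t. \<kappa> t - 1)"
  have zero: "((\<lambda>t. \<i> * complex_of_real (f t) * T t) has_integral 0) {0..s}" if s: "0 \<le> s" "s < L" for s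
  proof (cases "s = 0")
    case False
    \<comment> \<open>If the integrand were not integrable, its integral would be the default 0 and
      the curvature equation would force \<open>T s = T 0\<close>. This settles integrability for 0
      < s < L only, since the tangent closes up at \<open>L\<close>.\<close>
    have "T s \<noteq> T 0"
    proof
      assume "T s = T 0"
      then have "exp (\<i> * complex_of_real s) = 1"
        by (simp add: T \<gamma> distrib_left exp_add)
      then obtain n :: int where n: "s = of_int (2 * n) * pi"
        by (auto simp: exp_eq_1)
      then have "s = 2 * (of_int n * pi)"
        by simp
      then have "0 < of_int n * pi" "of_int n * pi < 1 * pi"
        using s False L by linarith+
      then have "0 < n" "n < 1"
        by (simp_all add: zero_less_mult_iff)
      then show False
        by simp
    qed
    then have "(\<lambda>t. \<i> * complex_of_real (\<kappa> t) * T t) integrable_on {0..s}"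
      using \<kappa>_eq[of s] s not_integrable_integral by fastforce
    then have "((\<lambda>t. \<i> * complex_of_real (\<kappa> t) * T t) has_integral (T s - T 0)) {0..s}"
      using \<kappa>_eq[of s] s by (simp add: has_integral_iff)
    moreover have "((\<lambda>t. \<i> * T t) has_integral (T s - T 0)) {0..s}"
      using s T_deriv by (intro fundamental_theorem_of_calculus) (auto intro: has_vector_derivative_at_within)
    ultimately have "((\<lambda>t. \<i> * complex_of_real (\<kappa> t) * T t - \<i> * T t) has_integral (T s - T 0) - (T s - T 0)) {0..s}"
      by (rule has_integral_diff)
    then show ?thesis
      by (simp add: f_def algebra_simps)
  qed (simp add: has_integral_refl)
  have rot: "\<i> * complex_of_real (f t) * T t = - complex_of_real (f t) * cis (t + c)" for t
  proof -
    have "\<gamma> t = cis (t + c)"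
      by (simp only: \<gamma> cis_conv_exp)
    then show ?thesis
      by (simp add: T complex_eq_iff)
  qed
  have cos0: "((\<lambda>t. f t * cos (t + c)) has_integral 0) {0..s}"
    and sin0: "((\<lambda>t. f t * sin (t + c)) has_integral 0) {0..s}" if "0 \<le> s" "s < L" for s
    using has_integral_neg[OF has_integral_Re[OF zero[OF that]]] has_integral_neg[OF has_integral_Im[OF zero[OF that]]]
    by (simp_all add: rot)
  have f0: "(f has_integral 0) {0..s}" if s: "0 \<le> s" "s < L" for s
  proof -
    have "((\<lambda>t. f t * cos (t + c) * cos (t + c)) has_integral 0) {0..s}"
      by (rule has_integral_zero_times_C1[where h' = "\<lambda>t. - sin (t + c)"])
         (use s cos0 in \<open>auto intro!: derivative_eq_intros continuous_intros\<close>)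
    moreover have "((\<lambda>t. f t * sin (t + c) * sin (t + c)) has_integral 0) {0..s}"
      by (rule has_integral_zero_times_C1[where h' = "\<lambda>t. cos (t + c)"])
         (use s sin0 in \<open>auto intro!: derivative_eq_intros continuous_intros\<close>)
    ultimately have "((\<lambda>t. f t * cos (t + c) * cos (t + c) + f t * sin (t + c) * sin (t + c)) has_integral 0 + 0) {0..s}"
      by (rule has_integral_add)
    moreover have "f t * cos (t + c) * cos (t + c) + f t * sin (t + c) * sin (t + c)
        = f t * ((sin (t + c))\<^sup>2 + (cos (t + c))\<^sup>2)" for t
      by (simp only: power2_eq_square algebra_simps)
    ultimately show ?thesis
      by simp
  qed
  have f_int: "f integrable_on {0..L}"
    unfolding f_def using \<kappa>_int by (intro integrable_diff) auto
  \<comment> \<open>The endpoint \<open>L\<close> is reached by continuity of the indefinite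
    integral, using that \<open>\<kappa>\<close> itself is integrable up to
    \<open>L\<close>.\<close>
  have f0': "(f has_integral 0) {0..s}" if "s \<in> {0..L}" for s
  proof (cases "s = L")
    case True
    have "continuous_on {0..L} (\<lambda>x. integral {0..x} f)"
      by (rule indefinite_integral_continuous_1[OF f_int])
    then have "((\<lambda>x. integral {0..x} f) \<longlongrightarrow> integral {0..L} f) (at L within {0..L})"
      using L by (auto simp: continuous_on)
    then have "((\<lambda>x. integral {0..x} f) \<longlongrightarrow> integral {0..L} f) (at_left L)"
      using L by (simp add: at_within_Icc_at_left)
    moreover have "\<forall>\<^sub>F x in at_left L. integral {0..x} f = 0"
    proof (rule eventually_mono)
      show "\<forall>\<^sub>F x in at_left L. x \<in> {0<..<L}"
        using eventually_at_left_real[of 0 L] L by simp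
      show "integral {0..x} f = 0" if "x \<in> {0<..<L}" for x
        using that by (intro integral_unique f0) auto
    qed
    ultimately have "((\<lambda>x. 0) \<longlongrightarrow> integral {0..L} f) (at_left L)"
      by (rule Lim_transform_eventually)
    then have "integral {0..L} f = 0"
      by (simp add: tendsto_const_iff)
    then show ?thesis
      using f_int True by (simp add: has_integral_iff)
  qed (use that f0 in auto)
  have "((\<lambda>t. f t * \<zeta> t) has_integral 0) {0..L}"
    using L by (intro has_integral_zero_times_C1[OF _ f0' \<zeta> \<zeta>']) auto
  moreover have "\<zeta> integrable_on {0..L}"
    using \<zeta> by (intro integrable_continuous_interval continuous_at_imp_continuous_on ballI DERIV_isCont)
  then have "(\<zeta> has_integral integral {0..L} \<zeta>) {0..L}"
    by (rule integrable_integral)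
  ultimately have "((\<lambda>t. f t * \<zeta> t + \<zeta> t) has_integral 0 + integral {0..L} \<zeta>) {0..L}"
    by (rule has_integral_add)
  then show ?thesis
    by (simp add: f_def algebra_simps integral_unique)
qed

text \<open>Boundary correspondence for the identity map: \<beta>' = 1, and the period follows from
  the increase of \<beta> by 2 \<pi>.\<close>

lemma disc_param:
  assumes "C11_boundary_param (ball 0 1) L \<gamma> T"
  obtains c where "L = 2 * pi" and "\<And>t. \<gamma> t = exp (\<i> * complex_of_real (t + c))" and "\<And>t. T t = \<i> * \<gamma> t"
proof -
  interpret C1_conformal_diffeo "ball 0 1" "\<lambda>z. z" "\<lambda>_. 1" "\<lambda>z. z" "\<lambda>_. 1"
    by unfold_locales (auto intro!: derivative_eq_intros)
  obtain \<beta> :: "real \<Rightarrow> real" where \<beta>: "\<And>t. \<gamma> t = exp (\<i> * complex_of_real (\<beta> t))"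
    "\<And>t. (\<beta> has_real_derivative 1) (at t)" "\<And>t. \<beta> (t + L) = \<beta> t + 2 * pi" "\<And>t. T t = \<i> * \<gamma> t"
    using boundary_correspondence[OF assms] by auto
  have "((\<lambda>t. \<beta> t - t) has_real_derivative 0) (at t)" for t
    using \<beta>(2)[of t] by (auto intro!: derivative_eq_intros)
  then have "\<beta> t - t = \<beta> 0 - 0" for t
    using DERIV_isconst_all[of "\<lambda>t. \<beta> t - t"] by blast
  then have lin: "\<beta> t = t + \<beta> 0" for t
    by (metis add.commute diff_add_cancel diff_zero)
  show ?thesis
  proof (rule that)
    show "L = 2 * pi"
      using \<beta>(3)[of 0] lin[of L] by simp
    show "\<gamma> t = exp (\<i> * complex_of_real (t + \<beta> 0))" for t
      using \<beta>(1)[of t] lin[of t] by simp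
  qed (rule \<beta>(4))
qed

section \<open>Phases on the circle with vanishing weak derivative\<close>

lemma finite_param_preimage:
  assumes "C11_boundary_param \<Omega> L \<gamma> T" and "finite A"
  shows "finite {t \<in> {0..L}. \<gamma> t \<in> A}"
proof -
  have "finite (\<gamma> -` A \<inter> {0..<L})"
    using finite_vimage_IntI[OF assms(2) param_inj[OF assms(1)]] .
  then show ?thesis
    by (rule finite_subset[rotated, OF finite.insertI[of _ L]]) auto
qed

lemma norm_exp_diff_power2:
  "(norm (exp (\<i> * complex_of_real x) - exp (\<i> * complex_of_real y)))\<^sup>2 = 2 - 2 * cos (x - y)"
proof -
  have "(norm (cis x - cis y))\<^sup>2 = (cos x - cos y)\<^sup>2 + (sin x - sin y)\<^sup>2"
    by (simp add: cmod_power2)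
  also have "\<dots> = ((sin x)\<^sup>2 + (cos x)\<^sup>2) + ((sin y)\<^sup>2 + (cos y)\<^sup>2) - 2 * (cos x * cos y + sin x * sin y)"
    by (simp only: power2_eq_square algebra_simps)
  also have "\<dots> = 2 - 2 * cos (x - y)"
    by (simp add: cos_diff)
  finally show ?thesis
    by (simp only: cis_conv_exp)
qed

text \<open>The test derivative is a bump at x2 minus its rotated copy at x1; equal masses make its
  primitive periodic. If D x2 > D x1, then D minus the midpoint has the sign of the bumps near both
  points, and the integral could not vanish. Exchanging the points yields equality.\<close>

lemma circle_du_Bois_Reymond:
  assumes param: "C11_boundary_param (ball 0 1) L \<gamma> T" and "finite A"
    and cont: "continuous_on (sphere 0 1 - A) D"
    and weak: "\<And>\<zeta> \<zeta>'. (\<And>t. (\<zeta> has_real_derivative \<zeta>' t) (at t)) \<Longrightarrow> continuous_on UNIV \<zeta>' \<Longrightarrow>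
      (\<And>t. \<zeta> (t + L) = \<zeta> t) \<Longrightarrow> ((\<lambda>t. D (\<gamma> t) * \<zeta>' t) has_integral 0) {0..L}"
    and x1: "x1 \<in> sphere 0 1 - A" and x2: "x2 \<in> sphere 0 1 - A"
  shows "D x2 \<le> (D x1 :: real)"
proof (rule ccontr)
  assume "\<not> D x2 \<le> D x1"
  \<comment> \<open>A quarter of the gap: where \<open>D\<close> varies by less than
    \<open>e\<close>, it stays above \<open>m + e\<close> near \<open>x2\<close> and below
    \<open>m - e\<close> near \<open>x1\<close>.\<close>
  define e where "e = (D x2 - D x1) / 4"
  define m where "m = (D x1 + D x2) / 2"
  have "e > 0"
    using \<open>\<not> D x2 \<le> D x1\<close> by (simp add: e_def)
  have m: "m = D x1 + 2 * e" "m = D x2 - 2 * e"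
    by (simp_all add: m_def e_def field_simps)
  obtain c where L: "L = 2 * pi" and \<gamma>: "\<And>t. \<gamma> t = exp (\<i> * complex_of_real (t + c))"
    using disc_param[OF param] by metis
  have near: "\<exists>\<delta>>0. \<forall>y\<in>sphere 0 1 - A. dist y x < \<delta> \<longrightarrow> \<bar>D y - D x\<bar> < e" if "x \<in> sphere 0 1 - A" for x
    using cont that \<open>e > 0\<close> unfolding continuous_on_iff dist_real_def by blast
  obtain \<delta>1 \<delta>2 where \<delta>12: "\<delta>1 > 0" "\<delta>2 > 0"
    "\<And>y. y \<in> sphere 0 1 - A \<Longrightarrow> dist y x1 < \<delta>1 \<Longrightarrow> \<bar>D y - D x1\<bar> < e"
    "\<And>y. y \<in> sphere 0 1 - A \<Longrightarrow> dist y x2 < \<delta>2 \<Longrightarrow> \<bar>D y - D x2\<bar> < e"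
    using near[OF x1] near[OF x2] by metis
  define \<delta> where "\<delta> = min \<delta>1 \<delta>2"
  have \<delta>: "\<delta> > 0"
    using \<delta>12 by (simp add: \<delta>_def)
  obtain t1 where t1: "t1 \<in> {0..<L}" "\<gamma> t1 = x1"
    using param_preimage[OF param, of x1] x1 by auto
  obtain t2 where t2: "t2 \<in> {0..<L}" "\<gamma> t2 = x2"
    using param_preimage[OF param, of x2] x2 by auto
  \<comment> \<open>The squared chord at angle u is 2 - 2 cos u, so \<open>B\<close> is positive
    exactly where the chord is shorter than \<open>\<delta>\<close>. Being a function of cos u, it
    is periodic.\<close>
  define B where "B = (\<lambda>u. max 0 (cos u - (1 - \<delta>\<^sup>2 / 2)))"
  have B_cont: "continuous_on UNIV B"
    unfolding B_def by (intro continuous_intros)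
  have B_nonneg: "B u \<ge> 0" for u
    by (simp add: B_def)
  have B_supp: "dist (\<gamma> t) (\<gamma> s) < \<delta>" if "B (t - s) \<noteq> 0" for s t
  proof -
    have "cos (t - s) > 1 - \<delta>\<^sup>2 / 2"
      using that by (auto simp: B_def max_def split: if_splits)
    moreover have "(dist (\<gamma> t) (\<gamma> s))\<^sup>2 = 2 - 2 * cos (t - s)"
      using norm_exp_diff_power2[of "t + c" "s + c"] by (simp add: \<gamma> dist_norm)
    ultimately have "(dist (\<gamma> t) (\<gamma> s))\<^sup>2 < \<delta>\<^sup>2"
      by simp
    then show ?thesis
      using \<delta> power2_less_imp_less by fastforce
  qed
  obtain F where F: "\<And>u. (F has_vector_derivative B u) (at u)"
    using continuous_antiderivative[OF B_cont] by blast
  then have F: "(F has_real_derivative B u) (at u)" for u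
    by (simp add: has_real_derivative_iff_has_vector_derivative)
  have F_shift: "((\<lambda>t. F (t + r)) has_real_derivative B (t + r)) (at t)" for t r
    using F[of "t + r"] by (simp add: DERIV_shift)
  have "((\<lambda>u. F (u + L) - F u) has_real_derivative B (u + L) - B u) (at u)" for u
    using F_shift[of L u] F[of u] by (intro DERIV_diff)
  moreover have "B (u + L) - B u = 0" for u
    by (simp add: B_def L)
  ultimately have F_per: "F (u + L) - F u = F (v + L) - F v" for u v
    using DERIV_isconst_all[of "\<lambda>u. F (u + L) - F u" u v] by simp
  define \<zeta> where "\<zeta> = (\<lambda>t. F (t + - t2) - F (t + - t1))"
  define \<psi> where "\<psi> = (\<lambda>t. B (t + - t2) - B (t + - t1))"
  have \<zeta>: "(\<zeta> has_real_derivative \<psi> t) (at t)" for t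
    unfolding \<zeta>_def \<psi>_def by (intro DERIV_diff F_shift)
  have B_shift: "continuous_on S (\<lambda>t. B (t + r))" for r S
    unfolding B_def by (intro continuous_intros)
  have \<psi>: "continuous_on UNIV \<psi>"
    unfolding \<psi>_def by (intro continuous_intros B_shift)
  have \<zeta>_per: "\<zeta> (t + L) = \<zeta> t" for t
    using F_per[of "t + - t2" "t + - t1"] by (simp add: \<zeta>_def algebra_simps)
  have "((\<lambda>t. D (\<gamma> t) * \<psi> t) has_integral 0) {0..L}"
    by (rule weak[OF \<zeta> \<psi> \<zeta>_per])
  moreover have "(\<psi> has_integral (\<zeta> L - \<zeta> 0)) {0..L}"
    using L \<zeta> by (intro fundamental_theorem_of_calculus)
      (auto simp: has_real_derivative_iff_has_vector_derivative intro: has_vector_derivative_at_within)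
  then have "((\<lambda>t. m * \<psi> t) has_integral m * (\<zeta> L - \<zeta> 0)) {0..L}"
    by (rule has_integral_mult_right)
  ultimately have "((\<lambda>t. D (\<gamma> t) * \<psi> t - m * \<psi> t) has_integral 0 - m * (\<zeta> L - \<zeta> 0)) {0..L}"
    by (rule has_integral_diff)
  then have "((\<lambda>t. (D (\<gamma> t) - m) * \<psi> t) has_integral 0) {0..L}"
    using \<zeta>_per[of 0] by (simp add: left_diff_distrib)
  \<comment> \<open>Nothing is known about \<open>D\<close> on \<open>A\<close>; at these finitely
    many parameters the integrand is replaced by the lower bound needed next.\<close>
  then have upper: "((\<lambda>t. if \<gamma> t \<in> A then e * B (t + - t2) else (D (\<gamma> t) - m) * \<psi> t) has_integral 0) {0..L}"
    by (rule has_integral_spike_finite[OF finite_param_preimage[OF param \<open>finite A\<close>], rotated]) auto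
  define J where "J = integral {0..L} (\<lambda>t. B (t + - t2))"
  have "((\<lambda>t. B (t + - t2)) has_integral J) {0..L}"
    unfolding J_def by (intro integrable_integral integrable_continuous_interval B_shift)
  then have "((\<lambda>t. e * B (t + - t2)) has_integral e * J) {0..L}"
    by (rule has_integral_mult_right)
  then have "e * J \<le> 0"
  proof (rule has_integral_le[OF _ upper])
    fix t
    show "e * B (t + - t2) \<le> (if \<gamma> t \<in> A then e * B (t + - t2) else (D (\<gamma> t) - m) * \<psi> t)"
    proof (cases "\<gamma> t \<in> A")
      case False
      have \<gamma>t: "\<gamma> t \<in> sphere 0 1 - A"
        using False param_in_frontier[OF param, of t] by simp
      have "e * B (t + - t2) \<le> (D (\<gamma> t) - m) * B (t + - t2)"
      proof (cases "B (t + - t2) = 0")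
        case nz: False
        then have "dist (\<gamma> t) x2 < \<delta>"
          using B_supp[of t t2] t2(2) by simp
        then have "dist (\<gamma> t) x2 < \<delta>2"
          by (simp add: \<delta>_def)
        from \<delta>12(4)[OF \<gamma>t this] have "e \<le> D (\<gamma> t) - m"
          using m(2) by linarith
        then show ?thesis
          using B_nonneg by (rule mult_right_mono)
      qed simp
      moreover have "(D (\<gamma> t) - m) * B (t + - t1) \<le> 0"
      proof (cases "B (t + - t1) = 0")
        case nz: False
        then have "dist (\<gamma> t) x1 < \<delta>"
          using B_supp[of t t1] t1(2) by simp
        then have "dist (\<gamma> t) x1 < \<delta>1"
          by (simp add: \<delta>_def)
        from \<delta>12(3)[OF \<gamma>t this] have "D (\<gamma> t) - m \<le> 0"
          using m(1) \<open>e > 0\<close> by linarith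
        then show ?thesis
          using B_nonneg by (rule mult_nonpos_nonneg)
      qed simp
      ultimately show ?thesis
        using False by (simp add: \<psi>_def right_diff_distrib)
    qed simp
  qed
  moreover have "J \<ge> 0"
    unfolding J_def by (intro integral_nonneg integrable_continuous_interval B_shift) (simp add: B_nonneg)
  ultimately have "J = 0"
    using \<open>e > 0\<close> by (simp add: mult_le_0_iff)
  then have "\<forall>t\<in>{0..L}. B (t + - t2) = 0"
    unfolding J_def using param_L_pos[OF param] B_nonneg by (subst (asm) integral_eq_0_iff[OF B_shift]) auto
  then have "B (t2 + - t2) = 0"
    using t2(1) by fastforce
  then show False
    using \<delta> by (simp add: B_def)
qed

text \<open>Up to an additive constant, modulo 2 \<pi>, the argument of the product of (z - a_j)^d_j
  away from the vortices, on a branch normalised to vanish at the origin.\<close>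

definition vortex_phase :: "nat \<Rightarrow> (nat \<Rightarrow> complex) \<Rightarrow> (nat \<Rightarrow> int) \<Rightarrow> complex \<Rightarrow> real" where
  "vortex_phase N a d z = (\<Sum>j=1..N. of_int (d j) * Im (Ln (1 - z / a j)))"

lemma continuous_on_vortex_phase:
  assumes "\<forall>j\<in>{1..N}. norm (a j) = 1"
  shows "continuous_on (cball 0 1 - a ` {1..N}) (vortex_phase N a d)"
  unfolding vortex_phase_def
proof (intro continuous_on_sum continuous_on_mult_left continuous_on_Im)
  fix j assume "j \<in> {1..N}"
  then show "continuous_on (cball 0 1 - a ` {1..N}) (\<lambda>z. Ln (1 - z / a j))"
    using assms by (intro continuous_on_subset[OF continuous_Ln_one_minus_divide]) auto
qed

lemma vortex_phase_eq_Im_holomorphic: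
  assumes "\<forall>j\<in>{1..N}. norm (a j) = 1"
  obtains F where "F holomorphic_on ball 0 1" and "\<And>z. vortex_phase N a d z = Im (F z)"
proof
  show "(\<lambda>z. \<Sum>j=1..N. of_int (d j) * Ln (1 - z / a j)) holomorphic_on ball 0 1"
    using assms by (intro holomorphic_intros holomorphic_Ln_one_minus_divide) auto
  show "vortex_phase N a d z = Im (\<Sum>j=1..N. of_int (d j) * Ln (1 - z / a j))" for z
    by (simp add: vortex_phase_def)
qed

lemma bounded_vortex_phase:
  assumes "\<forall>j\<in>{1..N}. norm (a j) = 1"
  shows "bounded (vortex_phase N a d ` ball 0 1)"
  unfolding bounded_iff
proof (intro exI ballI)
  fix y assume "y \<in> vortex_phase N a d ` ball 0 1"
  then obtain z where z: "z \<in> ball 0 1" and y: "y = vortex_phase N a d z"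
    by blast
  have "norm y \<le> (\<Sum>j=1..N. \<bar>of_int (d j)\<bar> * pi)"
    unfolding y vortex_phase_def
  proof (intro order_trans[OF norm_sum] sum_mono)
    fix j assume "j \<in> {1..N}"
    then have "1 - z / a j \<noteq> 0"
      using assms z by fastforce
    then have "\<bar>Im (Ln (1 - z / a j))\<bar> \<le> pi"
      using mpi_less_Im_Ln[of "1 - z / a j"] Im_Ln_le_pi[of "1 - z / a j"] by auto
    then show "norm (of_int (d j) * Im (Ln (1 - z / a j))) \<le> \<bar>of_int (d j)\<bar> * pi"
      by (simp add: abs_mult mult_left_mono)
  qed
  then show "norm y \<le> (\<Sum>j=1..N. \<bar>of_int (d j)\<bar> * pi)" .
qed

section \<open>Canonical harmonic maps in the disc\<close>

text \<open>The weak equation is stated with \<open>integral\<close>, which says nothing about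
  integrability. A gauge integrable function bounded off a finite set is absolutely integrable after
  correction there, and then the product is integrable too.\<close>

lemma integrable_bounded_times_continuous:
  fixes f h :: "real \<Rightarrow> real"
  assumes "f integrable_on {a..b}" and "finite X" and M: "\<And>t. t \<in> {a..b} - X \<Longrightarrow> \<bar>f t\<bar> \<le> M"
    and h: "continuous_on {a..b} h"
  shows "(\<lambda>t. f t * h t) integrable_on {a..b}"
proof -
  define f0 where "f0 = (\<lambda>t. if t \<in> X then 0 else f t)"
  have "f0 integrable_on {a..b}"
    using assms(1) by (rule integrable_spike_finite[OF assms(2), rotated]) (auto simp: f0_def)
  moreover have "norm (f0 t) \<le> max 0 M" if "t \<in> {a..b}" for t
    using M[of t] that by (auto simp: f0_def)
  moreover have "(\<lambda>t. max 0 M) integrable_on {a..b}"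
    by (rule integrable_const_ivl)
  ultimately have "f0 absolutely_integrable_on {a..b}"
    by (intro absolutely_integrable_integrable_bound)
  moreover have "h \<in> borel_measurable (lebesgue_on {a..b})"
    using h by (intro continuous_imp_measurable_on_sets_lebesgue) auto
  moreover have "bounded (h ` {a..b})"
    using h compact_continuous_image compact_imp_bounded compact_Icc by blast
  ultimately have "(\<lambda>t. h t * f0 t) absolutely_integrable_on {a..b}"
    by (intro absolutely_integrable_bounded_measurable_product_real) auto
  then have "(\<lambda>t. h t * f0 t) integrable_on {a..b}"
    using set_lebesgue_integral_eq_integral(1) by blast
  then show ?thesis
    by (rule integrable_spike_finite[OF assms(2), rotated]) (auto simp: f0_def mult.commute)
qed

text \<open>The two conclusions, with a single constant \<open>c\<close>, are all that the product
  formula and the transplantation need of \<open>m\<close>.\<close>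

lemma canonical_disc_phase:
  assumes canonical: "canonical_harmonic_map (ball 0 1) N a d m"
    and a: "\<forall>j\<in>{1..N}. norm (a j) = 1" and d: "(\<Sum>j=1..N. d j) = 2"
  obtains c where "\<forall>z\<in>ball 0 1. m z = exp (\<i> * complex_of_real (c + vortex_phase N a d z))"
    and "\<forall>x\<in>sphere 0 1 - a ` {1..N}.
      inner (exp (\<i> * complex_of_real (c + vortex_phase N a d x))) x = 0"
proof -
  define A where "A = a ` {1..N}"
  define E where "E = vortex_phase N a d"
  have A: "finite A" "A \<subseteq> sphere 0 1"
    using a by (auto simp: A_def)
  obtain L \<gamma> T \<kappa> s \<phi> \<phi>s where param: "C11_boundary_param (ball 0 1) L \<gamma> T" and \<kappa>: "curvature_of L T \<kappa>"
    and s: "\<And>j. j \<in> {1..N} \<Longrightarrow> s j \<in> {0..<L} \<and> \<gamma> (s j) = a j"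
    and \<phi>_int: "(\<lambda>t. \<phi> (\<gamma> t)) integrable_on {0..L}"
    and \<phi>_cont: "continuous_on (frontier (ball 0 1) - A) \<phi>"
    and perp: "\<And>x. x \<in> {0..L} \<Longrightarrow> \<gamma> x \<notin> A \<Longrightarrow>
        inner (exp (\<i> * complex_of_real (\<phi> (\<gamma> x)))) (- \<i> * T x) = 0"
    and weak: "\<And>\<zeta> \<zeta>'. (\<forall>t. (\<zeta> has_real_derivative \<zeta>' t) (at t)) \<and> continuous_on UNIV \<zeta>' \<and>
              (\<forall>t. \<zeta> (t + L) = \<zeta> t) \<Longrightarrow>
           integral {0..L} (\<lambda>t. \<phi> (\<gamma> t) * \<zeta>' t)
             = - integral {0..L} (\<lambda>t. \<kappa> t * \<zeta> t) + pi * (\<Sum>j=1..N. of_int (d j) * \<zeta> (s j))"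
    and harm: "harmonic_on \<phi>s (ball 0 1)" and bdd: "bounded (\<phi>s ` ball 0 1)"
    and lim: "\<And>x. x \<in> frontier (ball 0 1) - A \<Longrightarrow> (\<phi>s \<longlongrightarrow> \<phi> x) (at x within ball 0 1)"
    and m: "\<And>z. z \<in> ball 0 1 \<Longrightarrow> m z = exp (\<i> * complex_of_real (\<phi>s z))"
    using canonical unfolding canonical_harmonic_map_def A_def by blast
  have fr: "frontier (ball 0 1 :: complex set) = sphere 0 1"
    by simp
  obtain c0 where L: "L = 2 * pi" and \<gamma>: "\<And>t. \<gamma> t = exp (\<i> * complex_of_real (t + c0))"
    and T: "\<And>t. T t = \<i> * \<gamma> t"
    using disc_param[OF param] by metis
  define X where "X = {t \<in> {0..L}. \<gamma> t \<in> A}"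
  have "finite X"
    unfolding X_def by (rule finite_param_preimage[OF param A(1)])
  obtain M where M: "\<And>z. z \<in> ball 0 1 \<Longrightarrow> \<bar>\<phi>s z\<bar> \<le> M"
    using bdd unfolding bounded_iff by (metis imageI real_norm_def)
  \<comment> \<open>The boundary phase inherits the bound of its harmonic extension, of which it is
    a limit.\<close>
  have \<phi>_bd: "\<bar>\<phi> x\<bar> \<le> M" if "x \<in> sphere 0 1 - A" for x
  proof (rule tendsto_upperbound)
    show "((\<lambda>z. \<bar>\<phi>s z\<bar>) \<longlongrightarrow> \<bar>\<phi> x\<bar>) (at x within ball 0 1)"
      using lim that by (intro tendsto_rabs) (simp add: fr)
    show "\<forall>\<^sub>F z in at x within ball 0 1. \<bar>\<phi>s z\<bar> \<le> M"
      using M by (simp add: eventually_at_filter)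
    have "x islimpt ball 0 1"
      using that by (simp add: islimpt_ball)
    then show "at x within ball 0 1 \<noteq> bot"
      by (simp add: trivial_limit_within)
  qed
  have E_cont: "continuous_on (cball 0 1 - A) E"
    unfolding E_def A_def by (rule continuous_on_vortex_phase[OF a])
  define D where "D = (\<lambda>x. \<phi> x - E x)"
  have "D x2 \<le> D x1" if "x1 \<in> sphere 0 1 - A" "x2 \<in> sphere 0 1 - A" for x1 x2
  proof (rule circle_du_Bois_Reymond[OF param A(1) _ _ that])
    show "continuous_on (sphere 0 1 - A) D"
      unfolding D_def
    proof (rule continuous_on_diff)
      show "continuous_on (sphere 0 1 - A) \<phi>"
        using \<phi>_cont by (simp add: fr)
      show "continuous_on (sphere 0 1 - A) E"
        by (rule continuous_on_subset[OF E_cont]) auto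
    qed
    fix \<zeta> \<zeta>' :: "real \<Rightarrow> real"
    assume \<zeta>: "\<And>t. (\<zeta> has_real_derivative \<zeta>' t) (at t)" and \<zeta>': "continuous_on UNIV \<zeta>'"
      and per: "\<And>t. \<zeta> (t + L) = \<zeta> t"
    define I where "I = integral {0..L} \<zeta>"
    have "(\<lambda>t. \<phi> (\<gamma> t) * \<zeta>' t) integrable_on {0..L}"
    proof (rule integrable_bounded_times_continuous[OF \<phi>_int \<open>finite X\<close>])
      show "\<bar>\<phi> (\<gamma> t)\<bar> \<le> M" if "t \<in> {0..L} - X" for t
        using that param_in_frontier[OF param, of t] by (intro \<phi>_bd) (auto simp: X_def)
      show "continuous_on {0..L} \<zeta>'"
        using \<zeta>' continuous_on_subset by blast
    qed
    moreover have "integral {0..L} (\<lambda>t. \<phi> (\<gamma> t) * \<zeta>' t) = - I + pi * (\<Sum>j=1..N. of_int (d j) * \<zeta> (s j))"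
      using weak[of \<zeta> \<zeta>'] \<zeta> \<zeta>' per unit_circle_curvature[OF L \<gamma> T \<kappa> \<zeta> \<zeta>'] by (simp add: I_def)
    ultimately have 1: "((\<lambda>t. \<phi> (\<gamma> t) * \<zeta>' t) has_integral (- I + pi * (\<Sum>j=1..N. of_int (d j) * \<zeta> (s j)))) {0..L}"
      by (simp add: has_integral_iff)
    have "((\<lambda>t. Im (Ln (1 - \<gamma> t / a j)) * \<zeta>' t) has_integral (pi * \<zeta> (s j) - I / 2)) {0..L}"
      if j: "j \<in> {1..N}" for j
    proof -
      have "((\<lambda>t. t + c0) has_real_derivative 1) (at t)" for t
        by (auto intro!: derivative_eq_intros)
      then show ?thesis
        using sawtooth_weak_derivative[of "\<lambda>t. t + c0" "\<lambda>_. 1" L "s j" \<zeta> \<zeta>'] s[OF j] \<zeta> \<zeta>' per L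
        unfolding \<gamma>[symmetric] I_def by simp
    qed
    then have "((\<lambda>t. \<Sum>j=1..N. of_int (d j) * (Im (Ln (1 - \<gamma> t / a j)) * \<zeta>' t))
        has_integral (\<Sum>j=1..N. of_int (d j) * (pi * \<zeta> (s j) - I / 2))) {0..L}"
      by (intro has_integral_sum has_integral_mult_right) auto
    moreover have "(\<Sum>j=1..N. of_int (d j) * (Im (Ln (1 - \<gamma> t / a j)) * \<zeta>' t)) = E (\<gamma> t) * \<zeta>' t" for t
      by (simp add: E_def vortex_phase_def sum_distrib_right mult.assoc)
    moreover have "(\<Sum>j=1..N. of_int (d j) * (pi * \<zeta> (s j) - I / 2)) = - I + pi * (\<Sum>j=1..N. of_int (d j) * \<zeta> (s j))"
    proof -
      have "(\<Sum>j=1..N. of_int (d j) * (pi * \<zeta> (s j) - I / 2))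
          = pi * (\<Sum>j=1..N. of_int (d j) * \<zeta> (s j)) - of_int (\<Sum>j=1..N. d j) * (I / 2)"
        by (simp add: right_diff_distrib sum_subtractf sum_distrib_left sum_distrib_right mult_ac sum_divide_distrib)
      then show ?thesis
        unfolding d by simp
    qed
    ultimately have 2: "((\<lambda>t. E (\<gamma> t) * \<zeta>' t) has_integral (- I + pi * (\<Sum>j=1..N. of_int (d j) * \<zeta> (s j)))) {0..L}"
      by (simp only:)
    show "((\<lambda>t. D (\<gamma> t) * \<zeta>' t) has_integral 0) {0..L}"
      using has_integral_diff[OF 1 2] by (simp add: D_def left_diff_distrib)
  qed
  then have "\<exists>c. \<forall>x\<in>sphere 0 1 - A. D x = c"
    by (metis order_antisym)
  then obtain c where c: "\<And>x. x \<in> sphere 0 1 - A \<Longrightarrow> D x = c"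
    by blast
  then have \<phi>: "\<phi> x = c + E x" if "x \<in> sphere 0 1 - A" for x
    using that by (force simp: D_def)
  obtain F where F: "F holomorphic_on ball 0 1" "\<And>z. E z = Im (F z)"
    using vortex_phase_eq_Im_holomorphic[OF a] unfolding E_def by blast
  have \<phi>s: "\<phi>s z = c + E z" if "z \<in> ball 0 1" for z
  proof (rule bounded_harmonic_eq_if_boundary_eq[OF harm _ A bdd _ _ _ that])
    have "harmonic_on (\<lambda>z. Im (\<i> * complex_of_real c + F z)) (ball 0 1)"
      by (intro harmonic_on_Im holomorphic_intros F(1)) simp
    then show "harmonic_on (\<lambda>z. c + E z) (ball 0 1)"
      by (simp add: F(2))
    show "bounded ((\<lambda>z. c + E z) ` ball 0 1)"
      using bounded_translation[OF bounded_vortex_phase[OF a], of c d] by (simp add: E_def image_image)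
    show "(\<phi>s \<longlongrightarrow> \<phi> x) (at x within ball 0 1)" if "x \<in> sphere 0 1 - A" for x
      using lim that by (simp add: fr)
    show "((\<lambda>z. c + E z) \<longlongrightarrow> \<phi> x) (at x within ball 0 1)" if x: "x \<in> sphere 0 1 - A" for x
    proof -
      have "(E \<longlongrightarrow> E x) (at x within cball 0 1 - A)"
        using E_cont x by (auto simp: continuous_on)
      then have "(E \<longlongrightarrow> E x) (at x within ball 0 1)"
        by (rule tendsto_within_subset) (use A(2) in auto)
      then show ?thesis
        unfolding \<phi>[OF x] by (intro tendsto_intros)
    qed
  qed
  show ?thesis
  proof (rule that[of c])
    show "\<forall>z\<in>ball 0 1. m z = exp (\<i> * complex_of_real (c + vortex_phase N a d z))"
      using m \<phi>s by (simp add: E_def)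
    show "\<forall>x\<in>sphere 0 1 - a ` {1..N}. inner (exp (\<i> * complex_of_real (c + vortex_phase N a d x))) x = 0"
    proof
      fix x assume "x \<in> sphere 0 1 - a ` {1..N}"
      then have x: "x \<in> sphere 0 1 - A"
        by (simp add: A_def)
      then obtain t where t: "t \<in> {0..<L}" "\<gamma> t = x"
        using param_preimage[OF param, of x] by (auto simp: fr)
      then show "inner (exp (\<i> * complex_of_real (c + vortex_phase N a d x))) x = 0"
        using perp[of t] x \<phi>[OF x] T[of t] by (simp add: E_def)
    qed
  qed
qed

section \<open>From the phase to the product formula\<close>

lemma exp_Im_Ln:
  assumes "z \<noteq> 0"
  shows "exp (\<i> * complex_of_real (Im (Ln z))) = z / complex_of_real (norm z)"
proof -
  have "z = exp (complex_of_real (Re (Ln z)) + \<i> * complex_of_real (Im (Ln z)))"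
    using assms by (metis complex_eq exp_Ln)
  also have "\<dots> = complex_of_real (norm z) * exp (\<i> * complex_of_real (Im (Ln z)))"
    using assms by (simp add: exp_add exp_of_real)
  finally show ?thesis
    using assms by (metis nonzero_mult_div_cancel_left norm_eq_zero of_real_eq_0_iff)
qed

text \<open>Each factor comes from 1 - z / a = (- 1 / a) (z - a); the unimodular constants - 1 / a
  cancel in the comparison of two points.\<close>

lemma exp_vortex_phase:
  assumes "\<forall>j\<in>{1..N}. norm (a j) = 1" and "z \<notin> a ` {1..N}"
  shows "exp (\<i> * complex_of_real (vortex_phase N a d z))
    = (\<Prod>j=1..N. (- 1 / a j * ((z - a j) / complex_of_real (norm (z - a j)))) powi d j)"
proof -
  have "exp (\<i> * complex_of_real (vortex_phase N a d z))
      = (\<Prod>j=1..N. exp (of_int (d j) * (\<i> * complex_of_real (Im (Ln (1 - z / a j))))))"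
    by (simp add: vortex_phase_def sum_distrib_left exp_sum mult_ac)
  also have "\<dots> = (\<Prod>j=1..N. (- 1 / a j * ((z - a j) / complex_of_real (norm (z - a j)))) powi d j)"
  proof (rule prod.cong[OF refl])
    fix j assume j: "j \<in> {1..N}"
    have "a j \<noteq> 0"
      using assms(1) j by fastforce
    then have eq: "1 - z / a j = - 1 / a j * (z - a j)"
      by (simp add: field_simps)
    have "norm (1 - z / a j) = norm (z - a j)"
      unfolding eq using assms(1) j by (simp add: norm_mult norm_divide)
    moreover have "1 - z / a j \<noteq> 0"
      using assms(2) j \<open>a j \<noteq> 0\<close> by auto
    ultimately have "exp (\<i> * complex_of_real (Im (Ln (1 - z / a j))))
        = - 1 / a j * ((z - a j) / complex_of_real (norm (z - a j)))"
      using exp_Im_Ln[of "1 - z / a j"] eq by simp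
    then show "exp (of_int (d j) * (\<i> * complex_of_real (Im (Ln (1 - z / a j)))))
        = (- 1 / a j * ((z - a j) / complex_of_real (norm (z - a j)))) powi d j"
      by (simp only: exp_power_int[symmetric])
  qed
  finally show ?thesis .
qed

section \<open>Transplantation by a conformal map\<close>

lemma unit_orthogonal_complex:
  fixes w b :: complex
  assumes "norm w = 1" and "norm b = 1" and "inner w b = 0"
  shows "\<exists>\<sigma>\<in>{1, -1}. w = \<sigma> * \<i> * b"
proof -
  define y where "y = Im (w * cnj b)"
  have "Re (w * cnj b) = 0"
    using assms(3) by (simp add: inner_complex_def)
  then have wb: "w * cnj b = \<i> * complex_of_real y"
    by (simp add: y_def complex_eq_iff)
  have "\<bar>y\<bar> = norm (w * cnj b)"
    unfolding wb by (simp add: norm_mult)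
  then have "\<bar>y\<bar> = 1"
    using assms by (simp add: norm_mult)
  have "w = w * (b * cnj b)"
    using complex_norm_square[of b] assms(2) by simp
  also have "\<dots> = (w * cnj b) * b"
    by (simp add: mult_ac)
  finally have "w = complex_of_real y * \<i> * b"
    unfolding wb by (simp add: mult_ac)
  moreover have "y = 1 \<or> y = -1"
    using \<open>\<bar>y\<bar> = 1\<close> by linarith
  ultimately show ?thesis
    by auto
qed

text \<open>Dividing the expressions at \<open>z\<close> and at \<open>b\<close> eliminates
  \<open>c\<close> and the constants - 1 / a; what remains to be known is the value at
  \<open>b\<close>.\<close>

lemma vortex_phase_product:
  assumes a: "\<forall>j\<in>{1..N}. norm (a j) = 1"
    and z: "z \<notin> a ` {1..N}" and b: "b \<notin> a ` {1..N}"
  shows "exp (\<i> * complex_of_real (c + vortex_phase N a d z))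
    = exp (\<i> * complex_of_real (c + vortex_phase N a d b)) * (\<Prod>j=1..N.
        ((z - a j) / complex_of_real (norm (z - a j))
          * (complex_of_real (norm (b - a j)) / (b - a j))) powi d j)"
proof -
  have "exp (\<i> * complex_of_real (vortex_phase N a d z)) / exp (\<i> * complex_of_real (vortex_phase N a d b))
      = (\<Prod>j=1..N. (- 1 / a j * ((z - a j) / complex_of_real (norm (z - a j)))) powi d j
          / (- 1 / a j * ((b - a j) / complex_of_real (norm (b - a j)))) powi d j)"
    unfolding exp_vortex_phase[OF a z] exp_vortex_phase[OF a b] by (rule prod_dividef[symmetric])
  also have "\<dots> = (\<Prod>j=1..N. ((z - a j) / complex_of_real (norm (z - a j))
          * (complex_of_real (norm (b - a j)) / (b - a j))) powi d j)"
  proof (rule prod.cong[OF refl])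
    fix j assume j: "j \<in> {1..N}"
    have "a j \<noteq> 0"
      using a j by fastforce
    then show "(- 1 / a j * ((z - a j) / complex_of_real (norm (z - a j)))) powi d j
          / (- 1 / a j * ((b - a j) / complex_of_real (norm (b - a j)))) powi d j
        = ((z - a j) / complex_of_real (norm (z - a j)) * (complex_of_real (norm (b - a j)) / (b - a j))) powi d j"
      unfolding power_int_divide_distrib[symmetric] by simp
  qed
  finally show ?thesis
    by (simp add: distrib_left exp_add divide_eq_eq mult_ac)
qed

lemma exp_divide_norm: "exp z / complex_of_real (norm (exp z)) = exp (\<i> * complex_of_real (Im z))"
proof -
  have "exp z = complex_of_real (norm (exp z)) * exp (\<i> * complex_of_real (Im z))"
    unfolding norm_exp_eq_Re cis_conv_exp[symmetric] by (rule exp_eq_polar)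
  then show ?thesis
    by (metis exp_not_eq_zero nonzero_mult_div_cancel_left norm_eq_zero of_real_eq_0_iff)
qed

text \<open>Multiplication by \<open>w\<close> is a similarity, so tangency survives when phase and
  normal are rotated alike.\<close>

lemma inner_mult_right_complex: "inner (u * w) (v * w) = (norm w)\<^sup>2 * inner u (v :: complex)"
  unfolding cmod_power2 by (simp add: inner_complex_def power2_eq_square algebra_simps)

context C1_conformal_diffeo
begin

text \<open>Only the formula for \<open>m\<close> and tangency on the circle are used. The curvature
  of the target is the one from \<open>curvature_exists\<close> for the tangent angle
  \<open>\<theta>\<close>, so that integration by parts against it is available.\<close>

lemma canonical_transplant:
  assumes dom: "C11_domain \<Omega>" and a: "\<forall>j\<in>{1..N}. norm (a j) = 1" and d: "(\<Sum>j=1..N. d j) = 2"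
    and m: "\<forall>z\<in>ball 0 1. m z = exp (\<i> * complex_of_real (c + vortex_phase N a d z))"
    and perp: "\<forall>x\<in>sphere 0 1 - a ` {1..N}.
      inner (exp (\<i> * complex_of_real (c + vortex_phase N a d x))) x = 0"
  shows "canonical_harmonic_map \<Omega> N (\<lambda>j. \<Phi> (a j)) d
    (\<lambda>w. m (\<Psi> w) * deriv \<Phi> (\<Psi> w) / complex_of_real (norm (deriv \<Phi> (\<Psi> w))))"
proof -
  define E where "E = vortex_phase N a d"
  define A where "A = a ` {1..N}"
  define A' where "A' = (\<lambda>j. \<Phi> (a j)) ` {1..N}"
  obtain L \<gamma> T where param: "C11_boundary_param \<Omega> L \<gamma> T"
    using dom by (auto simp: C11_domain_def)
  have L: "L > 0"
    by (rule param_L_pos[OF param])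
  have cl: "\<gamma> t \<in> closure \<Omega>" for t
    using param_in_frontier[OF param] by (simp add: frontier_def)
  obtain \<beta> :: "real \<Rightarrow> real" where \<beta>: "\<And>t. \<Psi> (\<gamma> t) = exp (\<i> * complex_of_real (\<beta> t))"
    and \<beta>': "\<And>t. (\<beta> has_real_derivative 1 / norm (\<Phi>' (\<Psi> (\<gamma> t)))) (at t)"
    and \<beta>_per: "\<And>t. \<beta> (t + L) = \<beta> t + 2 * pi"
    and T: "\<And>t. T t = \<i> * \<Psi> (\<gamma> t) * \<Phi>' (\<Psi> (\<gamma> t)) / complex_of_real (norm (\<Phi>' (\<Psi> (\<gamma> t))))"
    using boundary_correspondence[OF param] by metis
  obtain l where l: "continuous_on (cball 0 1) l" "l holomorphic_on ball 0 1"
    "\<And>z. z \<in> cball 0 1 \<Longrightarrow> \<Phi>' z = exp (l z)"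
    using log_\<Phi>' by metis
  have \<Phi>'_unit: "\<Phi>' z / complex_of_real (norm (\<Phi>' z)) = exp (\<i> * complex_of_real (Im (l z)))"
    if "z \<in> cball 0 1" for z
    unfolding l(3)[OF that] by (rule exp_divide_norm)
  define g where "g = (\<lambda>t. \<Psi> (\<gamma> t))"
  define b where "b = (\<lambda>t. 1 / norm (\<Phi>' (g t)))"
  define \<alpha> where "\<alpha> = (\<lambda>t. Im (l (g t)))"
  \<comment> \<open>Arguments of the three factors in T = i g (\<Phi>'(g) / |\<Phi>'(g)|); the
    quarter turn is the factor i.\<close>
  define \<theta> where "\<theta> = (\<lambda>t. \<beta> t + pi / 2 + \<alpha> t)"
  have g_norm: "norm (g t) = 1" for t
    using norm_\<Psi>_frontier[OF param_in_frontier[OF param]] by (simp add: g_def)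
  have g_cball: "g t \<in> cball 0 1" for t
    using g_norm[of t] by simp
  have g_cont: "continuous_on UNIV g"
    unfolding g_def by (rule continuous_on_compose2[OF cont_\<Psi> param_continuous[OF param]]) (use cl in blast)
  have b_deriv: "(\<beta> has_real_derivative b t) (at t)" for t
    using \<beta>'[of t] by (simp add: b_def g_def)
  have b_pos: "b t > 0" for t
    using \<Phi>'_nonzero[OF g_cball] by (simp add: b_def)
  have b_cont: "continuous_on UNIV b"
  proof -
    have "continuous_on UNIV (\<lambda>t. \<Phi>' (g t))"
      by (rule continuous_on_compose2[OF cont_\<Phi>' g_cont]) (use g_cball in blast)
    then show ?thesis
      unfolding b_def using \<Phi>'_nonzero[OF g_cball] by (intro continuous_intros) auto
  qed
  have \<beta>_cont: "continuous_on UNIV \<beta>"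
    using b_deriv DERIV_isCont continuous_at_imp_continuous_on by blast
  have \<alpha>_cont: "continuous_on UNIV \<alpha>"
    unfolding \<alpha>_def by (intro continuous_on_Im continuous_on_compose2[OF l(1) g_cont]) (use g_cball in blast)
  have \<theta>_cont: "continuous_on UNIV \<theta>"
    unfolding \<theta>_def by (intro continuous_intros \<beta>_cont \<alpha>_cont)
  have T_\<theta>: "T t = exp (\<i> * complex_of_real (\<theta> t))" for t
  proof -
    have "T t = \<i> * g t * (\<Phi>' (g t) / complex_of_real (norm (\<Phi>' (g t))))"
      using T[of t] by (simp add: g_def)
    also have "\<dots> = \<i> * exp (\<i> * complex_of_real (\<beta> t)) * exp (\<i> * complex_of_real (\<alpha> t))"
      unfolding \<Phi>'_unit[OF g_cball] using \<beta>[of t] by (simp add: g_def \<alpha>_def)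
    also have "\<dots> = exp (\<i> * complex_of_real (\<beta> t)) * exp (\<i> * complex_of_real (pi / 2)) * exp (\<i> * complex_of_real (\<alpha> t))"
      using cis_conv_exp[of "pi / 2"] by (simp only: cis_pi_half mult.commute)
    finally show ?thesis
      by (simp only: \<theta>_def of_real_add distrib_left exp_add)
  qed
  obtain K where K: "\<And>s t. norm (T s - T t) \<le> K * \<bar>s - t\<bar>"
    using param_lipschitz[OF param] by blast
  obtain \<kappa> where \<kappa>: "curvature_of L T \<kappa>"
    and \<kappa>_parts: "\<forall>\<zeta> \<zeta>'. (\<forall>t. (\<zeta> has_real_derivative \<zeta>' t) (at t)) \<and> continuous_on UNIV \<zeta>' \<longrightarrow>
      ((\<lambda>t. \<kappa> t * \<zeta> t) has_integral
        (\<theta> L * \<zeta> L - \<theta> 0 * \<zeta> 0 - integral {0..L} (\<lambda>t. \<theta> t * \<zeta>' t))) {0..L}"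
    by (rule curvature_exists[OF L continuous_on_subset[OF \<theta>_cont subset_UNIV] K T_\<theta>]) (rule that)
  have "\<exists>s. s \<in> {0..<L} \<and> \<gamma> s = \<Phi> (a j)" if "j \<in> {1..N}" for j
    using param_preimage[OF param \<Phi>_sphere_frontier, of "a j"] a that by metis
  then obtain s where s: "\<And>j. j \<in> {1..N} \<Longrightarrow> s j \<in> {0..<L} \<and> \<gamma> (s j) = \<Phi> (a j)"
    by metis
  have exp_s: "exp (\<i> * complex_of_real (\<beta> (s j))) = a j" if "j \<in> {1..N}" for j
    using \<beta>[of "s j"] s[OF that] \<Psi>_\<Phi>[of "a j"] a that by simp
  \<comment> \<open>Defined on the closure off the vortices, this one formula serves both as
    boundary phase and as its harmonic extension.\<close>
  define \<phi> where "\<phi> = (\<lambda>w. c + E (\<Psi> w) + Im (l (\<Psi> w)))"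
  have not_A: "\<Psi> w \<in> cball 0 1 - A" if "w \<in> closure \<Omega> - A'" for w
    using \<Psi>_in_cball[of w] \<Phi>_\<Psi>[of w] that by (auto simp: A_def A'_def)
  have \<phi>_cont: "continuous_on (closure \<Omega> - A') \<phi>"
  proof -
    have \<Psi>_cont: "continuous_on (closure \<Omega> - A') \<Psi>"
      using cont_\<Psi> by (rule continuous_on_subset) auto
    have "continuous_on (closure \<Omega> - A') (\<lambda>w. E (\<Psi> w))"
      unfolding E_def
      by (rule continuous_on_compose2[OF continuous_on_vortex_phase[OF a] \<Psi>_cont]) (use not_A in \<open>auto simp: A_def\<close>)
    moreover have "continuous_on (closure \<Omega> - A') (\<lambda>w. l (\<Psi> w))"
      by (rule continuous_on_compose2[OF l(1) \<Psi>_cont]) (use not_A in auto)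
    ultimately show ?thesis
      unfolding \<phi>_def by (intro continuous_intros)
  qed
  have frontier_sub: "frontier \<Omega> - A' \<subseteq> closure \<Omega> - A'" "\<Omega> \<subseteq> closure \<Omega> - A'"
  proof -
    show "frontier \<Omega> - A' \<subseteq> closure \<Omega> - A'"
      by (auto simp: frontier_def)
    have "A' \<inter> \<Omega> = {}"
      using \<Phi>_sphere_frontier a open_\<Omega> by (force simp: A'_def frontier_def interior_open)
    then show "\<Omega> \<subseteq> closure \<Omega> - A'"
      using closure_subset by blast
  qed
  have \<phi>_\<gamma>: "\<phi> (\<gamma> t) = c + (\<Sum>j=1..N. of_int (d j) *
      Im (Ln (1 - exp (\<i> * complex_of_real (\<beta> t)) / exp (\<i> * complex_of_real (\<beta> (s j)))))) + \<alpha> t" for t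
    unfolding \<phi>_def E_def vortex_phase_def \<alpha>_def g_def \<beta>[symmetric] using exp_s \<beta> by simp
  have \<phi>_int: "(\<lambda>t. \<phi> (\<gamma> t)) integrable_on {0..L}"
    unfolding \<phi>_\<gamma>
  proof (intro integrable_add integrable_sum)
    show "\<alpha> integrable_on {0..L}"
      using \<alpha>_cont by (intro integrable_continuous_interval) (rule continuous_on_subset, auto)
    show "(\<lambda>t. of_int (d j) * Im (Ln (1 - exp (\<i> * complex_of_real (\<beta> t)) / exp (\<i> * complex_of_real (\<beta> (s j))))))
        integrable_on {0..L}" if "j \<in> {1..N}" for j
      using sawtooth_integrable[of \<beta> b L "s j", OF b_deriv b_cont b_pos \<beta>_per] s[OF that]
      by (intro integrable_on_mult_right) auto
  qed (auto intro: integrable_const_ivl)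
  have weak: "integral {0..L} (\<lambda>t. \<phi> (\<gamma> t) * \<zeta>' t)
      = - integral {0..L} (\<lambda>t. \<kappa> t * \<zeta> t) + pi * (\<Sum>j=1..N. of_int (d j) * \<zeta> (s j))"
    if \<zeta>: "\<And>t. (\<zeta> has_real_derivative \<zeta>' t) (at t)" and \<zeta>': "continuous_on UNIV \<zeta>'"
      and per: "\<And>t. \<zeta> (t + L) = \<zeta> t" for \<zeta> \<zeta>' :: "real \<Rightarrow> real"
  proof -
    define S where "S = (\<lambda>j t. Im (Ln (1 - exp (\<i> * complex_of_real (\<beta> t)) / exp (\<i> * complex_of_real (\<beta> (s j))))))"
    define I where "I = integral {0..L} (\<lambda>t. b t * \<zeta> t)"
    define J where "J = integral {0..L} (\<lambda>t. \<kappa> t * \<zeta> t)"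
    have \<zeta>L: "\<zeta> L = \<zeta> 0" and \<beta>L: "\<beta> L = \<beta> 0 + 2 * pi"
      using per[of 0] \<beta>_per[of 0] by simp_all
    have "g L = g 0"
      using param_periodic[OF param, of 0] by (simp add: g_def)
    then have \<theta>L: "\<theta> L = \<theta> 0 + 2 * pi"
      by (simp add: \<theta>_def \<alpha>_def \<beta>L)
    have "(\<zeta>' has_integral (\<zeta> L - \<zeta> 0)) {0..L}"
      using L \<zeta> by (intro fundamental_theorem_of_calculus)
        (auto simp: has_real_derivative_iff_has_vector_derivative intro: has_vector_derivative_at_within)
    from has_integral_mult_right[OF this, of c]
    have 1: "((\<lambda>t. c * \<zeta>' t) has_integral 0) {0..L}"
      by (simp add: \<zeta>L)
    have "((\<lambda>t. S j t * \<zeta>' t) has_integral (pi * \<zeta> (s j) - I / 2)) {0..L}" if "j \<in> {1..N}" for j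
      unfolding S_def I_def
      using sawtooth_weak_derivative[of \<beta> b L "s j" \<zeta> \<zeta>', OF b_deriv b_cont b_pos \<beta>_per _ \<zeta> \<zeta>' per] s[OF that] by blast
    then have "((\<lambda>t. \<Sum>j=1..N. of_int (d j) * (S j t * \<zeta>' t))
        has_integral (\<Sum>j=1..N. of_int (d j) * (pi * \<zeta> (s j) - I / 2))) {0..L}"
      by (intro has_integral_sum has_integral_mult_right) auto
    moreover have "(\<Sum>j=1..N. of_int (d j) * (pi * \<zeta> (s j) - I / 2)) = pi * (\<Sum>j=1..N. of_int (d j) * \<zeta> (s j)) - I"
    proof -
      have "(\<Sum>j=1..N. of_int (d j) * (pi * \<zeta> (s j) - I / 2))
          = pi * (\<Sum>j=1..N. of_int (d j) * \<zeta> (s j)) - of_int (\<Sum>j=1..N. d j) * (I / 2)"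
        by (simp add: right_diff_distrib sum_subtractf sum_distrib_left sum_distrib_right mult_ac sum_divide_distrib)
      then show ?thesis
        unfolding d by simp
    qed
    ultimately have 2: "((\<lambda>t. \<Sum>j=1..N. of_int (d j) * (S j t * \<zeta>' t))
        has_integral (pi * (\<Sum>j=1..N. of_int (d j) * \<zeta> (s j)) - I)) {0..L}"
      by (simp only:)
    have "continuous_on UNIV (\<lambda>t. \<theta> t * \<zeta>' t)"
      using \<theta>_cont \<zeta>' by (rule continuous_on_mult)
    then have "(\<lambda>t. \<theta> t * \<zeta>' t) integrable_on {0..L}"
      by (intro integrable_continuous_interval) (rule continuous_on_subset, auto)
    moreover have "J = \<theta> L * \<zeta> L - \<theta> 0 * \<zeta> 0 - integral {0..L} (\<lambda>t. \<theta> t * \<zeta>' t)"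
      unfolding J_def using \<kappa>_parts \<zeta> \<zeta>' by (intro integral_unique) blast
    then have "integral {0..L} (\<lambda>t. \<theta> t * \<zeta>' t) = 2 * pi * \<zeta> 0 - J"
      by (simp add: \<theta>L \<zeta>L algebra_simps)
    ultimately have 3: "((\<lambda>t. \<theta> t * \<zeta>' t) has_integral (2 * pi * \<zeta> 0 - J)) {0..L}"
      by (simp add: has_integral_iff)
    have "((\<lambda>t. (\<beta> t + pi / 2) * \<zeta>' t) has_integral
        ((\<beta> L + pi / 2) * \<zeta> L - (\<beta> 0 + pi / 2) * \<zeta> 0 - I)) {0..L}"
      unfolding I_def using L
      by (intro product_rule_has_integral \<zeta> \<zeta>' b_cont) (auto intro!: derivative_eq_intros b_deriv)
    moreover have "(\<beta> L + pi / 2) * \<zeta> L - (\<beta> 0 + pi / 2) * \<zeta> 0 - I = 2 * pi * \<zeta> 0 - I"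
      by (simp add: \<beta>L \<zeta>L algebra_simps)
    ultimately have 4: "((\<lambda>t. (\<beta> t + pi / 2) * \<zeta>' t) has_integral (2 * pi * \<zeta> 0 - I)) {0..L}"
      by (simp only:)
    \<comment> \<open>\<open>\<alpha>\<close> is known only to be continuous and is tested as
      \<open>\<theta>\<close> minus \<open>\<beta> + pi / 2\<close>. The terms 2 \<pi> \<zeta>(0),
      the total turning of both angles, cancel, and the remaining \<open>I\<close> cancels the one
      from the sawtooth sum, leaving the curvature term \<open>- J\<close>.\<close>
    have "((\<lambda>t. \<theta> t * \<zeta>' t - (\<beta> t + pi / 2) * \<zeta>' t) has_integral ((2 * pi * \<zeta> 0 - J) - (2 * pi * \<zeta> 0 - I))) {0..L}"
      by (rule has_integral_diff[OF 3 4])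
    then have "((\<lambda>t. \<alpha> t * \<zeta>' t) has_integral (I - J)) {0..L}"
      by (simp add: \<theta>_def algebra_simps)
    from has_integral_add[OF has_integral_add[OF 1 2] this]
    have "((\<lambda>t. c * \<zeta>' t + (\<Sum>j=1..N. of_int (d j) * (S j t * \<zeta>' t)) + \<alpha> t * \<zeta>' t)
        has_integral (- J + pi * (\<Sum>j=1..N. of_int (d j) * \<zeta> (s j)))) {0..L}"
      by simp
    moreover have "c * \<zeta>' t + (\<Sum>j=1..N. of_int (d j) * (S j t * \<zeta>' t)) + \<alpha> t * \<zeta>' t = \<phi> (\<gamma> t) * \<zeta>' t" for t
      unfolding \<phi>_\<gamma> S_def by (simp add: distrib_right sum_distrib_right mult.assoc)
    ultimately show ?thesis
      by (simp add: integral_unique J_def)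
  qed
  have orth: "inner (exp (\<i> * complex_of_real (\<phi> (\<gamma> x)))) (- \<i> * T x) = 0" if "\<gamma> x \<notin> A'" for x
  proof -
    define u where "u = exp (\<i> * complex_of_real (\<alpha> x))"
    have "g x \<in> sphere 0 1 - A"
      using not_A[of "\<gamma> x"] cl[of x] that g_norm[of x] by (simp add: g_def)
    then have "inner (exp (\<i> * complex_of_real (c + E (g x)))) (g x) = 0"
      using perp by (simp add: A_def E_def)
    moreover have "exp (\<i> * complex_of_real (\<phi> (\<gamma> x))) = exp (\<i> * complex_of_real (c + E (g x))) * u"
      by (simp add: \<phi>_def u_def \<alpha>_def g_def exp_add[symmetric] algebra_simps)
    moreover have "- \<i> * T x = g x * u"
    proof -
      have "T x = \<i> * g x * (\<Phi>' (g x) / complex_of_real (norm (\<Phi>' (g x))))"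
        using T[of x] by (simp add: g_def)
      then show ?thesis
        unfolding \<Phi>'_unit[OF g_cball] by (simp add: u_def \<alpha>_def mult.assoc)
    qed
    ultimately show ?thesis
      by (simp only: inner_mult_right_complex mult_zero_right)
  qed
  obtain F where F: "F holomorphic_on ball 0 1" "\<And>z. E z = Im (F z)"
    using vortex_phase_eq_Im_holomorphic[OF a] unfolding E_def by blast
  have harm: "harmonic_on \<phi> \<Omega>"
  proof -
    have "\<Psi> ` \<Omega> \<subseteq> ball 0 1"
      using \<Psi>_in_ball by blast
    then have "(\<lambda>w. F (\<Psi> w)) holomorphic_on \<Omega>" "(\<lambda>w. l (\<Psi> w)) holomorphic_on \<Omega>"
      using holomorphic_on_compose_gen[OF holomorphic_\<Psi> F(1)] holomorphic_on_compose_gen[OF holomorphic_\<Psi> l(2)]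
      by (simp_all add: o_def)
    then have "harmonic_on (\<lambda>w. Im (\<i> * complex_of_real c + F (\<Psi> w) + l (\<Psi> w))) \<Omega>"
      by (intro harmonic_on_Im holomorphic_intros open_\<Omega>)
    then show ?thesis
      by (simp add: \<phi>_def F(2))
  qed
  have bdd: "bounded (\<phi> ` \<Omega>)"
  proof -
    obtain M1 where M1: "\<And>z. z \<in> ball 0 1 \<Longrightarrow> \<bar>E z\<bar> \<le> M1"
      using bounded_vortex_phase[OF a, of d] unfolding bounded_iff E_def by (metis imageI real_norm_def)
    obtain M2 where M2: "\<And>z. z \<in> cball 0 1 \<Longrightarrow> norm (l z) \<le> M2"
      using compact_imp_bounded[OF compact_continuous_image[OF l(1) compact_cball]]
      unfolding bounded_iff by (metis imageI)
    have "norm (\<phi> w) \<le> \<bar>c\<bar> + M1 + M2" if "w \<in> \<Omega>" for w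
    proof -
      have "\<bar>Im (l (\<Psi> w))\<bar> \<le> M2"
        using abs_Im_le_cmod M2[of "\<Psi> w"] \<Psi>_in_ball[OF that] by (meson ball_subset_cball order_trans subsetD)
      then show ?thesis
        using M1[OF \<Psi>_in_ball[OF that]] by (simp add: \<phi>_def)
    qed
    then show ?thesis
      unfolding bounded_iff by blast
  qed
  have lim: "(\<phi> \<longlongrightarrow> \<phi> x) (at x within \<Omega>)" if "x \<in> frontier \<Omega> - A'" for x
  proof -
    have "(\<phi> \<longlongrightarrow> \<phi> x) (at x within closure \<Omega> - A')"
      using \<phi>_cont frontier_sub(1) that by (auto simp: continuous_on)
    then show ?thesis
      using frontier_sub(2) by (rule tendsto_within_subset)
  qed
  have map: "m (\<Psi> w) * deriv \<Phi> (\<Psi> w) / complex_of_real (norm (deriv \<Phi> (\<Psi> w))) = exp (\<i> * complex_of_real (\<phi> w))"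
    if "w \<in> \<Omega>" for w
  proof -
    have z: "\<Psi> w \<in> ball 0 1" "\<Psi> w \<in> cball 0 1"
      using \<Psi>_in_ball[OF that] by auto
    have "deriv \<Phi> (\<Psi> w) = \<Phi>' (\<Psi> w)"
      using deriv_\<Phi>_eq[OF z(1)] by (rule DERIV_imp_deriv)
    then have "m (\<Psi> w) * deriv \<Phi> (\<Psi> w) / complex_of_real (norm (deriv \<Phi> (\<Psi> w)))
        = exp (\<i> * complex_of_real (c + E (\<Psi> w))) * (\<Phi>' (\<Psi> w) / complex_of_real (norm (\<Phi>' (\<Psi> w))))"
      using m z(1) by (simp add: E_def)
    also have "\<dots> = exp (\<i> * complex_of_real (\<phi> w))"
      unfolding \<Phi>'_unit[OF z(2)] by (simp add: \<phi>_def exp_add[symmetric] algebra_simps)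
    finally show ?thesis .
  qed
  show ?thesis
    unfolding canonical_harmonic_map_def A'_def[symmetric]
  proof (intro conjI exI)
    show "C11_boundary_param \<Omega> L \<gamma> T" "curvature_of L T \<kappa>" "(\<lambda>t. \<phi> (\<gamma> t)) integrable_on {0..L}"
      "harmonic_on \<phi> \<Omega>" "bounded (\<phi> ` \<Omega>)" "C11_domain \<Omega>"
      using param \<kappa> \<phi>_int harm bdd dom by blast+
    show "\<forall>j\<in>{1..N}. s j \<in> {0..<L} \<and> \<gamma> (s j) = \<Phi> (a j)"
      using s by blast
    show "continuous_on (frontier \<Omega> - A') \<phi>"
      using \<phi>_cont frontier_sub(1) by (rule continuous_on_subset)
    show "\<forall>x\<in>{0..L}. \<gamma> x \<notin> A' \<longrightarrow> inner (exp (\<i> * complex_of_real (\<phi> (\<gamma> x)))) (- \<i> * T x) = 0"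
      using orth by blast
    show "\<forall>\<zeta> \<zeta>'. (\<forall>t. (\<zeta> has_real_derivative \<zeta>' t) (at t)) \<and> continuous_on UNIV \<zeta>' \<and>
              (\<forall>t. \<zeta> (t + L) = \<zeta> t) \<longrightarrow>
           integral {0..L} (\<lambda>t. \<phi> (\<gamma> t) * \<zeta>' t)
             = - integral {0..L} (\<lambda>t. \<kappa> t * \<zeta> t) + pi * (\<Sum>j=1..N. of_int (d j) * \<zeta> (s j))"
      using weak by blast
    show "\<forall>x\<in>frontier \<Omega> - A'. (\<phi> \<longlongrightarrow> \<phi> x) (at x within \<Omega>)"
      using lim by blast
    show "\<forall>z\<in>\<Omega>. m (\<Psi> z) * deriv \<Phi> (\<Psi> z) / complex_of_real (norm (deriv \<Phi> (\<Psi> z)))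
        = exp (\<i> * complex_of_real (\<phi> z))"
      using map by blast
  qed
qed

end

theorem theorem1p4:
  fixes N :: nat and a :: "nat \<Rightarrow> complex" and d :: "nat \<Rightarrow> int"
    and b :: complex and m :: "complex \<Rightarrow> complex"
  assumes "N \<ge> 1"
    and "inj_on a {1..N}"
    and "\<forall>j\<in>{1..N}. a j \<in> sphere 0 1"
    and "\<forall>j\<in>{1..N}. d j \<noteq> 0"
    and "(\<Sum>j=1..N. d j) = 2"
    and "b \<in> sphere 0 1" and "b \<notin> a ` {1..N}"
    and "canonical_harmonic_map (ball 0 1) N a d m"
  shows "(\<exists>\<sigma>\<in>{1, -1::complex}. \<forall>z\<in>ball 0 1.
            m z = \<sigma> * \<i> * b * (\<Prod>j=1..N.
               ((z - a j) / complex_of_real (norm (z - a j))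
                * (complex_of_real (norm (b - a j)) / (b - a j))) powi d j))
       \<and> (\<forall>(\<Omega>::complex set) (\<Phi>::complex \<Rightarrow> complex) (\<Psi>::complex \<Rightarrow> complex).
            C11_domain \<Omega> \<and>
            (\<exists>\<Phi>'. continuous_on (cball 0 1) \<Phi>' \<and>
               (\<forall>z\<in>cball 0 1. (\<Phi> has_field_derivative \<Phi>' z) (at z within cball 0 1) \<and> \<Phi>' z \<noteq> 0)) \<and>
            (\<exists>\<Psi>'. continuous_on (closure \<Omega>) \<Psi>' \<and>
               (\<forall>w\<in>closure \<Omega>. (\<Psi> has_field_derivative \<Psi>' w) (at w within closure \<Omega>))) \<and>
            \<Phi> ` cball 0 1 = closure \<Omega> \<and>
            (\<forall>z\<in>cball 0 1. \<Psi> (\<Phi> z) = z) \<and> (\<forall>w\<in>closure \<Omega>. \<Phi> (\<Psi> w) = w)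
          \<longrightarrow> canonical_harmonic_map \<Omega> N (\<lambda>j. \<Phi> (a j)) d
                (\<lambda>w. m (\<Psi> w) * deriv \<Phi> (\<Psi> w) / complex_of_real (norm (deriv \<Phi> (\<Psi> w)))))"
proof -
  have a: "\<forall>j\<in>{1..N}. norm (a j) = 1"
    using assms(3) by auto
  obtain c where m: "\<forall>z\<in>ball 0 1. m z = exp (\<i> * complex_of_real (c + vortex_phase N a d z))"
    and perp: "\<forall>x\<in>sphere 0 1 - a ` {1..N}.
      inner (exp (\<i> * complex_of_real (c + vortex_phase N a d x))) x = 0"
    by (rule canonical_disc_phase[OF assms(8) a assms(5)]) (rule that)
  show ?thesis
  proof (intro conjI allI impI)
    \<comment> \<open>The boundary phase is tangent at \<open>b\<close>, which is not a vortex; a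
      unit vector orthogonal to \<open>b\<close> is i b or - i b, and this determines the sign
      \<sigma>.\<close>
    define w where "w = exp (\<i> * complex_of_real (c + vortex_phase N a d b))"
    have "\<exists>\<sigma>\<in>{1, -1}. w = \<sigma> * \<i> * b"
      unfolding w_def by (rule unit_orthogonal_complex) (use assms(6,7) perp in auto)
    then obtain \<sigma> where \<sigma>: "\<sigma> \<in> {1, -1}" "w = \<sigma> * \<i> * b"
      by blast
    show "\<exists>\<sigma>\<in>{1, -1::complex}. \<forall>z\<in>ball 0 1. m z = \<sigma> * \<i> * b * (\<Prod>j=1..N.
               ((z - a j) / complex_of_real (norm (z - a j))
                * (complex_of_real (norm (b - a j)) / (b - a j))) powi d j)"
    proof (intro bexI[OF _ \<sigma>(1)] ballI)
      fix z :: complex assume z: "z \<in> ball 0 1"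
      show "m z = \<sigma> * \<i> * b * (\<Prod>j=1..N.
               ((z - a j) / complex_of_real (norm (z - a j))
                * (complex_of_real (norm (b - a j)) / (b - a j))) powi d j)"
        unfolding bspec[OF m z] \<sigma>(2)[symmetric] w_def
        by (rule vortex_phase_product[OF a _ assms(7)]) (use a z in force)
    qed
  next
    fix \<Omega> :: "complex set" and \<Phi> \<Psi> :: "complex \<Rightarrow> complex"
    assume H: "C11_domain \<Omega> \<and>
            (\<exists>\<Phi>'. continuous_on (cball 0 1) \<Phi>' \<and>
               (\<forall>z\<in>cball 0 1. (\<Phi> has_field_derivative \<Phi>' z) (at z within cball 0 1) \<and> \<Phi>' z \<noteq> 0)) \<and>
            (\<exists>\<Psi>'. continuous_on (closure \<Omega>) \<Psi>' \<and>
               (\<forall>w\<in>closure \<Omega>. (\<Psi> has_field_derivative \<Psi>' w) (at w within closure \<Omega>))) \<and>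
            \<Phi> ` cball 0 1 = closure \<Omega> \<and>
            (\<forall>z\<in>cball 0 1. \<Psi> (\<Phi> z) = z) \<and> (\<forall>w\<in>closure \<Omega>. \<Phi> (\<Psi> w) = w)"
    have dom: "C11_domain \<Omega>"
      using H by (elim conjE)
    have image: "\<Phi> ` cball 0 1 = closure \<Omega>"
      using H by (elim conjE)
    have inverse1: "\<forall>z\<in>cball 0 1. \<Psi> (\<Phi> z) = z"
      using H by (elim conjE)
    have inverse2: "\<forall>w\<in>closure \<Omega>. \<Phi> (\<Psi> w) = w"
      using H by (elim conjE)
    have "\<exists>\<Phi>'. continuous_on (cball 0 1) \<Phi>' \<and>
        (\<forall>z\<in>cball 0 1. (\<Phi> has_field_derivative \<Phi>' z) (at z within cball 0 1) \<and> \<Phi>' z \<noteq> 0)"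
      using H by (elim conjE)
    then obtain \<Phi>' where \<Phi>': "continuous_on (cball 0 1) \<Phi>'"
      "\<And>z. z \<in> cball 0 1 \<Longrightarrow> (\<Phi> has_field_derivative \<Phi>' z) (at z within cball 0 1)"
      "\<And>z. z \<in> cball 0 1 \<Longrightarrow> \<Phi>' z \<noteq> 0"
      by metis
    have "\<exists>\<Psi>'. continuous_on (closure \<Omega>) \<Psi>' \<and>
        (\<forall>w\<in>closure \<Omega>. (\<Psi> has_field_derivative \<Psi>' w) (at w within closure \<Omega>))"
      using H by (elim conjE)
    then obtain \<Psi>' where \<Psi>': "continuous_on (closure \<Omega>) \<Psi>'"
      "\<And>w. w \<in> closure \<Omega> \<Longrightarrow> (\<Psi> has_field_derivative \<Psi>' w) (at w within closure \<Omega>)"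
      by metis
    have "open \<Omega>" "bounded \<Omega>"
      using dom by (simp_all add: C11_domain_def)
    obtain L \<gamma> T where param: "C11_boundary_param \<Omega> L \<gamma> T"
      using dom by (auto simp: C11_domain_def)
    have "continuous_on (cball 0 1) \<Phi>" "continuous_on (closure \<Omega>) \<Psi>"
      using \<Phi>'(2) \<Psi>'(2) DERIV_continuous_on by blast+
    then have "\<Phi> ` ball 0 1 = \<Omega>"
      by (rule conformal_image_ball[OF param \<open>open \<Omega>\<close> \<open>bounded \<Omega>\<close> _ _ bspec[OF inverse1] bspec[OF inverse2] image])
    then interpret C1_conformal_diffeo \<Omega> \<Phi> \<Phi>' \<Psi> \<Psi>'
      using \<open>open \<Omega>\<close> \<Phi>' \<Psi>' bspec[OF inverse1] bspec[OF inverse2] image by unfold_locales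
    show "canonical_harmonic_map \<Omega> N (\<lambda>j. \<Phi> (a j)) d
                (\<lambda>w. m (\<Psi> w) * deriv \<Phi> (\<Psi> w) / complex_of_real (norm (deriv \<Phi> (\<Psi> w))))"
      by (rule canonical_transplant[OF dom a assms(5) m perp])
  qed
qed

end
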